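(* Let $M = M_{11}$ be the Mathieu group of degree $11$ (of order $7920$), acting transitively on a set $\Omega$ of $22$ points with point stabilizer isomorphic to the alternating group $A_6$ of degree $6$. Let $H = C_2 \wr M$ be the wreath product of the cyclic group $C_2$ of order $2$ with $M$ with respect to this action on $\Omega$, and let $G_{MacHale} = [H, H]$ be the derived subgroup of $H$. Then $|G_{MacHale}| = 16609443840$, and there is exactly one element of $G_{MacHale}$ which is not a commutator in $G_{MacHale}$.
   Context: An element $x$ of a group $G$ is a commutator (in $G$) if $x = a^{-1}b^{-1}ab$ for some $a, b \in G$; an element of $G$ that is not of this form is a noncommutator of $G$. The derived subgroup $[H,H]$ is the subgroup of $H$ generated by all commutators of $H$. The wreath product $C_2 \wr M$ is the permutational one: the semidirect product $C_2^{\Omega} \rtimes M$, where $M$ permutes the $22$ coordinates of $C_2^{\Omega}$ via its action on $\Omega$, so $|H| = 2^{22}\cdot 7920$. The action of $M$ on $\Omega$ is equivalent to the action of $M_{11}$ on the cosets of a subgroup isomorphic to $A_6$, which has index $22$. *)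

theory Defs
  imports
    "HOL-Algebra.Sym_Groups"
    "HOL-Algebra.Group_Action"
    "HOL-Algebra.Product_Groups"
    "HOL-Algebra.Elementary_Groups"
begin

text \<open>The usual generators of the Mathieu group of degree 11,
  acting on the points 1, ..., 11.\<close>

definition M11 :: "(nat \<Rightarrow> nat) monoid" where
  "M11 = subgroup_generated (sym_group 11)
     {cycle_of_list [1, 2, 3, 4, 5, 6, 7, 8, 9, 10, 11],
      cycle_of_list [3, 7, 11, 8] \<circ> cycle_of_list [4, 10, 5, 6]}"

text \<open>Permutational wreath product of \<open>A\<close> with \<open>M\<close>: here \<open>\<phi>\<close> is a left action of \<open>M\<close>
  on \<open>\<Omega>\<close>, and \<open>g\<close> sends the tuple \<open>f\<close> to \<open>\<lambda>\<omega>. f (g\<inverse> \<omega>)\<close>, so that the entry of \<open>f\<close>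
  at \<open>\<omega>\<close> is moved to the coordinate \<open>g \<omega>\<close>.\<close>

definition wreath_product ::
  "('a, 'x) monoid_scheme \<Rightarrow> ('g, 'y) monoid_scheme \<Rightarrow> 'b set \<Rightarrow> ('g \<Rightarrow> 'b \<Rightarrow> 'b)
     \<Rightarrow> (('b \<Rightarrow> 'a) \<times> 'g) monoid" where
  "wreath_product A M \<Omega> \<phi> =
     \<lparr>carrier = carrier (product_group \<Omega> (\<lambda>_. A)) \<times> carrier M,
      monoid.mult = (\<lambda>(f, g) (f', g').
        (f \<otimes>\<^bsub>product_group \<Omega> (\<lambda>_. A)\<^esub> (\<lambda>\<omega>\<in>\<Omega>. f' (\<phi> (inv\<^bsub>M\<^esub> g) \<omega>)), g \<otimes>\<^bsub>M\<^esub> g')),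
      one = (\<one>\<^bsub>product_group \<Omega> (\<lambda>_. A)\<^esub>, \<one>\<^bsub>M\<^esub>)\<rparr>"

definition derived_subgroup :: "('a, 'x) monoid_scheme \<Rightarrow> ('a, 'x) monoid_scheme" where
  "derived_subgroup G = G\<lparr>carrier := derived G (carrier G)\<rparr>"

definition is_commutator :: "('a, 'x) monoid_scheme \<Rightarrow> 'a \<Rightarrow> bool" where
  "is_commutator G x \<longleftrightarrow>
     (\<exists>a\<in>carrier G. \<exists>b\<in>carrier G. x = inv\<^bsub>G\<^esub> a \<otimes>\<^bsub>G\<^esub> inv\<^bsub>G\<^esub> b \<otimes>\<^bsub>G\<^esub> a \<otimes>\<^bsub>G\<^esub> b)"

definition MacHale_group ::
  "'b set \<Rightarrow> ((nat \<Rightarrow> nat) \<Rightarrow> 'b \<Rightarrow> 'b) \<Rightarrow> (('b \<Rightarrow> int) \<times> (nat \<Rightarrow> nat)) monoid" where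
  "MacHale_group \<Omega> \<phi> = derived_subgroup (wreath_product (integer_mod_group 2) M11 \<Omega> \<phi>)"

lemma group_M11: "group M11"
  unfolding M11_def by (intro group.group_subgroup_generated sym_group_is_group)

lemma group_wreath_product:
  assumes "group A" and "group_action M \<Omega> \<phi>"
  shows "group (wreath_product A M \<Omega> \<phi>)"
proof -
  interpret A: group A by fact
  interpret M: group_action M \<Omega> \<phi> by fact
  interpret Mg: group M using M.group_hom group_hom.axioms(1) by blast
  have el: "\<phi> g w \<in> \<Omega>" if "g \<in> carrier M" "w \<in> \<Omega>" for g w
    using M.element_image that by blast
  have comp: "\<phi> (g \<otimes>\<^bsub>M\<^esub> h) w = \<phi> g (\<phi> h w)"
    if "g \<in> carrier M" "h \<in> carrier M" "w \<in> \<Omega>" for g h w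
    using M.composition_rule that by blast
  have one: "\<phi> \<one>\<^bsub>M\<^esub> w = w" if "w \<in> \<Omega>" for w
    using M.id_eq_one that by (metis restrict_apply')
  have inv1: "\<phi> (inv\<^bsub>M\<^esub> g) (\<phi> g w) = w" "\<phi> g (\<phi> (inv\<^bsub>M\<^esub> g) w) = w"
    if "g \<in> carrier M" "w \<in> \<Omega>" for g w
    using comp[of "inv\<^bsub>M\<^esub> g" g w] comp[of g "inv\<^bsub>M\<^esub> g" w] one that by auto
  show ?thesis
  proof (rule groupI, goal_cases)
    case (1 x y)
    then show ?case
      by (auto simp: wreath_product_def PiE_iff el)
  next
    case 2
    then show ?case
      by (auto simp: wreath_product_def)
  next
    case (3 x y z)
    then show ?case
      by (auto simp: wreath_product_def PiE_iff el Mg.m_assoc Mg.inv_mult_group comp A.m_assoc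
          fun_eq_iff restrict_def)
  next
    case (4 x)
    then show ?case
      by (auto simp: wreath_product_def PiE_iff one fun_eq_iff extensional_def)
  next
    case (5 x)
    then obtain f g where x: "x = (f, g)" "f \<in> (\<Pi>\<^sub>E i\<in>\<Omega>. carrier A)" "g \<in> carrier M"
      by (auto simp: wreath_product_def)
    show ?case
      by (rule bexI[of _ "(\<lambda>w\<in>\<Omega>. inv\<^bsub>A\<^esub> f (\<phi> g w), inv\<^bsub>M\<^esub> g)"])
         (use x in \<open>auto simp: wreath_product_def PiE_iff el fun_eq_iff restrict_def extensional_def\<close>)
  qed
qed

end

theory Submission
  imports Defs
begin

text \<open>The action on 22 points is forced: a subgroup of order 360 of the sharply 4-transitive group
  \<open>M11\<close> has to fix one of the 11 points, so a point stabilizer has index 2 in the stabilizer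
  \<open>M10\<close> of that point, hence contains all squares of \<open>M10\<close>, and the squares determine the action.
  The 22 points thus form 11 columns of two points each.

  The derived subgroup consists of the \<open>(F, g)\<close> with \<open>F\<close> a set of points of even size. If
  \<open>g = x\<inverse> y\<inverse> x y\<close>, then the elements \<open>(F, g)\<close> that are commutators of some \<open>(u, x)\<close> and
  \<open>(v, y)\<close> form, up to a translation, the augmentation subspace of the even sets for \<open>\<langle>x, y\<rangle>\<close>. It
  consists of all sets that are even on the orbits of \<open>\<langle>x, y\<rangle>\<close> if two words in \<open>x\<close> and \<open>y\<close> with
  independent exponent parities have fixed points. For \<open>g \<noteq> id\<close> suitable pairs are given explicitly, up to
  conjugation, for the normal forms that 4-transitivity provides. For \<open>g = id\<close> an element of
  order 11 serves all \<open>F\<close> except unions of an odd number of columns; of these only \<open>UNIV\<close> is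
  not covered by an element with a fixed point. Finally, for commuting \<open>x\<close> and \<open>y\<close> there is a set of odd size
  that each of them either preserves or maps to its complement, and this functional
  separates \<open>UNIV\<close> from the augmentation subspace.\<close>

section \<open>A copy of the Mathieu group on 22 points\<close>

text \<open>Read sets of points as vectors over the field with two elements. Let V be the
  permutation module, E the even sets, and I the augmentation ideal of the group generated by
  \<open>x\<close> and \<open>y\<close>. Sets even on every orbit form I V. Commutators inside the
  derived subgroup have even entries only and so reach just I E = (1 + x) E + (1 + y) E. Modulo I E
  the set \<open>{i, z i}\<close> depends on \<open>z\<close> alone, and additively; so I V / I E is
  an image of the group that factors through the exponent parities, of rank at most two. Two
  independent words with fixed points make it zero.

  To exclude \<open>(UNIV, id)\<close>, a functional must kill I E; it need be invariant on E only,
  not on V. An even set meets \<open>w\<close> and its complement in the same parity, so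
  \<open>w\<close> may go to its complement. Without this, elements of order 8 would be out of
  reach: all their cycles on the 22 points are even, and they preserve no set of odd size.

  Elements are words in two generators, so that equations and orbits are decided by evaluation, and
  four columns identify an element.\<close>

datatype pt =
    P1 | P2 | P3 | P4 | P5 | P6 | P7 | P8 | P9 | P10 | P11
  | Q1 | Q2 | Q3 | Q4 | Q5 | Q6 | Q7 | Q8 | Q9 | Q10 | Q11

datatype letter = A | A' | B | B'

text \<open>\<open>permA\<close> and \<open>permB\<close> lift the two generators of
  \<open>M11\<close> to the 22 points, \<open>Pi\<close> and \<open>Qi\<close> lying over
  \<open>i\<close>. Their inverses are listed as well, so that inverting a word is a syntactic
  operation.\<close>

primrec permA :: "pt \<Rightarrow> pt" where
    "permA P1 = P2" | "permA P2 = P3" | "permA P3 = P4" | "permA P4 = P5"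
  | "permA P5 = P6" | "permA P6 = P7" | "permA P7 = P8" | "permA P8 = P9"
  | "permA P9 = P10" | "permA P10 = P11" | "permA P11 = P1" | "permA Q1 = Q2"
  | "permA Q2 = Q3" | "permA Q3 = Q4" | "permA Q4 = Q5" | "permA Q5 = Q6"
  | "permA Q6 = Q7" | "permA Q7 = Q8" | "permA Q8 = Q9" | "permA Q9 = Q10"
  | "permA Q10 = Q11" | "permA Q11 = Q1"

primrec permA' :: "pt \<Rightarrow> pt" where
    "permA' P1 = P11" | "permA' P2 = P1" | "permA' P3 = P2" | "permA' P4 = P3"
  | "permA' P5 = P4" | "permA' P6 = P5" | "permA' P7 = P6" | "permA' P8 = P7"
  | "permA' P9 = P8" | "permA' P10 = P9" | "permA' P11 = P10" | "permA' Q1 = Q11"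
  | "permA' Q2 = Q1" | "permA' Q3 = Q2" | "permA' Q4 = Q3" | "permA' Q5 = Q4"
  | "permA' Q6 = Q5" | "permA' Q7 = Q6" | "permA' Q8 = Q7" | "permA' Q9 = Q8"
  | "permA' Q10 = Q9" | "permA' Q11 = Q10"

primrec permB :: "pt \<Rightarrow> pt" where
    "permB P1 = Q1" | "permB P2 = Q2" | "permB P3 = P7" | "permB P4 = Q10"
  | "permB P5 = Q6" | "permB P6 = Q4" | "permB P7 = P11" | "permB P8 = P3"
  | "permB P9 = P9" | "permB P10 = Q5" | "permB P11 = P8" | "permB Q1 = P1"
  | "permB Q2 = P2" | "permB Q3 = Q7" | "permB Q4 = P10" | "permB Q5 = P6"
  | "permB Q6 = P4" | "permB Q7 = Q11" | "permB Q8 = Q3" | "permB Q9 = Q9"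
  | "permB Q10 = P5" | "permB Q11 = Q8"

primrec permB' :: "pt \<Rightarrow> pt" where
    "permB' P1 = Q1" | "permB' P2 = Q2" | "permB' P3 = P8" | "permB' P4 = Q6"
  | "permB' P5 = Q10" | "permB' P6 = Q5" | "permB' P7 = P3" | "permB' P8 = P11"
  | "permB' P9 = P9" | "permB' P10 = Q4" | "permB' P11 = P7" | "permB' Q1 = P1"
  | "permB' Q2 = P2" | "permB' Q3 = Q8" | "permB' Q4 = P6" | "permB' Q5 = P10"
  | "permB' Q6 = P5" | "permB' Q7 = Q3" | "permB' Q8 = Q11" | "permB' Q9 = Q9"
  | "permB' Q10 = P4" | "permB' Q11 = Q7"

primrec gen :: "letter \<Rightarrow> pt \<Rightarrow> pt" where
  "gen A = permA" | "gen A' = permA'" | "gen B = permB" | "gen B' = permB'"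

primrec ev :: "letter list \<Rightarrow> pt \<Rightarrow> pt" where
  "ev [] p = p"
| "ev (l # w) p = gen l (ev w p)"

text \<open>A column is represented by its \<open>P\<close> point, so that columns are points again
  and \<open>g\<close> moves a column \<open>c\<close> to \<open>col (g c)\<close>.\<close>

primrec col :: "pt \<Rightarrow> pt" where
    "col P1 = P1" | "col P2 = P2" | "col P3 = P3" | "col P4 = P4"
  | "col P5 = P5" | "col P6 = P6" | "col P7 = P7" | "col P8 = P8"
  | "col P9 = P9" | "col P10 = P10" | "col P11 = P11" | "col Q1 = P1"
  | "col Q2 = P2" | "col Q3 = P3" | "col Q4 = P4" | "col Q5 = P5"
  | "col Q6 = P6" | "col Q7 = P7" | "col Q8 = P8" | "col Q9 = P9"
  | "col Q10 = P10" | "col Q11 = P11"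

definition pts :: "pt list" where
  "pts = [P1, P2, P3, P4, P5, P6, P7, P8, P9, P10, P11,
          Q1, Q2, Q3, Q4, Q5, Q6, Q7, Q8, Q9, Q10, Q11]"

lemma set_pts: "set pts = UNIV"
proof -
  have "p \<in> set pts" for p
    by (cases p) (simp_all add: pts_def)
  then show ?thesis by blast
qed

lemma list_all_pts: "list_all P pts \<longleftrightarrow> (\<forall>p. P p)"
  by (simp add: list_all_iff set_pts)

instance pt :: finite
  by standard (metis set_pts List.finite_set)

lemma card_pt: "card (UNIV :: pt set) = 22"
proof -
  have "distinct pts" by code_simp
  moreover have "length pts = 22" by code_simp
  ultimately show ?thesis
    by (metis set_pts distinct_card)
qed

definition weq :: "letter list \<Rightarrow> letter list \<Rightarrow> bool" where
  "weq v w = list_all (\<lambda>p. ev v p = ev w p) pts"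

lemma weq_iff: "weq v w \<longleftrightarrow> ev v = ev w"
  by (auto simp: weq_def list_all_pts fun_eq_iff)

lemma ev_append: "ev (v @ w) = ev v \<circ> ev w"
  by (induction v) (auto simp: fun_eq_iff)

lemma ev_Nil: "ev [] = id"
  by (simp add: fun_eq_iff)

lemma ev_Cons: "ev (l # w) = gen l \<circ> ev w"
  by (simp add: fun_eq_iff)

primrec flip :: "letter \<Rightarrow> letter" where
  "flip A = A'" | "flip A' = A" | "flip B = B'" | "flip B' = B"

definition winv :: "letter list \<Rightarrow> letter list" where
  "winv w = rev (map flip w)"

lemma gen_flip: "gen l (gen (flip l) p) = p" "gen (flip l) (gen l p) = p"
  by (cases l; cases p; simp)+

lemma ev_winv: "ev (winv w) \<circ> ev w = id" "ev w \<circ> ev (winv w) = id"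
  by (induction w) (auto simp: winv_def ev_append fun_eq_iff gen_flip)

text \<open>\<open>N\<close> is a copy of the Mathieu group acting on 22 points, the orbits \<open>{Pi, Qi}\<close> of
  \<^const>\<open>col\<close> being a system of blocks on which it acts as on \<open>{1..11}\<close>.\<close>

definition N :: "(pt \<Rightarrow> pt) set" where
  "N = range ev"

lemma ev_in_N [simp, intro]: "ev w \<in> N"
  by (simp add: N_def)

lemma id_in_N [simp, intro]: "id \<in> N"
  using ev_in_N[of "[]"] by (simp only: ev_Nil)

lemma comp_in_N [intro]: "g \<in> N \<Longrightarrow> h \<in> N \<Longrightarrow> g \<circ> h \<in> N"
  by (metis (no_types, lifting) N_def ev_append ev_in_N imageE)

lemma N_inverse:
  assumes "g \<in> N"
  obtains g' where "g' \<in> N" "g' \<circ> g = id" "g \<circ> g' = id"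
  using assms ev_winv unfolding N_def by blast

lemma bij_N: "g \<in> N \<Longrightarrow> bij g"
  by (metis N_inverse o_bij)

lemma inj_N: "g \<in> N \<Longrightarrow> inj g"
  using bij_N bij_is_inj by blast

lemma finite_N [simp]: "finite N"
  by (rule finite_subset[OF subset_UNIV]) simp

lemma col_gen: "col (gen l (col p)) = col (gen l p)"
  by (cases l; cases p; simp)

lemma col_N: "g \<in> N \<Longrightarrow> col (g (col p)) = col (g p)"
proof -
  have "col (ev w (col p)) = col (ev w p)" for w
    by (induction w) (simp_all, cases p, simp_all, metis col_gen)
  then show "g \<in> N \<Longrightarrow> ?thesis" by (auto simp: N_def)
qed

abbreviation cols :: "pt set" where
  "cols \<equiv> {P1, P2, P3, P4, P5, P6, P7, P8, P9, P10, P11}"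

lemma range_col: "range col = cols"
proof -
  have "range col = set (map col pts)" by (simp add: set_pts)
  also have "\<dots> = cols" by (auto simp: pts_def)
  finally show ?thesis .
qed

lemma col_in_cols [simp]: "col p \<in> cols"
  using range_col by blast

lemma col_of_cols: "c \<in> cols \<Longrightarrow> col c = c"
  by auto

lemma col_col [simp]: "col (col p) = col p"
  by (cases p) simp_all

lemma card_cols: "card cols = 11"
  by simp

lemma col_N_inj:
  assumes "g \<in> N"
  shows "col (g p) = col (g q) \<longleftrightarrow> col p = col q"
proof
  obtain g' where g': "g' \<in> N" "g' \<circ> g = id" using N_inverse[OF assms] by metis
  assume "col (g p) = col (g q)"
  then have "col (g' (g p)) = col (g' (g q))" by (metis g'(1) col_N)
  then show "col p = col q" using g'(2) by (metis comp_apply id_apply)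
qed (metis assms col_N)

section \<open>Order and sharp 4-transitivity\<close>

text \<open>A stabilizer chain: \<open>Sk\<close> generates the stabilizer of the first \<open>k\<close> columns, and \<open>Uk\<close> is a
  transversal of the next stabilizer in it. The entries \<open>(i, h)\<close> of \<open>siftk\<close>, indexed by the pairs
  of a generator \<open>s\<close> and a representative \<open>u\<close>, say that \<open>s u\<close> is the \<open>i\<close>-th representative
  times the word \<open>h\<close> in the generators of the next stabilizer.\<close>

definition S0 :: "bool \<Rightarrow> letter list" where
  "S0 b = (if b then [A] else [B])"

definition S1 :: "bool \<Rightarrow> letter list" where
  "S1 b = (if b then [B] else [A',B,A])"

definition S2 :: "bool \<Rightarrow> letter list" where
  "S2 b = (if b then [B] else [A,B',A',B,A,B,A'])"

definition S3 :: "bool \<Rightarrow> letter list" where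
  "S3 b = (if b then [A',B',A',B,A,B,A,A] else [B',A,A,A,A,B',A,B',A])"

definition S4 :: "bool \<Rightarrow> letter list" where
  "S4 b = []"

definition U0 :: "letter list list" where
  "U0 = [
    [], [A], [A,A], [A,A,A], [A,A,A,A], [A,A,A,A,A], [A',A',A',A',A'], [A',A',A',A'],
    [A',A',A'], [A',A'], [A']]"

definition U1 :: "letter list list" where
  "U1 = [
    [], [B',A',B',A], [B,A',B,A], [B',A',B,A], [A',B,A], [A',B',A], [B,B,A',B',A],
    [A,B,A',B,A'], [A',B,B,A], [B,A',B',A]]"

definition U2 :: "letter list list" where
  "U2 = [
    [], [A,A,B',A,B',A',A'], [A,B',A',B,B,A,B,A'], [A,B',A',B,A,B,A'], [B], [B'],
    [A,A,B,A',B,A',A',B'], [A,A,B,A',B,A',A'], [B,B]]"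

definition U3 :: "letter list list" where
  "U3 = [
    [], [A',B,A',A',B,B,A,A,A,A], [A',B,A',B,A',A',A',A',B], [B',A,A,A,A,B',A,B',A],
    [A,B',A,A,A,B',A',B,A,A], [A',B',A',B,A,B,A,A], [B,A,A,B',A',A',B,A,A],
    [A',A',B',A',B',A,B,A]]"

definition sift0 :: "(nat \<times> bool list) list" where
  "sift0 = [
    (1, []), (2, []), (3, []), (4, []), (5, []), (6, []), (7, []), (8, []), (9, []),
    (10, []), (0, []), (0, [True]), (1, [False]),
    (6, [False, False, False, True, True, True, False, True, True, True]),
    (9, [False, True, False, False, False, True, False, False, False]),
    (5, [True, False, True, False, False, True, True, True, False, True, True]),
    (3, [True, False, False, True, False, False, False]),
    (10, [False, True, False, False, True, True, True, False]),
    (2, [False, False, True, True, False, True, False, True, False, True]),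
    (8, [False, False, False, True, False, True, False, True, True, False]),
    (4, [True, True, False, True, True, False, True, False, True]),
    (7, [False, True, False, True])]"

definition sift1 :: "(nat \<times> bool list) list" where
  "sift1 = [
    (0, [True]), (5, []), (8, [False, True, False, False]), (4, []), (2, []), (9, []),
    (1, []), (7, [True, True, False, True]), (3, [False, True, False, False, True, True]),
    (6, []), (4, []), (7, [False, True, False, True, False, True]),
    (3, [True, False, False]), (1, [False, False, True, False, True, True]), (8, []),
    (0, []), (6, [False, True, False, False]), (2, [False, True, True, True, False]),
    (5, []), (9, [False, False, False, True, False])]"

definition sift2 :: "(nat \<times> bool list) list" where
  "sift2 = [
    (4, []), (7, [True, True, True]), (3, [True, False]), (1, [False, True]), (8, []),
    (0, []), (6, [True, True, True]), (2, [True]), (5, []), (3, []), (0, [False]),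
    (1, [False, True, True]), (2, []), (8, [False, True]), (5, [False, True, True]),
    (7, [False, True]), (4, [True, False]), (6, [True, False])]"

definition sift3 :: "(nat \<times> bool list) list" where
  "sift3 = [
    (5, []), (2, []), (4, []), (1, []), (3, []), (6, []), (7, []), (0, []), (3, []),
    (5, []), (0, []), (6, []), (7, []), (4, []), (2, []), (1, [])]"

text \<open>Only products of generators, without inverses: in a finite group these already form the
  generated subgroup.\<close>

definition gp :: "(bool \<Rightarrow> letter list) \<Rightarrow> (pt \<Rightarrow> pt) set" where
  "gp S = range (\<lambda>h. ev (concat (map S h)))"

definition sift_ok ::
  "(bool \<Rightarrow> letter list) \<Rightarrow> letter list list \<Rightarrow> (bool \<Rightarrow> letter list) \<Rightarrow> (nat \<times> bool list) list \<Rightarrow> bool"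
where
  "sift_ok S U T cs \<longleftrightarrow>
     list_all2 (\<lambda>(b, u) (i, h). i < length U \<and> weq (S b @ u) (U ! i @ concat (map T h)))
       (List.product [True, False] U) cs"

lemma sift_okD:
  assumes "sift_ok S U T cs" "u \<in> set U"
  shows "\<exists>u'\<in>set U. \<exists>k\<in>gp T. ev (S b) \<circ> ev u = ev u' \<circ> k"
proof -
  have "(b, u) \<in> set (List.product [True, False] U)" using assms(2) by (cases b) auto
  then obtain j where j: "j < length (List.product [True, False] U)"
      "List.product [True, False] U ! j = (b, u)"
    by (metis in_set_conv_nth)
  obtain i h where ih: "cs ! j = (i, h)" by force
  have "i < length U \<and> weq (S b @ u) (U ! i @ concat (map T h))"
    using assms(1) j ih unfolding sift_ok_def list_all2_conv_all_nth by fastforce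
  then show ?thesis
    unfolding weq_iff ev_append gp_def by (intro bexI[of _ "U ! i"]) auto
qed

lemma gp_comp: "g \<in> gp T \<Longrightarrow> h \<in> gp T \<Longrightarrow> g \<circ> h \<in> gp T"
  unfolding gp_def by (auto simp flip: ev_append concat_append map_append)

lemma gp_id: "id \<in> gp T"
proof -
  have "ev (concat (map T [])) \<in> gp T" unfolding gp_def by blast
  then show ?thesis by (simp add: ev_Nil)
qed

text \<open>The products of a representative and an element of \<open>gp T\<close> contain the
  identity and, by the sifting entries, are closed under left multiplication by the
  generators.\<close>

lemma gp_factor:
  assumes "sift_ok S U T cs" "[] \<in> set U" "g \<in> gp S"
  shows "\<exists>u\<in>set U. \<exists>k\<in>gp T. g = ev u \<circ> k"
proof -
  have "\<exists>u\<in>set U. \<exists>k\<in>gp T. ev (concat (map S h)) = ev u \<circ> k" for h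
  proof (induction h)
    case Nil
    show ?case by (intro bexI[OF _ assms(2)] bexI[OF _ gp_id]) (simp add: ev_Nil)
  next
    case (Cons b h)
    then obtain u k where u: "u \<in> set U" and k: "k \<in> gp T" "ev (concat (map S h)) = ev u \<circ> k"
      by blast
    obtain u' k' where u': "u' \<in> set U" and k': "k' \<in> gp T" "ev (S b) \<circ> ev u = ev u' \<circ> k'"
      using sift_okD[OF assms(1) u] by blast
    have "ev (concat (map S (b # h))) = ev u' \<circ> (k' \<circ> k)"
      using k(2) k'(2) by (simp add: ev_append fun_eq_iff)
    then show ?case using u' gp_comp[OF k'(1) k(1)] by blast
  qed
  then show ?thesis using assms(3) unfolding gp_def by blast
qed

definition fixes_cols :: "pt list \<Rightarrow> (pt \<Rightarrow> pt) set" where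
  "fixes_cols ps = {g \<in> N. \<forall>p\<in>set ps. col (g p) = col p}"

definition level_ok :: "pt list \<Rightarrow> pt \<Rightarrow> letter list list \<Rightarrow> bool" where
  "level_ok ps p U \<longleftrightarrow> [] \<in> set U \<and> distinct (map (\<lambda>u. col (ev u p)) U)
     \<and> list_all (\<lambda>u. list_all (\<lambda>q. col (ev u q) = col q) ps) U"

lemma fixes_cols_comp: "g \<in> fixes_cols ps \<Longrightarrow> h \<in> fixes_cols ps \<Longrightarrow> g \<circ> h \<in> fixes_cols ps"
  unfolding fixes_cols_def by (auto simp: comp_in_N) (metis col_N)

text \<open>The representatives move \<open>p\<close> to distinct columns. So an element that fixes
  this column has representative \<open>[]\<close> and lies in \<open>gp T\<close>; the same
  distinctness makes the factorization unique, which gives the index.\<close>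

lemma fixes_cols_level:
  assumes ok: "sift_ok S U T cs" "level_ok ps p U"
    and sub: "fixes_cols ps \<subseteq> gp S"
    and T: "gp T \<subseteq> fixes_cols (p # ps)"
  shows "fixes_cols (p # ps) \<subseteq> gp T"
    and "card (fixes_cols ps) = length U * card (fixes_cols (p # ps))"
proof -
  have nil: "[] \<in> set U" and dist: "distinct (map (\<lambda>u. col (ev u p)) U)"
    and Ufix: "\<And>u. u \<in> set U \<Longrightarrow> ev u \<in> fixes_cols ps"
    using ok(2) by (auto simp: level_ok_def list_all_iff fixes_cols_def)
  have inj: "u = u'" if "u \<in> set U" "u' \<in> set U" "col (ev u p) = col (ev u' p)" for u u'
    using dist that by (auto simp: distinct_map inj_on_def)
  have fac: "\<exists>u\<in>set U. \<exists>k\<in>gp T. g = ev u \<circ> k" if "g \<in> fixes_cols ps" for g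
    using gp_factor[OF ok(1) nil] that sub by blast
  have colk: "col (ev u (k p)) = col (ev u p)" if "k \<in> fixes_cols (p # ps)" for u k
    using that by (simp add: fixes_cols_def col_N_inj[OF ev_in_N[of u]])
  show *: "fixes_cols (p # ps) \<subseteq> gp T"
  proof
    fix g assume g: "g \<in> fixes_cols (p # ps)"
    then have "g \<in> fixes_cols ps" by (auto simp: fixes_cols_def)
    then obtain u k where u: "u \<in> set U" and k: "k \<in> gp T" "g = ev u \<circ> k" using fac by blast
    have "col (ev u p) = col (g p)" using colk[of k u] k T by auto
    also have "\<dots> = col (ev [] p)" using g by (simp add: fixes_cols_def)
    finally have "u = []" using inj u nil by blast
    then show "g \<in> gp T" using k by (simp add: ev_Nil)
  qed
  have "bij_betw (\<lambda>(u, k). ev u \<circ> k) (set U \<times> fixes_cols (p # ps)) (fixes_cols ps)"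
    unfolding bij_betw_def
  proof
    show "inj_on (\<lambda>(u, k). ev u \<circ> k) (set U \<times> fixes_cols (p # ps))"
    proof (rule inj_onI, clarify)
      fix u k u' k'
      assume u: "u \<in> set U" "u' \<in> set U" and k: "k \<in> fixes_cols (p # ps)" "k' \<in> fixes_cols (p # ps)"
        and e: "ev u \<circ> k = ev u' \<circ> k'"
      have "col (ev u p) = col (ev u' p)"
        using colk[OF k(1), of u] colk[OF k(2), of u'] fun_cong[OF e, of p] by simp
      then have "u = u'" using inj u by blast
      then have "k = k'" using e inj_N[OF ev_in_N[of u]] by (auto simp: fun_eq_iff dest: injD)
      then show "u = u' \<and> k = k'" using \<open>u = u'\<close> by blast
    qed
    show "(\<lambda>(u, k). ev u \<circ> k) ` (set U \<times> fixes_cols (p # ps)) = fixes_cols ps"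
    proof
      have "fixes_cols (p # ps) \<subseteq> fixes_cols ps" by (auto simp: fixes_cols_def)
      then show "(\<lambda>(u, k). ev u \<circ> k) ` (set U \<times> fixes_cols (p # ps)) \<subseteq> fixes_cols ps"
        using Ufix fixes_cols_comp by fastforce
      show "fixes_cols ps \<subseteq> (\<lambda>(u, k). ev u \<circ> k) ` (set U \<times> fixes_cols (p # ps))"
        using fac T by fastforce
    qed
  qed
  then have "card (set U \<times> fixes_cols (p # ps)) = card (fixes_cols ps)"
    by (rule bij_betw_same_card)
  moreover have "card (set U) = length U"
    using dist by (simp add: distinct_map distinct_card)
  ultimately show "card (fixes_cols ps) = length U * card (fixes_cols (p # ps))"
    by (simp add: card_cartesian_product)
qed

lemma gp_fixes_cols:
  assumes "list_all (\<lambda>b. list_all (\<lambda>q. col (ev (T b) q) = col q) ps) [True, False]"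
  shows "gp T \<subseteq> fixes_cols ps"
proof -
  have T: "ev (T b) \<in> fixes_cols ps" for b
    using assms by (cases b) (auto simp: list_all_iff fixes_cols_def)
  have "ev (concat (map T h)) \<in> fixes_cols ps" for h
  proof (induction h)
    case Nil
    have "id \<in> fixes_cols ps" by (simp add: fixes_cols_def)
    then show ?case by (simp only: list.map concat.simps ev_Nil)
  next
    case (Cons b h)
    then show ?case
      by (simp only: list.map concat.simps ev_append fixes_cols_comp[OF T])
  qed
  then show ?thesis by (auto simp: gp_def)
qed

lemma N_subset_gp: "N \<subseteq> gp S0"
proof -
  have letter: "gen l \<in> gp S0" for l
  proof -
    have "ev (concat (map S0 h)) \<in> gp S0" for h unfolding gp_def by blast
    \<comment> \<open>\<open>permA\<close> has order 11 and \<open>permB\<close> order 4, so the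
      inverses are the powers 10 and 3.\<close>
    moreover have
      "ev [A] = ev (concat (map S0 [True]))"
      "ev [A'] = ev (concat (map S0 (replicate 10 True)))"
      "ev [B] = ev (concat (map S0 [False]))"
      "ev [B'] = ev (concat (map S0 [False, False, False]))"
      unfolding weq_iff[symmetric] by code_simp+
    ultimately have "ev [l] \<in> gp S0" by (cases l) metis+
    then show ?thesis by (simp add: ev_Cons ev_Nil)
  qed
  have "ev w \<in> gp S0" for w
  proof (induction w)
    case Nil
    show ?case unfolding ev_Nil by (rule gp_id)
  next
    case (Cons l w)
    then show ?case unfolding ev_Cons by (intro gp_comp letter)
  qed
  then show ?thesis by (auto simp: N_def)
qed

lemmas level0 = fixes_cols_level[of S0 U0 S1 sift0 "[]" P1]
lemmas level1 = fixes_cols_level[of S1 U1 S2 sift1 "[P1]" P2]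
lemmas level2 = fixes_cols_level[of S2 U2 S3 sift2 "[P2, P1]" P3]
lemmas level3 = fixes_cols_level[of S3 U3 S4 sift3 "[P3, P2, P1]" P4]

lemma sift_ok_levels:
  "sift_ok S0 U0 S1 sift0" "sift_ok S1 U1 S2 sift1" "sift_ok S2 U2 S3 sift2" "sift_ok S3 U3 S4 sift3"
  by code_simp+

lemma level_ok_levels:
  "level_ok [] P1 U0" "level_ok [P1] P2 U1" "level_ok [P2, P1] P3 U2" "level_ok [P3, P2, P1] P4 U3"
  by code_simp+

lemma gp_fixes_levels:
  "gp S1 \<subseteq> fixes_cols [P1]" "gp S2 \<subseteq> fixes_cols [P2, P1]"
  "gp S3 \<subseteq> fixes_cols [P3, P2, P1]" "gp S4 \<subseteq> fixes_cols [P4, P3, P2, P1]"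
  by (rule gp_fixes_cols; code_simp)+

lemma fixes_cols_Nil: "fixes_cols [] = N"
  by (simp add: fixes_cols_def)

lemma gp_S4: "gp S4 = {id}"
proof -
  have "concat (map S4 h) = []" for h by (induction h) (auto simp: S4_def)
  then show ?thesis by (simp only: gp_def ev_Nil) auto
qed

text \<open>The indices along the chain are 11, 10, 9 and 8. The bottom group is trivial on all 22
  points, so \<open>N\<close> is faithful on columns.\<close>

lemma fixes_base: "fixes_cols [P4, P3, P2, P1] = {id}"
  and card_N: "card N = 7920"
  and card_stab_P1: "card (fixes_cols [P1]) = 720"
proof -
  note l0 = level0[OF sift_ok_levels(1) level_ok_levels(1) _ gp_fixes_levels(1)]
  have s0: "fixes_cols [] \<subseteq> gp S0" using N_subset_gp by (simp add: fixes_cols_Nil)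
  note l1 = level1[OF sift_ok_levels(2) level_ok_levels(2) l0(1)[OF s0] gp_fixes_levels(2)]
  note l2 = level2[OF sift_ok_levels(3) level_ok_levels(3) l1(1) gp_fixes_levels(3)]
  note l3 = level3[OF sift_ok_levels(4) level_ok_levels(4) l2(1) gp_fixes_levels(4)]
  show *: "fixes_cols [P4, P3, P2, P1] = {id}"
    using l3(1) gp_fixes_levels(4) unfolding gp_S4 by blast
  have len: "length U0 = 11" "length U1 = 10" "length U2 = 9" "length U3 = 8"
    by code_simp+
  show **: "card (fixes_cols [P1]) = 720"
    using l1(2) l2(2) l3(2) by (simp add: * len)
  show "card N = 7920"
    using l0(2)[OF s0] by (simp add: ** len fixes_cols_Nil)
qed

definition base :: "(pt \<Rightarrow> pt) \<Rightarrow> pt list" where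
  "base g = map (\<lambda>p. col (g p)) [P1, P2, P3, P4]"

lemma base_inj:
  assumes "g \<in> N" "g' \<in> N" "base g = base g'"
  shows "g = g'"
proof -
  obtain k where k: "k \<in> N" "k \<circ> g = id" "g \<circ> k = id" using N_inverse[OF assms(1)] by metis
  have "col (k (g' p)) = col (k (g p))" if "p \<in> {P4, P3, P2, P1}" for p
    using that assms(3) col_N_inj[OF k(1)] by (auto simp: base_def)
  then have "k \<circ> g' \<in> fixes_cols [P4, P3, P2, P1]"
    using k assms by (auto simp: fixes_cols_def comp_in_N fun_eq_iff)
  then have "k \<circ> g' = id" unfolding fixes_base by blast
  then have "g \<circ> (k \<circ> g') = g" by simp
  then show ?thesis using k(3) by (simp flip: comp_assoc)
qed

text \<open>Injectivity and counting: there are 11 * 10 * 9 * 8 = 7920 quadruples of distinct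
  columns, as many as elements of \<open>N\<close>.\<close>

lemma bij_betw_base: "bij_betw base N {cs. length cs = 4 \<and> distinct cs \<and> set cs \<subseteq> cols}"
proof -
  let ?L = "{cs. length cs = 4 \<and> distinct cs \<and> set cs \<subseteq> cols}"
  have inj: "inj_on base N" by (auto intro: inj_onI base_inj)
  have sub: "base ` N \<subseteq> ?L"
  proof
    fix cs assume "cs \<in> base ` N"
    then obtain g where g: "g \<in> N" "cs = base g" by blast
    have "col (g p) \<in> cols" for p by (rule col_in_cols)
    moreover have "distinct (base g)"
      by (simp add: base_def col_N_inj[OF g(1)])
    ultimately show "cs \<in> ?L"
      unfolding g(2) by (simp add: base_def del: insert_iff)
  qed
  have "{11 - 4 + 1..11} = {8, 9, 10, 11 :: nat}" by auto
  then have "card ?L = 7920"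
    using card_lists_distinct_length_eq[of cols 4] unfolding card_cols by simp
  then have "card (base ` N) = card ?L"
    using card_image[OF inj] card_N by simp
  moreover have "finite ?L"
    by (rule finite_subset[OF _ finite_lists_length_eq[of cols 4]]) (blast, simp)
  ultimately have "base ` N = ?L" using sub card_subset_eq by blast
  then show ?thesis using inj by (simp add: bij_betw_def)
qed

lemma ex_base:
  assumes "distinct [c1, c2, c3, c4]" "{c1, c2, c3, c4} \<subseteq> cols"
  obtains g where "g \<in> N" "base g = [c1, c2, c3, c4]"
proof -
  have "[c1, c2, c3, c4] \<in> base ` N"
    using assms bij_betw_imp_surj_on[OF bij_betw_base] by auto
  then show thesis using that by (metis imageE)
qed

lemma eq_of_four_cols:
  assumes "g \<in> N" "g' \<in> N" "distinct [c1, c2, c3, c4]" "{c1, c2, c3, c4} \<subseteq> cols"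
    and "\<And>c. c \<in> {c1, c2, c3, c4} \<Longrightarrow> col (g c) = col (g' c)"
  shows "g = g'"
proof -
  obtain t where t: "t \<in> N" "base t = [c1, c2, c3, c4]" using ex_base assms(3,4) by metis
  have "col (g (t p)) = col (g' (t p))" if "p \<in> {P1, P2, P3, P4}" for p
  proof -
    have "col (t p) \<in> {c1, c2, c3, c4}" using that t(2) by (auto simp: base_def)
    then have "col (g (col (t p))) = col (g' (col (t p)))" by (rule assms(5))
    then show ?thesis by (simp only: col_N[OF assms(1)] col_N[OF assms(2)])
  qed
  then have "base (g \<circ> t) = base (g' \<circ> t)" by (simp add: base_def)
  then have e: "g \<circ> t = g' \<circ> t" using base_inj assms t by (meson comp_in_N)
  show ?thesis using e bij_N[OF t(1)] by (metis bij_is_surj surj_fun_eq)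
qed

section \<open>Identification with the Mathieu group\<close>

primrec num :: "pt \<Rightarrow> nat" where
  "num P1 = 1" | "num P2 = 2" | "num P3 = 3" | "num P4 = 4" | "num P5 = 5" | "num P6 = 6"
| "num P7 = 7" | "num P8 = 8" | "num P9 = 9" | "num P10 = 10" | "num P11 = 11"
| "num Q1 = 1" | "num Q2 = 2" | "num Q3 = 3" | "num Q4 = 4" | "num Q5 = 5" | "num Q6 = 6"
| "num Q7 = 7" | "num Q8 = 8" | "num Q9 = 9" | "num Q10 = 10" | "num Q11 = 11"

definition pnt :: "nat \<Rightarrow> pt" where
  "pnt n = pts ! (n - 1)"

definition down :: "(pt \<Rightarrow> pt) \<Rightarrow> nat \<Rightarrow> nat" where
  "down g n = (if n \<in> {1..11} then num (g (pnt n)) else n)"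

lemma atLeastAtMost_11: "{1..11} = {1, 2, 3, 4, 5, 6, 7, 8, 9, 10, 11 :: nat}"
  unfolding atLeastAtMost_upt by (simp add: upt_rec numeral_eq_Suc)

lemma num_pnt: "n \<in> {1..11} \<Longrightarrow> num (pnt n) = n"
  unfolding atLeastAtMost_11 by (auto simp: pnt_def pts_def)

lemma pnt_num: "pnt (num p) = col p"
  by (cases p) (simp_all add: pnt_def pts_def)

lemma num_col: "num (col p) = num p"
  by (cases p) simp_all

lemma num_eq_iff: "num p = num q \<longleftrightarrow> col p = col q"
  by (metis num_col pnt_num)

lemma num_range: "num p \<in> {1..11}"
  by (cases p) simp_all

lemma down_num: "g \<in> N \<Longrightarrow> down g (num p) = num (g p)"
  using num_range[of p] by (simp add: down_def pnt_num num_eq_iff col_N)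

lemma down_comp:
  assumes "g \<in> N" "h \<in> N" shows "down (g \<circ> h) = down g \<circ> down h"
proof
  fix n show "down (g \<circ> h) n = (down g \<circ> down h) n"
  proof (cases "n \<in> {1..11}")
    case True
    then obtain p where n: "n = num p" by (metis num_pnt)
    show ?thesis
      using down_num[OF comp_in_N[OF assms], of p] by (simp add: n down_num assms)
  qed (auto simp: down_def)
qed

lemma down_id: "down id = id"
  by (auto simp: down_def num_pnt fun_eq_iff)

lemma down_inj: "inj_on down N"
proof (rule inj_onI)
  fix g h assume g: "g \<in> N" and h: "h \<in> N" and e: "down g = down h"
  have "col (g p) = col (h p)" for p
    using down_num[OF g, of p] down_num[OF h, of p] e by (simp add: num_eq_iff)
  then show "g = h" using base_inj[OF g h] by (simp add: base_def)
qed

lemma down_permutes: "g \<in> N \<Longrightarrow> down g permutes {1..11}"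
proof -
  assume g: "g \<in> N"
  obtain k where k: "k \<in> N" "k \<circ> g = id" "g \<circ> k = id" using N_inverse[OF g] by metis
  have "bij (down g)"
    using down_comp[OF k(1) g] down_comp[OF g k(1)] k by (metis down_id o_bij)
  moreover have "down g n = n" if "n \<notin> {1..11}" for n
    using that by (simp add: down_def del: atLeastAtMost_iff)
  ultimately show ?thesis by (auto simp: permutes_def bij_iff)
qed

abbreviation M11_a :: "nat \<Rightarrow> nat" where
  "M11_a \<equiv> cycle_of_list [1, 2, 3, 4, 5, 6, 7, 8, 9, 10, 11]"

abbreviation M11_b :: "nat \<Rightarrow> nat" where
  "M11_b \<equiv> cycle_of_list [3, 7, 11, 8] \<circ> cycle_of_list [4, 10, 5, 6]"

lemma down_A: "down permA = M11_a"
proof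
  have *: "list_all (\<lambda>n. num (permA (pnt n)) = M11_a n) [1, 2, 3, 4, 5, 6, 7, 8, 9, 10, 11]"
    unfolding list.pred_inject by (intro conjI TrueI; simp add: pnt_def pts_def transpose_def)
  fix n show "down permA n = M11_a n"
  proof (cases "n \<in> {1..11}")
    case True
    moreover from this have "n \<in> set [1, 2, 3, 4, 5, 6, 7, 8, 9, 10, 11]"
      unfolding atLeastAtMost_11 by (simp only: list.set)
    ultimately have "num (permA (pnt n)) = M11_a n"
      using * unfolding list_all_iff by blast
    then show ?thesis using \<open>n \<in> {1..11}\<close> unfolding down_def by (simp only: if_True)
  next
    case False
    then show ?thesis
      by (subst id_outside_supp) (auto simp: down_def)
  qed
qed

lemma down_B: "down permB = M11_b"
proof
  have *: "list_all (\<lambda>n. num (permB (pnt n)) = M11_b n) [1, 2, 3, 4, 5, 6, 7, 8, 9, 10, 11]"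
    unfolding list.pred_inject by (intro conjI TrueI; simp add: pnt_def pts_def transpose_def)
  fix n show "down permB n = M11_b n"
  proof (cases "n \<in> {1..11}")
    case True
    moreover from this have "n \<in> set [1, 2, 3, 4, 5, 6, 7, 8, 9, 10, 11]"
      unfolding atLeastAtMost_11 by (simp only: list.set)
    ultimately have "num (permB (pnt n)) = M11_b n"
      using * unfolding list_all_iff by blast
    then show ?thesis using \<open>n \<in> {1..11}\<close> unfolding down_def by (simp only: if_True)
  next
    case False
    then have "cycle_of_list [4, 10, 5, 6] n = n" "cycle_of_list [3, 7, 11, 8] n = n"
      by (subst id_outside_supp; auto)+
    then show ?thesis using False by (auto simp: down_def)
  qed
qed

lemma gen_in_N: "gen l \<in> N"
  using ev_in_N[of "[l]"] by (simp add: ev_Cons ev_Nil del: ev_in_N)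

text \<open>The image of \<open>N\<close> under \<open>down\<close> is a subgroup that contains both
  generators; conversely each element of \<open>N\<close> is a product of \<open>permA\<close> and
  \<open>permB\<close>, and \<open>down\<close> is multiplicative.\<close>

lemma carrier_M11: "carrier M11 = down ` N"
  and mult_M11: "monoid.mult M11 = (\<circ>)"
  and one_M11: "one M11 = id"
proof -
  interpret S: group "sym_group 11" by (rule sym_group_is_group)
  have A: "permA \<in> N" and B: "permB \<in> N"
    using gen_in_N[of A] gen_in_N[of B] by simp_all
  have ab: "M11_a \<in> carrier (sym_group 11)" "M11_b \<in> carrier (sym_group 11)"
    using down_permutes[OF A] down_permutes[OF B] unfolding sym_group_carrier down_A down_B by blast+
  have c: "carrier M11 = generate (sym_group 11) {M11_a, M11_b}"
    using ab by (simp add: M11_def carrier_subgroup_generated Int_absorb1)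
  have sub: "subgroup (down ` N) (sym_group 11)"
  proof (rule S.subgroupI)
    show "down ` N \<subseteq> carrier (sym_group 11)"
      using down_permutes by (auto simp: sym_group_carrier)
    show "down ` N \<noteq> {}" using A by blast
    show "x \<otimes>\<^bsub>sym_group 11\<^esub> y \<in> down ` N" if xy: "x \<in> down ` N" "y \<in> down ` N" for x y
    proof -
      obtain g h where g: "g \<in> N" "h \<in> N" "x = down g" "y = down h"
        using xy by blast
      then show ?thesis unfolding sym_group_mult g(3,4) down_comp[OF g(1,2), symmetric]
        by (intro imageI comp_in_N)
    qed
    show "inv\<^bsub>sym_group 11\<^esub> x \<in> down ` N" if x: "x \<in> down ` N" for x
    proof -
      obtain g where g: "g \<in> N" "x = down g" using x by blast
      obtain k where k: "k \<in> N" "k \<circ> g = id" using N_inverse[OF g(1)] by metis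
      have "down k \<otimes>\<^bsub>sym_group 11\<^esub> x = \<one>\<^bsub>sym_group 11\<^esub>"
        unfolding sym_group_mult sym_group_one g(2)
        by (simp add: down_comp[OF k(1) g(1), symmetric] k(2) down_id)
      then have "inv\<^bsub>sym_group 11\<^esub> x = down k"
        using S.inv_equality down_permutes k(1) g by (auto simp: sym_group_carrier)
      then show ?thesis using k(1) by blast
    qed
  qed
  show "carrier M11 = down ` N"
  proof
    show "carrier M11 \<subseteq> down ` N" unfolding c
      by (rule S.generate_subgroup_incl[OF _ sub]) (use A B down_A down_B in force)
    have gp: "down g \<in> generate (sym_group 11) {M11_a, M11_b}" if "g \<in> gp S0" for g
    proof -
      have "down (ev (concat (map S0 h))) \<in> generate (sym_group 11) {M11_a, M11_b}" for h
      proof (induction h)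
        case Nil
        show ?case using generate.one[of "sym_group 11"]
          by (simp only: list.map concat.simps ev_Nil down_id sym_group_one)
      next
        case (Cons b h)
        have "down (ev (S0 b)) = (if b then M11_a else M11_b)"
          by (cases b) (simp_all only: S0_def if_True if_False ev_Cons ev_Nil comp_id gen.simps down_A down_B)
        then have "down (ev (S0 b)) \<in> generate (sym_group 11) {M11_a, M11_b}"
          by (auto intro: generate.incl)
        from generate.eng[OF this Cons] show ?case
          by (simp only: list.map concat.simps ev_append down_comp[OF ev_in_N ev_in_N] sym_group_mult)
      qed
      then show ?thesis using that unfolding gp_def by blast
    qed
    then show "down ` N \<subseteq> carrier M11" using N_subset_gp unfolding c by blast
  qed
  show "monoid.mult M11 = (\<circ>)" "one M11 = id"
    by (simp_all add: M11_def subgroup_generated_def sym_group_mult sym_group_one)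
qed

section \<open>The action on 22 points\<close>

text \<open>\<open>rep p\<close> maps \<open>P1\<close> to \<open>p\<close>, and the Schreier generator for \<open>p\<close> and the letter \<open>B\<close> is
  the square of \<open>root p\<close>; those for the letter \<open>A\<close> are trivial.\<close>

primrec rep :: "pt \<Rightarrow> letter list" where
  "rep P1 = []" | "rep P2 = [A]" | "rep P3 = [A,A]"
| "rep P4 = [A,A,A]" | "rep P5 = [A,A,A,A]" | "rep P6 = [A,A,A,A,A]"
| "rep P7 = [A',A',A',A',A']" | "rep P8 = [A',A',A',A']" | "rep P9 = [A',A',A']"
| "rep P10 = [A',A']" | "rep P11 = [A']" | "rep Q1 = [B]"
| "rep Q2 = [A,B]" | "rep Q3 = [A,A,B]" | "rep Q4 = [A,A,A,B]"
| "rep Q5 = [A,A,A,A,B]" | "rep Q6 = [A,A,A,A,A,B]" | "rep Q7 = [A',A',A',A',A',B]"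
| "rep Q8 = [A',A',A',A',B]" | "rep Q9 = [A',A',A',B]" | "rep Q10 = [A',A',B]"
| "rep Q11 = [A',B]"

primrec root :: "pt \<Rightarrow> letter list" where
  "root P1 = []" | "root P2 = [A',B',A,B,A',B',A,B]" | "root P3 = [B,A',B',A,B,A',B,A]"
| "root P4 = [B,A,B,A',B',A',B',A',A']" | "root P5 = [A,B',A,A,B,A,B',A',A']" | "root P6 = [B,B,A',A',B',A',B,A']"
| "root P7 = [A,A,A,A,A,B',A']" | "root P8 = [B',A',B',A',A',B',A',A']" | "root P9 = [B,A,A,B,B,A',B',A']"
| "root P10 = [A,B',A,B,A,A]" | "root P11 = [A',B,A,B]" | "root Q1 = [B]"
| "root Q2 = [A,B',A',A',A',A']" | "root Q3 = [A',B',A,B,A',B,A,B]" | "root Q4 = [A',A',B,A,B,A,A]"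
| "root Q5 = [A,B',A',B,B,A,B',A,A]" | "root Q6 = [B,A,A,A,B,A',A',A']" | "root Q7 = [A,B,A,B',A',B',A',B',A']"
| "root Q8 = [A,B,A',B,A',B']" | "root Q9 = [B,A,A,A,A,B',A,A]" | "root Q10 = [B,A,B',A,B',A']"
| "root Q11 = [B',A',B,A,B,B]"

section \<open>Subgroups of order 360 and their fixed columns\<close>

definition N_subgroup :: "(pt \<Rightarrow> pt) set \<Rightarrow> bool" where
  "N_subgroup S \<longleftrightarrow> S \<subseteq> N \<and> id \<in> S \<and> (\<forall>g\<in>S. \<forall>h\<in>S. g \<circ> h \<in> S)
     \<and> (\<forall>g\<in>S. \<exists>k\<in>S. k \<circ> g = id \<and> g \<circ> k = id)"

lemma N_subgroup_N: "N_subgroup N"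
  unfolding N_subgroup_def by (meson N_inverse comp_in_N id_in_N order_refl)

text \<open>Orbit counting for any map compatible with left translations: translation by
  \<open>k\<close> carries the fibre of \<open>id\<close> to that of \<open>k\<close>. It is applied
  to an action and to the image of a column.\<close>

lemma card_fibre_product:
  assumes S: "N_subgroup S"
    and \<alpha>: "\<And>k g h. k \<in> S \<Longrightarrow> g \<in> S \<Longrightarrow> h \<in> S \<Longrightarrow> \<alpha> g = \<alpha> h \<Longrightarrow> \<alpha> (k \<circ> g) = \<alpha> (k \<circ> h)"
  shows "card S = card (\<alpha> ` S) * card {g \<in> S. \<alpha> g = \<alpha> id}"
proof -
  have fin: "finite S" using S finite_subset[OF _ finite_N] by (auto simp: N_subgroup_def)
  have fibre: "card {g \<in> S. \<alpha> g = y} = card {g \<in> S. \<alpha> g = \<alpha> id}" if y: "y \<in> \<alpha> ` S" for y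
  proof -
    obtain k where k: "k \<in> S" "y = \<alpha> k" using y by blast
    obtain k' where k': "k' \<in> S" "k' \<circ> k = id" "k \<circ> k' = id"
      using S k(1) unfolding N_subgroup_def by blast
    have "bij_betw (\<lambda>g. k \<circ> g) {g \<in> S. \<alpha> g = \<alpha> id} {g \<in> S. \<alpha> g = y}"
    proof (rule bij_betw_byWitness[where f' = "\<lambda>g. k' \<circ> g"])
      show "\<forall>g\<in>{g \<in> S. \<alpha> g = \<alpha> id}. k' \<circ> (k \<circ> g) = g" "\<forall>g\<in>{g \<in> S. \<alpha> g = y}. k \<circ> (k' \<circ> g) = g"
        using k' by (simp_all flip: comp_assoc)
      show "(\<lambda>g. k \<circ> g) ` {g \<in> S. \<alpha> g = \<alpha> id} \<subseteq> {g \<in> S. \<alpha> g = y}"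
      proof clarify
        fix g assume g: "g \<in> S" "\<alpha> g = \<alpha> id"
        have "id \<in> S" using S by (simp add: N_subgroup_def)
        from \<alpha>[OF k(1) g(1) this g(2)] have "\<alpha> (k \<circ> g) = y" using k(2) by simp
        then show "k \<circ> g \<in> S \<and> \<alpha> (k \<circ> g) = y" using S k(1) g(1) by (simp add: N_subgroup_def)
      qed
      show "(\<lambda>g. k' \<circ> g) ` {g \<in> S. \<alpha> g = y} \<subseteq> {g \<in> S. \<alpha> g = \<alpha> id}"
      proof clarify
        fix g assume g: "g \<in> S" "y = \<alpha> g"
        have "\<alpha> g = \<alpha> k" using g k by simp
        from \<alpha>[OF k'(1) g(1) k(1) this] have "\<alpha> (k' \<circ> g) = \<alpha> id" using k'(2) by simp
        then show "k' \<circ> g \<in> S \<and> \<alpha> (k' \<circ> g) = \<alpha> id" using S k'(1) g(1) by (simp add: N_subgroup_def)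
      qed
    qed
    then show ?thesis by (rule bij_betw_same_card[symmetric])
  qed
  have "card S = (\<Sum>y\<in>\<alpha> ` S. card {g \<in> S. \<alpha> g = y})"
    using sum.image_gen[OF fin, of "\<lambda>_. 1 :: nat" \<alpha>] by simp
  also have "\<dots> = card (\<alpha> ` S) * card {g \<in> S. \<alpha> g = \<alpha> id}"
    by (simp add: fibre)
  finally show ?thesis .
qed

lemma distinct_list_in:
  assumes "finite U" "a \<le> card U"
  obtains xs where "distinct xs" "length xs = a" "set xs \<subseteq> U"
proof -
  obtain V where V: "V \<subseteq> U" "card V = a" "finite V"
    using assms obtain_subset_with_card_n by metis
  obtain xs where xs: "set xs = V" "distinct xs" using finite_distinct_list[OF V(3)] by blast
  then show thesis using that[of xs] V distinct_card[OF xs(2)] by simp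
qed

text \<open>The images of \<open>a\<close> columns inside the invariant set and \<open>b\<close>
  outside determine an element; the two products count the possible images on either side.\<close>

lemma card_le_of_invariant_cols:
  assumes S: "N_subgroup S" and U: "U \<subseteq> cols" "\<And>g c. g \<in> S \<Longrightarrow> c \<in> U \<Longrightarrow> col (g c) \<in> U"
    and ab: "a + b = 4" "a \<le> card U" "b \<le> 11 - card U"
  shows "card S \<le> \<Prod>{card U - a + 1..card U} * \<Prod>{11 - card U - b + 1..11 - card U}"
proof -
  let ?L = "\<lambda>n U. {xs. length xs = n \<and> distinct xs \<and> set xs \<subseteq> U}"
  have finU: "finite U" using U(1) finite_subset by blast
  have cV: "card (cols - U) = 11 - card U"
    using card_Diff_subset[OF finU U(1)] unfolding card_cols .
  obtain xs where xs: "distinct xs" "length xs = a" "set xs \<subseteq> U"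
    using distinct_list_in[OF finU ab(2)] .
  obtain ys where ys: "distinct ys" "length ys = b" "set ys \<subseteq> cols - U"
    using distinct_list_in[of "cols - U" b] ab(3) unfolding cV by blast
  have "\<exists>c1 c2 c3 c4. zs = [c1, c2, c3, c4]" if "length zs = 4" for zs :: "pt list"
    using that by (auto simp: length_Suc_conv numeral_eq_Suc)
  moreover have "length (xs @ ys) = 4" using xs ys ab by simp
  ultimately obtain c1 c2 c3 c4 where c: "xs @ ys = [c1, c2, c3, c4]" by blast
  have dist: "distinct [c1, c2, c3, c4]" "{c1, c2, c3, c4} \<subseteq> cols"
  proof -
    have "set xs \<inter> set ys = {}" using xs(3) ys(3) by blast
    then have "distinct (xs @ ys)" using xs ys by simp
    then show "distinct [c1, c2, c3, c4]" unfolding c .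
    have "set (xs @ ys) \<subseteq> cols" using xs(3) ys(3) U(1) unfolding set_append by blast
    then show "{c1, c2, c3, c4} \<subseteq> cols" unfolding c by simp
  qed
  have V: "col (g c) \<in> cols - U" if "g \<in> S" "c \<in> cols - U" for g c
  proof -
    obtain k where k: "k \<in> S" "k \<circ> g = id" using S \<open>g \<in> S\<close> unfolding N_subgroup_def by blast
    have "k \<in> N" using k S by (auto simp: N_subgroup_def)
    then have "col (k (col (g c))) = col ((k \<circ> g) c)" using col_N by simp
    also have "\<dots> = c" using k that by (auto simp: col_of_cols)
    finally show ?thesis using U(2)[OF k(1), of "col (g c)"] that(2) col_in_cols by auto
  qed
  let ?f = "\<lambda>g. (map (\<lambda>c. col (g c)) xs, map (\<lambda>c. col (g c)) ys)"
  have "inj_on ?f S"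
  proof (rule inj_onI)
    fix g h assume g: "g \<in> S" "h \<in> S" and e: "?f g = ?f h"
    have *: "map (\<lambda>c. col (g c)) (xs @ ys) = map (\<lambda>c. col (h c)) (xs @ ys)" using e by simp
    have "col (g c) = col (h c)" if "c \<in> {c1, c2, c3, c4}" for c
      using * that unfolding c by auto
    moreover have "g \<in> N" "h \<in> N" using g S by (auto simp: N_subgroup_def)
    ultimately show "g = h" using eq_of_four_cols[OF _ _ dist] by blast
  qed
  moreover have "?f ` S \<subseteq> ?L a U \<times> ?L b (cols - U)"
  proof (rule image_subsetI)
    fix g assume g: "g \<in> S"
    then have gN: "g \<in> N" using S by (auto simp: N_subgroup_def)
    have d: "distinct (map (\<lambda>c. col (g c)) zs)" if "distinct zs" "set zs \<subseteq> cols" for zs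
    proof -
      have "col c = c" if "c \<in> set zs" for c
        using \<open>set zs \<subseteq> cols\<close> that by (intro col_of_cols) (rule subsetD)
      then show ?thesis using \<open>distinct zs\<close> by (simp add: distinct_map inj_on_def col_N_inj[OF gN])
    qed
    have "distinct (map (\<lambda>c. col (g c)) xs)" "distinct (map (\<lambda>c. col (g c)) ys)"
      by (rule d[OF xs(1) subset_trans[OF xs(3) U(1)]],
          rule d[OF ys(1) subset_trans[OF ys(3) Diff_subset]])
    moreover have "set (map (\<lambda>c. col (g c)) xs) \<subseteq> U" using U(2)[OF g] xs(3) by auto
    moreover have "set (map (\<lambda>c. col (g c)) ys) \<subseteq> cols - U" using V[OF g] ys(3) unfolding set_map by blast
    ultimately show "(map (\<lambda>c. col (g c)) xs, map (\<lambda>c. col (g c)) ys) \<in> ?L a U \<times> ?L b (cols - U)"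
      using xs(2) ys(2) by simp
  qed
  moreover have fin: "finite (?L n V)" if "finite V" for n V
    by (rule finite_subset[OF _ finite_lists_length_eq[OF that, of n]]) blast
  ultimately have "card S \<le> card (?L a U \<times> ?L b (cols - U))"
    using finU by (intro card_inj_on_le finite_cartesian_product fin) auto
  also have "\<dots> = \<Prod>{card U - a + 1..card U} * \<Prod>{11 - card U - b + 1..11 - card U}"
    unfolding card_cartesian_product
    using card_lists_distinct_length_eq[OF finU ab(2)]
      card_lists_distinct_length_eq[of "cols - U" b] ab(3) unfolding cV by simp
  finally show ?thesis .
qed

text \<open>The sharp 4-transitivity bounds the order of a subgroup with an orbit of length between
  2 and 9 by 144, and 11 does not divide 360.\<close>

lemma subgroup_360_fixes_col:
  assumes S: "N_subgroup S" and card: "card S = 360"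
  obtains c where "c \<in> cols" "\<And>g. g \<in> S \<Longrightarrow> col (g c) = c"
proof -
  have SN: "S \<subseteq> N" using S by (simp add: N_subgroup_def)
  define U where "U = (\<lambda>g. col (g P1)) ` S"
  have U: "U \<subseteq> cols" unfolding U_def using col_in_cols by blast
  have inv: "col (g c) \<in> U" if g: "g \<in> S" and c: "c \<in> U" for g c
  proof -
    obtain h where h: "h \<in> S" "c = col (h P1)" using c by (auto simp: U_def)
    have "col (g c) = col ((g \<circ> h) P1)" using h g SN col_N by auto
    then show ?thesis using S h g unfolding U_def N_subgroup_def by blast
  qed
  have P1: "P1 \<in> U"
  proof -
    have "id \<in> S" using S by (simp add: N_subgroup_def)
    then show ?thesis unfolding U_def by (intro image_eqI[of _ _ id]) auto
  qed
  have finU: "finite U" using U finite_subset by blast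
  have "card U \<le> 11" using card_mono[OF _ U] unfolding card_cols by simp
  moreover have "0 < card U" using P1 finU by (auto simp: card_gt_0_iff)
  ultimately have "card U \<in> {1..11}" unfolding atLeastAtMost_iff by linarith
  then have cases: "card U = 1 \<or> card U = 2 \<or> card U = 3 \<or> card U = 4 \<or> card U = 5 \<or> card U = 6
    \<or> card U = 7 \<or> card U = 8 \<or> card U = 9 \<or> card U = 10 \<or> card U = 11"
    unfolding atLeastAtMost_11 by (simp only: insert_iff empty_iff simp_thms)
  have bd: "360 \<le> \<Prod>{card U - a + 1..card U} * \<Prod>{11 - card U - b + 1..11 - card U}"
    if "a + b = 4" "a \<le> card U" "b \<le> 11 - card U" for a b
    unfolding card[symmetric] by (rule card_le_of_invariant_cols[OF S U _ that]) (rule inv)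
  have iv: "{Suc (Suc 0)..5} = {2, 3, 4, 5 :: nat}" "{1..4} = {1, 2, 3, 4 :: nat}" "{1..3} = {1, 2, 3 :: nat}"
    "{1..2} = {1, 2 :: nat}" "{8..9} = {8, 9 :: nat}" by auto
  have "card U \<noteq> 11"
  proof
    assume "card U = 11"
    moreover have "card S = card U * card {g \<in> S. col (g P1) = col (id P1)}"
      unfolding U_def
    proof (rule card_fibre_product[OF S])
      fix k g h assume "k \<in> S" and e: "col (g P1) = col (h P1)"
      then have "k \<in> N" using SN by blast
      from col_N_inj[OF this] e show "col ((k \<circ> g) P1) = col ((k \<circ> h) P1)" by simp
    qed
    ultimately have "360 = 11 * card {g \<in> S. col (g P1) = col (id P1)}" using card by simp
    then show False by presburger
  qed
  \<comment> \<open>The four columns are taken from the smaller of the orbit and its complement as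
    far as it reaches.\<close>
  moreover have "card U \<noteq> 2" using bd[of 2 2] iv by auto
  moreover have "card U \<noteq> 3" using bd[of 3 1] iv by auto
  moreover have "card U \<noteq> 4" using bd[of 4 0] iv by auto
  moreover have "card U \<noteq> 5" using bd[of 4 0] iv by auto
  moreover have "card U \<noteq> 6" using bd[of 0 4] iv by auto
  moreover have "card U \<noteq> 7" using bd[of 0 4] iv by auto
  moreover have "card U \<noteq> 8" using bd[of 1 3] iv by auto
  moreover have "card U \<noteq> 9" using bd[of 2 2] iv by auto
  ultimately consider "card U = 1" | "card U = 10" using cases by argo
  then show thesis
  proof cases
    case 1
    then have "U = {P1}" using P1 by (metis card_1_singletonE singletonD)
    then show thesis using inv P1 that[of P1] by auto
  next
    case 2
    \<comment> \<open>An orbit of length 10 leaves out a single column, which is therefore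
      fixed.\<close>
    have "card (cols - U) = 1"
      using card_Diff_subset[OF finU U] unfolding card_cols 2 by simp
    then obtain c where c: "cols - U = {c}" by (rule card_1_singletonE)
    have "col (g c) = c" if g: "g \<in> S" for g
    proof -
      obtain k where k: "k \<in> S" "k \<circ> g = id" using S g unfolding N_subgroup_def by blast
      have "k \<in> N" using k SN by blast
      then have "col (k (col (g c))) = col ((k \<circ> g) c)" by (simp add: col_N del: id_apply)
      also have "\<dots> = c" unfolding k(2) id_apply by (rule col_of_cols) (use c in blast)
      finally have kc: "col (k (col (g c))) = c" .
      have "c \<notin> U" using c by blast
      then have "col (g c) \<notin> U" using inv[OF k(1), of "col (g c)"] kc by metis
      then have "col (g c) \<in> cols - U" using col_in_cols[of "g c"] by (rule DiffI[rotated])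
      then show ?thesis unfolding c by (rule singletonD)
    qed
    then show thesis using that c by blast
  qed
qed

section \<open>Transitive actions on 22 points\<close>

locale N_action =
  fixes \<Omega> :: "'b set" and \<psi> :: "(pt \<Rightarrow> pt) \<Rightarrow> 'b \<Rightarrow> 'b"
  assumes closed: "g \<in> N \<Longrightarrow> w \<in> \<Omega> \<Longrightarrow> \<psi> g w \<in> \<Omega>"
    and comp: "g \<in> N \<Longrightarrow> h \<in> N \<Longrightarrow> w \<in> \<Omega> \<Longrightarrow> \<psi> (g \<circ> h) w = \<psi> g (\<psi> h w)"
    and ident: "w \<in> \<Omega> \<Longrightarrow> \<psi> id w = w"
    and trans: "v \<in> \<Omega> \<Longrightarrow> w \<in> \<Omega> \<Longrightarrow> \<exists>g\<in>N. \<psi> g v = w"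
    and card: "card \<Omega> = 22"
begin

definition stab :: "'b \<Rightarrow> (pt \<Rightarrow> pt) set" where
  "stab w = {g \<in> N. \<psi> g w = w}"

lemma stab_subgroup:
  assumes w: "w \<in> \<Omega>" shows "N_subgroup (stab w)"
proof -
  have "\<exists>k\<in>stab w. k \<circ> g = id \<and> g \<circ> k = id" if "g \<in> stab w" for g
  proof -
    have g: "g \<in> N" "\<psi> g w = w" using that by (auto simp: stab_def)
    obtain k where k: "k \<in> N" "k \<circ> g = id" "g \<circ> k = id" using N_inverse[OF g(1)] by metis
    have "\<psi> k w = \<psi> (k \<circ> g) w" using comp[OF k(1) g(1) w] g(2) by simp
    then show ?thesis using k ident[OF w] by (auto simp: stab_def)
  qed
  then show ?thesis
    unfolding N_subgroup_def by (auto simp: stab_def comp ident w comp_in_N)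
qed

lemma card_stab:
  assumes w: "w \<in> \<Omega>" shows "card (stab w) = 360"
proof -
  have "(\<lambda>g. \<psi> g w) ` N = \<Omega>" using closed trans w by blast
  moreover have "{g \<in> N. \<psi> g w = \<psi> id w} = stab w" by (simp add: stab_def ident[OF w])
  ultimately have "7920 = 22 * card (stab w)"
    using card_fibre_product[OF N_subgroup_N, of "\<lambda>g. \<psi> g w"] comp w closed card card_N by simp
  then show ?thesis by simp
qed

text \<open>Stabilizers of points in one orbit are conjugate, so the fixed column of one of them can
  be moved to \<open>P1\<close>.\<close>

lemma ex_stab_fixing_P1:
  obtains w where "w \<in> \<Omega>" "stab w \<subseteq> fixes_cols [P1]"
proof -
  obtain v where v: "v \<in> \<Omega>" using card by fastforce
  obtain c where c: "c \<in> cols" "\<And>g. g \<in> stab v \<Longrightarrow> col (g c) = c"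
    using subgroup_360_fixes_col[OF stab_subgroup[OF v] card_stab[OF v]] by metis
  obtain t where t: "t \<in> N" "col (t P1) = c"
  proof -
    have "\<exists>w. col (ev w P1) = c"
    proof -
      have "list_all (\<lambda>c. list_ex (\<lambda>w. col (ev w P1) = c) U0) [P1, P2, P3, P4, P5, P6, P7, P8, P9, P10, P11]"
        by code_simp
      then show ?thesis using c(1) unfolding list_all_iff list_ex_iff by auto
    qed
    then show thesis using that ev_in_N by blast
  qed
  obtain k where k: "k \<in> N" "k \<circ> t = id" "t \<circ> k = id" using N_inverse[OF t(1)] by metis
  have "g \<in> fixes_cols [P1]" if "g \<in> stab (\<psi> k v)" for g
  proof -
    have g: "g \<in> N" "\<psi> g (\<psi> k v) = \<psi> k v" using that by (auto simp: stab_def)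
    have "\<psi> (t \<circ> (g \<circ> k)) v = \<psi> t (\<psi> g (\<psi> k v))"
      using g(1) t(1) k(1) v closed comp by (simp add: comp_in_N)
    also have "\<dots> = \<psi> (t \<circ> k) v"
      using g(2) comp[OF t(1) k(1) v] by simp
    finally have "\<psi> (t \<circ> (g \<circ> k)) v = \<psi> (t \<circ> k) v" .
    then have "t \<circ> (g \<circ> k) \<in> stab v"
      using g(1) t(1) k v ident by (simp add: stab_def comp_in_N)
    then have "col (t (g (k c))) = c" using c(2) by fastforce
    moreover have "col (k c) = P1"
    proof -
      have "col (k c) = col (k (t P1))" using t(2) col_N[OF k(1)] by metis
      also have "\<dots> = P1" using fun_cong[OF k(2), of P1] by simp
      finally show ?thesis .
    qed
    ultimately have "col (t (g P1)) = col (t P1)"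
      using t(2) col_N[OF g(1)] col_N[OF t(1)] by metis
    then show ?thesis using g(1) by (simp add: fixes_cols_def col_N_inj[OF t(1)])
  qed
  then show thesis using that closed[OF k(1) v] by blast
qed

text \<open>A point stabilizer has index 2 in the stabilizer of a column.\<close>

lemma square_in_stab:
  assumes w: "w \<in> \<Omega>" "stab w \<subseteq> fixes_cols [P1]" and r: "r \<in> fixes_cols [P1]"
  shows "\<psi> (r \<circ> r) w = w"
proof (rule ccontr)
  have rN: "r \<in> N" using r by (simp add: fixes_cols_def)
  have SN: "stab w \<subseteq> N" by (auto simp: stab_def)
  assume "\<psi> (r \<circ> r) w \<noteq> w"
  then have ne: "\<psi> r (\<psi> r w) \<noteq> w" using comp rN w(1) by simp
  then have ne': "\<psi> r w \<noteq> w" by auto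
  \<comment> \<open>If \<open>r\<close> is outside the stabilizer, the stabilizer and its coset by
    \<open>r\<close> have 360 + 360 elements and fill the column stabilizer. But
    \<open>r \<circ> r\<close> is in neither: in the coset it would put \<open>r\<close> into the
    stabilizer.\<close>
  have inj: "inj_on ((\<circ>) r) (stab w)"
    using inj_N[OF rN] by (auto simp: inj_on_def fun_eq_iff)
  have "stab w \<inter> (\<circ>) r ` stab w = {}"
    using ne' comp rN w(1) by (auto simp: stab_def)
  moreover have "finite (stab w)" using finite_subset[OF SN] by simp
  ultimately have "card (stab w \<union> (\<circ>) r ` stab w) = 720"
    using card_image[OF inj] card_stab[OF w(1)] by (simp add: card_Un_disjoint)
  moreover have "stab w \<union> (\<circ>) r ` stab w \<subseteq> fixes_cols [P1]"
    using w(2) fixes_cols_comp[OF r] by auto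
  moreover have "finite (fixes_cols [P1])"
    by (rule finite_subset[of _ N]) (auto simp: fixes_cols_def)
  ultimately have "stab w \<union> (\<circ>) r ` stab w = fixes_cols [P1]"
    using card_subset_eq card_stab[OF w(1)] card_stab_P1 by metis
  then have "r \<circ> r \<in> stab w \<union> (\<circ>) r ` stab w" using fixes_cols_comp[OF r r] by blast
  then show False
  proof
    assume "r \<circ> r \<in> stab w"
    then show False using ne comp rN w(1) by (simp add: stab_def)
  next
    assume "r \<circ> r \<in> (\<circ>) r ` stab w"
    then obtain s where s: "s \<in> stab w" "r \<circ> r = r \<circ> s" by blast
    then have "r = s" using inj_N[OF rN] by (auto simp: fun_eq_iff dest: injD)
    then show False using s ne' by (simp add: stab_def)
  qed
qed

text \<open>Label the image of \<open>w\<close> under \<open>rep p\<close> by \<open>p\<close>. This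
  is equivariant for \<open>permB\<close> because its Schreier generators are squares and so fix
  \<open>w\<close>.\<close>

lemma ex_labelling:
  obtains h where "bij_betw h UNIV \<Omega>" "\<And>g p. g \<in> N \<Longrightarrow> \<psi> g (h p) = h (g p)"
proof -
  obtain w where w: "w \<in> \<Omega>" "stab w \<subseteq> fixes_cols [P1]" by (rule ex_stab_fixing_P1)
  define h where "h p = \<psi> (ev (rep p)) w" for p
  have hA: "\<psi> permA (h p) = h (permA p)" for p
  proof -
    have "list_all (\<lambda>p. weq (A # rep p) (rep (permA p))) pts" by code_simp
    then have "ev (A # rep p) = ev (rep (permA p))" by (simp add: list_all_pts weq_iff)
    then show ?thesis
      using comp[OF gen_in_N[of A] ev_in_N[of "rep p"] w(1)] unfolding h_def ev_Cons by simp
  qed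
  have hB: "\<psi> permB (h p) = h (permB p)" for p
  proof -
    have "list_all (\<lambda>p. weq (B # rep p) (rep (permB p) @ root p @ root p) \<and> col (ev (root p) P1) = P1) pts"
      by code_simp
    then have e: "ev (B # rep p) = ev (rep (permB p) @ root p @ root p)" and r: "col (ev (root p) P1) = P1"
      by (simp_all add: list_all_pts weq_iff)
    have r': "ev (root p) \<in> fixes_cols [P1]" using r by (simp add: fixes_cols_def)
    have "\<psi> permB (h p) = \<psi> (ev (B # rep p)) w"
      using comp[OF gen_in_N[of B] ev_in_N[of "rep p"] w(1)] unfolding h_def ev_Cons by simp
    also have "\<dots> = \<psi> (ev (rep (permB p)) \<circ> (ev (root p) \<circ> ev (root p))) w"
      by (simp only: e ev_append)
    also have "\<dots> = h (permB p)"
      unfolding h_def by (subst comp) (simp_all add: w comp_in_N square_in_stab[OF w r'])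
    finally show ?thesis .
  qed
  have hS0: "\<psi> (ev (S0 b)) (h p) = h (ev (S0 b) p)" for b p
    using hA hB by (cases b) (simp_all add: S0_def ev_Cons ev_Nil)
  have h\<Omega>: "h p \<in> \<Omega>" for p unfolding h_def using closed[OF ev_in_N w(1)] .
  have "\<psi> (ev (concat (map S0 bs))) (h p) = h (ev (concat (map S0 bs)) p)" for bs p
  proof (induction bs)
    case Nil
    show ?case unfolding list.map concat.simps ev_Nil ident[OF h\<Omega>] by simp
  next
    case (Cons b bs)
    show ?case
      unfolding list.map concat.simps ev_append comp[OF ev_in_N ev_in_N h\<Omega>] Cons hS0 by simp
  qed
  then have eq: "\<psi> g (h p) = h (g p)" if "g \<in> N" for g p
    using that N_subset_gp unfolding gp_def by blast
  have "h ` UNIV = \<Omega>"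
  proof
    show "\<Omega> \<subseteq> h ` UNIV"
    proof
      fix v assume "v \<in> \<Omega>"
      then obtain g where "g \<in> N" "\<psi> g (h P1) = v" using trans h\<Omega> by blast
      then show "v \<in> h ` UNIV" using eq by auto
    qed
  qed (use h\<Omega> in blast)
  moreover have "inj h"
    using calculation card card_pt by (simp add: eq_card_imp_inj_on)
  ultimately show thesis using that eq unfolding bij_betw_def by blast
qed

end

section \<open>Commutators over a given element\<close>

definition sd :: "'a set \<Rightarrow> 'a set \<Rightarrow> 'a set" where
  "sd S T = (S - T) \<union> (T - S)"

lemma mem_sd: "p \<in> sd S T \<longleftrightarrow> (p \<in> S) \<noteq> (p \<in> T)"
  by (auto simp: sd_def)

lemma sd_assoc: "sd (sd S T) U = sd S (sd T U)"
  by (auto simp: mem_sd)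

lemma sd_commute: "sd S T = sd T S"
  by (auto simp: mem_sd)

lemma sd_left_commute: "sd S (sd T U) = sd T (sd S U)"
  by (auto simp: mem_sd)

lemma sd_simps [simp]: "sd S {} = S" "sd {} S = S" "sd S S = {}" "sd S (sd S T) = T"
  by (auto simp: mem_sd)

lemmas sd_ac = sd_assoc sd_commute sd_left_commute

lemma sd_eq_iff: "sd S T = U \<longleftrightarrow> T = sd S U"
  by (metis sd_simps(4))

lemma image_sd: "inj g \<Longrightarrow> g ` sd S T = sd (g ` S) (g ` T)"
  by (simp add: sd_def image_Un image_set_diff)

lemma even_card_sd:
  fixes S T :: "'a::finite set"
  shows "even (card (sd S T)) \<longleftrightarrow> (even (card S) \<longleftrightarrow> even (card T))"
proof -
  have "card (sd S T) = card (S - T) + card (T - S)"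
    unfolding sd_def by (rule card_Un_disjoint) auto
  moreover have "card S = card (S - T) + card (S \<inter> T)" "card T = card (T - S) + card (S \<inter> T)"
    by (subst card_Un_disjoint[symmetric]; auto intro: arg_cong[where f = card])+
  ultimately show ?thesis by (metis even_add)
qed

lemma sd_Int: "sd S T \<inter> U = sd (S \<inter> U) (T \<inter> U)"
  by (auto simp: sd_def)

abbreviation pair :: "pt \<Rightarrow> pt \<Rightarrow> pt set" where
  "pair i j \<equiv> sd {i} {j}"

lemma even_card_pair [simp]: "even (card (pair i j))"
  by (simp add: even_card_sd)

lemma card_image_N [simp]: "g \<in> N \<Longrightarrow> card (g ` S) = card S"
  by (rule card_image) (rule inj_on_subset[OF inj_N subset_UNIV])

text \<open>If \<open>(F, g) = a\<inverse> b\<inverse> a b\<close> with \<open>a = (u, x)\<close> and \<open>b = (v, y)\<close>, then \<open>b a (F, g) = a b\<close>; the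
  image of \<open>F\<close> under \<open>y \<circ> x\<close> is then the element of \<open>comm_space x y\<close> given by \<open>u\<close> and \<open>v\<close>.\<close>

definition comm_space :: "(pt \<Rightarrow> pt) \<Rightarrow> (pt \<Rightarrow> pt) \<Rightarrow> pt set set" where
  "comm_space x y =
     {sd (sd u (x ` v)) (sd v (y ` u)) | u v. even (card u) \<and> even (card v)}"

definition commutes_to :: "pt set \<Rightarrow> (pt \<Rightarrow> pt) \<Rightarrow> bool" where
  "commutes_to F g \<longleftrightarrow>
     (\<exists>x\<in>N. \<exists>y\<in>N. x \<circ> y = y \<circ> x \<circ> g \<and> (y \<circ> x) ` F \<in> comm_space x y)"

lemma comm_space_empty: "{} \<in> comm_space x y"
  unfolding comm_space_def by (intro CollectI exI[of _ "{}"]) simp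

lemma comm_space_sd:
  assumes xy: "x \<in> N" "y \<in> N" and S: "S \<in> comm_space x y" and T: "T \<in> comm_space x y"
  shows "sd S T \<in> comm_space x y"
proof -
  obtain u v where u: "S = sd (sd u (x ` v)) (sd v (y ` u))" "even (card u)" "even (card v)"
    using S unfolding comm_space_def by blast
  obtain u' v' where u': "T = sd (sd u' (x ` v')) (sd v' (y ` u'))" "even (card u')" "even (card v')"
    using T unfolding comm_space_def by blast
  have "sd S T = sd (sd (sd u u') (x ` sd v v')) (sd (sd v v') (y ` sd u u'))"
    unfolding u u' image_sd[OF inj_N[OF xy(1)]] image_sd[OF inj_N[OF xy(2)]] by (simp add: sd_ac)
  moreover have "even (card (sd u u'))" "even (card (sd v v'))"
    using u u' by (simp_all add: even_card_sd)
  ultimately show ?thesis unfolding comm_space_def by blast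
qed

text \<open>An even set is a sum of pairs of its points, and \<open>comm_space\<close> is closed
  under sums.\<close>

lemma even_subset_in_comm_space:
  assumes xy: "x \<in> N" "y \<in> N"
  shows "even (card S) \<Longrightarrow> (\<And>i j. i \<in> S \<Longrightarrow> j \<in> S \<Longrightarrow> pair i j \<in> comm_space x y)
    \<Longrightarrow> S \<in> comm_space x y"
proof (induction "card S" arbitrary: S rule: less_induct)
  case less
  show ?case
  proof (cases "S = {}")
    case True
    then show ?thesis by (simp add: comm_space_empty)
  next
    case False
    then obtain i where i: "i \<in> S" by blast
    have "S \<noteq> {i}" using less.prems(1) by auto
    then obtain j where j: "j \<in> S" "j \<noteq> i" using i by blast
    let ?S = "sd S (pair i j)"
    have sub: "?S \<subset> S" using i j by (auto simp: sd_def)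
    have "?S \<in> comm_space x y"
    proof (rule less.hyps)
      show "card ?S < card S" using sub by (simp add: psubset_card_mono)
      show "even (card ?S)" using less.prems(1) by (simp add: even_card_sd)
    qed (use sub less.prems(2) in blast)
    from comm_space_sd[OF xy this less.prems(2)[OF i j(1)]]
    show ?thesis by (simp add: sd_assoc)
  qed
qed

primrec run :: "(pt \<Rightarrow> pt) \<Rightarrow> (pt \<Rightarrow> pt) \<Rightarrow> bool list \<Rightarrow> pt \<Rightarrow> pt" where
  "run x y [] p = p"
| "run x y (b # w) p = (if b then x else y) (run x y w p)"

abbreviation oddly :: "bool \<Rightarrow> bool list \<Rightarrow> bool" where
  "oddly b w \<equiv> odd (length (filter (\<lambda>c. c = b) w))"

text \<open>Modulo \<^const>\<open>comm_space\<close> the class of \<open>{i, z i}\<close> does not depend on \<open>i\<close>, for \<open>z\<close> in the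
  group generated by \<open>x\<close> and \<open>y\<close>, and is multiplicative in \<open>z\<close>. It vanishes if \<open>z\<close> has a
  fixed point.\<close>

lemma pair_step:
  assumes xy: "x \<in> N" "y \<in> N"
  shows "sd (pair i (x i)) (pair j (x j)) \<in> comm_space x y"
    and "sd (pair i (y i)) (pair j (y j)) \<in> comm_space x y"
proof -
  \<comment> \<open>This is \<open>1 + x\<close> applied to the even set
    \<open>pair i j\<close>.\<close>
  have "sd (pair i (x i)) (pair j (x j)) = sd (sd {} (x ` pair i j)) (sd (pair i j) (y ` {}))"
    by (simp add: image_sd[OF inj_N[OF xy(1)]] sd_ac)
  then show "sd (pair i (x i)) (pair j (x j)) \<in> comm_space x y"
    unfolding comm_space_def using even_card_pair by (metis (mono_tags, lifting) CollectI card.empty even_zero)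
  have "sd (pair i (y i)) (pair j (y j)) = sd (sd (pair i j) (x ` {})) (sd {} (y ` pair i j))"
    by (simp add: image_sd[OF inj_N[OF xy(2)]] sd_ac)
  then show "sd (pair i (y i)) (pair j (y j)) \<in> comm_space x y"
    unfolding comm_space_def using even_card_pair by (metis (mono_tags, lifting) CollectI card.empty even_zero)
qed

lemma pair_run:
  assumes xy: "x \<in> N" "y \<in> N"
  shows "sd (pair i (run x y w i))
    (sd (if oddly True w then pair P1 (x P1) else {}) (if oddly False w then pair P1 (y P1) else {}))
      \<in> comm_space x y"
proof (induction w)
  case Nil
  show ?case by (simp add: comm_space_empty)
next
  case (Cons b w)
  let ?z = "if b then x else y" and ?q = "run x y w i"
  let ?c = "sd (if oddly True w then pair P1 (x P1) else {}) (if oddly False w then pair P1 (y P1) else {})"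
  have "sd (pair ?q (?z ?q)) (pair P1 (?z P1)) \<in> comm_space x y"
    using pair_step[OF xy] by (cases b) simp_all
  from comm_space_sd[OF xy Cons this]
  have "sd (pair i (?z ?q)) (sd ?c (pair P1 (?z P1))) \<in> comm_space x y"
    by (simp add: sd_ac)
  moreover have "sd ?c (pair P1 (?z P1)) =
    sd (if oddly True (b # w) then pair P1 (x P1) else {}) (if oddly False (b # w) then pair P1 (y P1) else {})"
    by (cases b; cases "oddly True w"; cases "oddly False w") (simp_all add: sd_ac)
  ultimately show ?case by simp
qed

primrec chained :: "(pt \<Rightarrow> pt) \<Rightarrow> (pt \<Rightarrow> pt) \<Rightarrow> pt list \<Rightarrow> pt list \<Rightarrow> bool" where
  "chained x y seen [] \<longleftrightarrow> True"
| "chained x y seen (p # ps) \<longleftrightarrow>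
     list_ex (\<lambda>q. x q = p \<or> y q = p) seen \<and> chained x y (p # seen) ps"

definition orbit_ok :: "(pt \<Rightarrow> pt) \<Rightarrow> (pt \<Rightarrow> pt) \<Rightarrow> pt list \<Rightarrow> bool" where
  "orbit_ok x y ps \<longleftrightarrow> ps \<noteq> [] \<and> chained x y [hd ps] (tl ps)
     \<and> list_all (\<lambda>p. x p \<in> set ps \<and> y p \<in> set ps) ps"

text \<open>\<open>wp\<close> and \<open>wp'\<close> are words with a fixed point whose exponent parities are independent, \<open>os\<close> are
  the orbits, each listed so that every point is an image of an earlier one.\<close>

definition comm_ok ::
  "letter list \<Rightarrow> letter list \<Rightarrow> letter list \<Rightarrow> bool list \<times> pt \<Rightarrow> bool list \<times> pt \<Rightarrow> pt list list \<Rightarrow> bool"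
where
  "comm_ok x y g wp wp' os \<longleftrightarrow> weq (x @ y) (y @ x @ g)
     \<and> run (ev x) (ev y) (fst wp) (snd wp) = snd wp \<and> run (ev x) (ev y) (fst wp') (snd wp') = snd wp'
     \<and> (oddly True (fst wp), oddly False (fst wp)) \<noteq> (False, False)
     \<and> (oddly True (fst wp'), oddly False (fst wp')) \<noteq> (False, False)
     \<and> (oddly True (fst wp), oddly False (fst wp)) \<noteq> (oddly True (fst wp'), oddly False (fst wp'))
     \<and> distinct (concat os) \<and> length (concat os) = 22 \<and> list_all (orbit_ok (ev x) (ev y)) os"

lemma pair_chained:
  assumes xy: "x \<in> N" "y \<in> N"
    and step: "\<And>i. pair i (x i) \<in> comm_space x y" "\<And>i. pair i (y i) \<in> comm_space x y"
  shows "chained x y seen ps \<Longrightarrow> (\<And>q. q \<in> set seen \<Longrightarrow> pair p q \<in> comm_space x y)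
    \<Longrightarrow> q \<in> set ps \<Longrightarrow> pair p q \<in> comm_space x y"
proof (induction ps arbitrary: seen)
  case (Cons r ps)
  obtain s where s: "s \<in> set seen" "x s = r \<or> y s = r"
    using Cons.prems(1) by (auto simp: list_ex_iff)
  have "pair s r \<in> comm_space x y" using s(2) step by auto
  from comm_space_sd[OF xy Cons.prems(2)[OF s(1)] this]
  have "pair p r \<in> comm_space x y" by (simp add: sd_ac)
  then show ?case using Cons.IH[of "r # seen"] Cons.prems by auto
qed simp

lemma commutes_to_of_comm_ok:
  assumes ok: "comm_ok x y g wp wp' os"
    and F: "\<And>ps. ps \<in> set os \<Longrightarrow> even (card (F \<inter> set ps))"
  shows "commutes_to F (ev g)"
proof -
  let ?x = "ev x" and ?y = "ev y" and ?V = "comm_space (ev x) (ev y)"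
  have xy: "?x \<in> N" "?y \<in> N" by simp_all
  note okD = ok[unfolded comm_ok_def]
  let ?cx = "pair P1 (?x P1)" and ?cy = "pair P1 (?y P1)"
  have c: "sd (if oddly True (fst w) then ?cx else {}) (if oddly False (fst w) then ?cy else {}) \<in> ?V"
    if "w = wp \<or> w = wp'" for w
    using pair_run[OF xy, of "snd w" "fst w"] okD that by auto
  \<comment> \<open>The parity vectors of the two words are distinct and nonzero, hence a basis:
    each of \<open>?cx\<close> and \<open>?cy\<close> is one of the two classes or their
    sum.\<close>
  have c1: "?cx \<in> ?V" and c2: "?cy \<in> ?V"
    using c[of wp] c[of wp'] comm_space_sd[OF xy c[of wp] c[of wp']] okD
    by (auto split: if_splits simp: sd_ac)
  have sx: "pair i (?x i) \<in> ?V" for i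
    using comm_space_sd[OF xy pair_step(1)[OF xy, of i P1] c1] by (simp add: sd_assoc)
  have sy: "pair i (?y i) \<in> ?V" for i
    using comm_space_sd[OF xy pair_step(2)[OF xy, of i P1] c2] by (simp add: sd_assoc)
  let ?F = "(?y \<circ> ?x) ` F"
  have yx: "?y \<circ> ?x \<in> N" by (simp add: comp_in_N)
  \<comment> \<open>Orbits are invariant under \<open>?y \<circ> ?x\<close>, so evenness on them
    passes from \<open>F\<close> to \<open>?F\<close>.\<close>
  have orb: "?F \<inter> set ps \<in> ?V" if ps: "ps \<in> set os" for ps
  proof (rule even_subset_in_comm_space[OF xy])
    have o: "orbit_ok ?x ?y ps" using okD ps by (simp add: list_all_iff)
    have "(?y \<circ> ?x) ` set ps \<subseteq> set ps" using o by (auto simp: orbit_ok_def list_all_iff)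
    then have "(?y \<circ> ?x) ` set ps = set ps"
      using card_subset_eq[OF finite_set _ card_image_N[OF yx]] by blast
    then have "?F \<inter> set ps = (?y \<circ> ?x) ` (F \<inter> set ps)"
      using inj_N[OF yx] by (metis image_Int)
    then show "even (card (?F \<inter> set ps))" using F[OF ps] by (simp only: card_image_N[OF yx])
    have hd: "pair (hd ps) q \<in> ?V" if "q \<in> set ps" for q
    proof (cases "q = hd ps")
      case False
      then have "q \<in> set (tl ps)" using that by (cases ps) auto
      then show ?thesis
        using pair_chained[OF xy sx sy, of "[hd ps]" "tl ps" "hd ps" q] o
        by (simp add: orbit_ok_def comm_space_empty)
    qed (simp add: comm_space_empty)
    show "pair i j \<in> ?V" if "i \<in> ?F \<inter> set ps" "j \<in> ?F \<inter> set ps" for i j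
      using comm_space_sd[OF xy hd[of i] hd[of j]] that by (simp add: sd_ac)
  qed
  have "?F \<inter> set (concat ps) \<in> ?V" if "set ps \<subseteq> set os" "distinct (concat ps)" for ps
    using that
  proof (induction ps)
    case Nil
    show ?case by (simp add: comm_space_empty)
  next
    case (Cons p ps)
    have "?F \<inter> set (concat (p # ps)) = sd (?F \<inter> set p) (?F \<inter> set (concat ps))"
      using Cons.prems(2) by (auto simp: sd_def)
    moreover have "?F \<inter> set (concat ps) \<in> ?V" using Cons by simp
    moreover have "?F \<inter> set p \<in> ?V" using Cons.prems(1) orb by simp
    ultimately show ?case using comm_space_sd[OF xy] by metis
  qed
  from this[of os] have "?F \<inter> set (concat os) \<in> ?V" using okD by simp
  moreover have "set (concat os) = UNIV"
  proof (rule card_subset_eq)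
    show "card (set (concat os)) = card (UNIV :: pt set)"
      using okD distinct_card[of "concat os"] by (simp only: card_pt)
  qed auto
  ultimately have "?F \<in> ?V" by simp
  then show ?thesis
    using okD xy unfolding commutes_to_def weq_iff ev_append by (metis comp_assoc)
qed

lemma commutes_to_conj:
  assumes F: "commutes_to F g" and k: "k \<in> N" and g': "g' \<circ> k = k \<circ> g"
  shows "commutes_to (k ` F) g'"
proof -
  obtain k' where k': "k' \<in> N" "k' \<circ> k = id" "k \<circ> k' = id" using N_inverse[OF k] by metis
  obtain x y u v where x: "x \<in> N" and y: "y \<in> N" and e: "x \<circ> y = y \<circ> x \<circ> g"
    and uv: "even (card u)" "even (card v)" "(y \<circ> x) ` F = sd (sd u (x ` v)) (sd v (y ` u))"
    using F unfolding commutes_to_def comm_space_def by blast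
  define x' where "x' = k \<circ> x \<circ> k'"
  define y' where "y' = k \<circ> y \<circ> k'"
  have x'N: "x' \<in> N" and y'N: "y' \<in> N"
    unfolding x'_def y'_def using k k' x y by (auto intro: comp_in_N)
  have kk: "k' (k p) = p" "k (k' p) = p" for p using k' by (metis comp_apply id_apply)+
  have x'k: "x' (k p) = k (x p)" and y'k: "y' (k p) = k (y p)" for p by (simp_all add: x'_def y'_def kk)
  have "x' \<circ> y' = y' \<circ> x' \<circ> g'"
  proof
    fix p
    obtain q where p: "p = k q" by (metis kk(2))
    have "x (y q) = y (x (g q))" using fun_cong[OF e, of q] by simp
    then show "(x' \<circ> y') p = (y' \<circ> x' \<circ> g') p"
      using fun_cong[OF g', of q] by (simp add: p x'k y'k)
  qed
  moreover have "(y' \<circ> x') ` (k ` F) = sd (sd (k ` u) (x' ` (k ` v))) (sd (k ` v) (y' ` (k ` u)))"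
  proof -
    have "(y' \<circ> x') ` (k ` F) = k ` ((y \<circ> x) ` F)" by (simp add: image_image x'k y'k)
    also have "\<dots> = sd (sd (k ` u) (x' ` (k ` v))) (sd (k ` v) (y' ` (k ` u)))"
      unfolding uv(3) image_sd[OF inj_N[OF k]] by (simp add: image_image x'k y'k)
    finally show ?thesis .
  qed
  ultimately show ?thesis
    unfolding commutes_to_def comm_space_def using x'N y'N uv(1,2) k by (auto intro!: bexI exI)
qed

section \<open>Certificates\<close>

text \<open>Arguments of \<^const>\<open>comm_ok\<close>, in \<open>column_set_certs\<close> preceded by a list of columns.\<close>

definition generic_certs ::
  "(letter list \<times> letter list \<times> letter list \<times> (bool list \<times> pt) \<times> (bool list \<times> pt) \<times> pt list list) list"
where
  "generic_certs = [
    ([A,A,B,A,B',A',A'], [B,A,A,B',A,B',A',A'], [A',B',A',B',A,B,A], ([False], P6), ([False,True], P7),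
     [[P1,P8,Q1,P6,P11,Q8,Q2,Q7,P4,Q6,Q11,Q5,P2,P10,P9,Q9,P5,P7,Q4,Q3,P3,Q10]]),
    ([B,A',A',A',B',A,B,B], [A',A',B,A',B,A,B,A,A], [A], ([False], P3), ([False,False,False,True], P9),
     [[P1,P5,Q11,Q6,P7,Q2,P10,Q4,P8,P6,P9,Q10,P4,P3,Q7,Q8,P2,Q9,Q3,Q5,Q1,P11]]),
    ([B',A',B',A,B,A,B], [B,A,B',A',B',A,B',A',B,A], [B,A',A',B,B,A,A,A,A], ([False], P4), ([False,False,True], P10),
     [[P1,P3,Q2,P10,P9,Q4,P11,Q9,P8,Q6,Q7,Q8,P6,P7,P5,Q3,P2,Q10,Q5,Q1,P4,Q11]]),
    ([A',A',B,A,B',A,A], [A',B,A',A',B',A,B,A], [B,A',B,A',A',A',A',B], ([False], P10), ([False,True,True,True], P11),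
     [[P1,P7,P3,Q3,P9,Q6,P5,P6,Q5,P10,Q4,Q8,P2,Q10,P4,P8,Q2,P11,Q11,Q1,Q9,Q7]]),
    ([B',A',B',A,B,A,B], [A',B',A',B',A], [A',A',A',B,A',A',A',B',A], ([False], P2), ([False,False,True,False,True,True], P1),
     [[P1,P3,P11,P10,P9,Q8,Q6,Q9,Q4,Q7,Q5,Q10,P2,P6,P7,P8,P4,Q2,Q1,Q3,P5,Q11]]),
    ([B,A,B'], [A',B,B,A',A',B], [A',A',A',B,B,A,A,B',A], ([False], P3), ([False,True,True,True], P8),
     [[P1,P2,Q5,Q7,Q2,P8,P4,P10,Q8,P7,Q1,P11,Q11,Q6,P6,Q10,P5,P3,P9,Q3,Q9,Q4]]),
    ([A,A,A,B,A',B',A,B,A], [B,B,A',B,A',B',A,B,A'], [B',A',B,A,B,A,A], ([False], P7), ([False,False,True], P1),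
     [[P1,Q3,P2,Q7,P6,Q8,Q9,Q11,P10,P8,Q4,P4,P9,Q10,Q5,P5,Q2,Q6,Q1,P11,P3,P7]]),
    ([A,B,A',A',B',A'], [A,B,A,B',A,A,B',A,A], [A',B',A,A,B,A',A',B'], ([False], P2), ([False,True,False,True,True], P4),
     [[P1,Q7,P7,P8,Q4,Q8,P4,Q2,Q5,P5,Q11,P2,P11,Q6,P9,Q9,Q3,Q1,P6,P3,P10,Q10]]),
    ([A,B',A',A',B',A'], [A,B,A',B,A,B,A',B], [B,A',B,B,A,A,A,B',A,A], ([False], P2), ([False,False,True], P5),
     [[P1,Q11,Q4,Q3,P9,P6,P11,P8,P7,P10,Q10,Q1,P3,Q9,Q2,P5,P4,Q8,Q7,Q5,Q6,P2]]),
    ([B,A',A',B], [B',A,A,A,A,B,A',B], [A',B,A,A,B,A,A,A,A], ([False], P1), ([False,False,True], P5),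
     [[P1,P5,P10,Q4,Q7,P8,P3,Q2,Q9,P9,Q1,Q6,Q11,Q3,P11,Q5,P7,P4,P6,Q10,P2,Q8]]),
    ([A',A',B,A,B',A,A], [A',B,A',A',B,A,B',A,A], [A,B,B], ([False], P3), ([False,False,True], P6),
     [[P1,P7,P10,Q3,Q6,P11,P6,Q4,Q5,P5,Q10,P4,Q2,P8,P2,Q8,Q11,Q7,Q1,P9,Q9,P3]]),
    ([A',B,A,B',A], [A,B',A,B',A,B',A',B'], [A',B',A,A,A,B',A',A',B], ([False], P8), ([False,False,False,False,True,True,True], P4),
     [[P1,Q6,P2,P9,P7,P8,Q9,P5,P3,Q11,Q10,Q4,Q5,Q3,Q1,P6,Q2,P11,P10,P4,Q7,Q8]]),
    ([A,B',A,A,A,B,A'], [A,B,A,B,A,B',A',B], [A,A,B',A',B,A,B,A',B], ([False], P6), ([False,False,True,True,True], P8),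
     [[P1,P8,P11,P9,Q4,Q1,Q9,Q6,P3,P5,Q8,Q11,P6,Q3,P10,Q7,P4,Q10,P7,Q2,Q5,P2]]),
    ([A',A',B,B], [A,A,B,A], [A',A',B',A,B,A',A',A',B'], ([False], P10), ([False,False,True], P4),
     [[P1,P10,Q4,P4,Q3,P8,P3,Q8,Q9,P5,P11,P9,Q1,Q5,Q11,Q7,P7,P2,Q6,Q10,Q2,P6]]),
    ([B,A,B'], [B,B,A,B,A,A,B,B], [B,A,B,A,B',A,B',A',B'], ([False], P9), ([False,False,False,False,True], P7),
     [[P1,P2,P7,Q7,Q3,Q10,P10,Q9,P11,Q6,Q5,P6,P5,P3,Q8,Q4,P8,P4,Q2,P9,Q11,Q1]]),
    ([A,B',A,B,A'], [A,A,B,A], [A',B',A,B',A,A,B,A], ([False], P10), ([False,False,False,False,True], P9),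
     [[P1,P10,Q4,Q5,Q1,P8,P6,Q10,P4,Q2,P11,P2,P5,Q8,Q3,Q9,P3,P9,Q6,Q11,P7,Q7]])]"

definition row_certs ::
  "(letter list \<times> letter list \<times> letter list \<times> (bool list \<times> pt) \<times> (bool list \<times> pt) \<times> pt list list) list"
where
  "row_certs = [
    ([B,B,A,B',A,B,A',B], [A',B,A,B',A], [B,A',B,A,B',A'], ([True], P3), ([False,True], P6),
     [[P1,Q6,P9,Q8,P5,P4,P3,Q7,Q10,P11,Q2],
      [P2,Q11,P8,Q1,Q9,Q4,P6,Q5,P7,Q3,P10]]),
    ([A,B,A',A',A',B,B,A,A], [B',A,A,B',A], [B,A',B,A,B',A'], ([True], P8), ([False,True], P1),
     [[P1,P4,P6,Q11,Q10,P8,Q9,P7,Q5,Q2,P3],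
      [P2,Q3,Q4,P11,Q1,Q6,Q8,P10,Q7,P9,P5]]),
    ([B',A,B,A',B',A], [B,B,A',B',A',B], [B,A',B,A,B',A'], ([True], P3), ([False,True], P8),
     [[P1,Q2,Q10,Q3,Q4,P5,P7,P9,Q11,P6,Q8],
      [P2,Q1,P3,P10,Q5,P4,Q7,Q9,P11,Q6,P8]]),
    ([B',A',B,A',B,A',B,A',A'], [B,A',A',A',A',A'], [B,A',B,A,B',A'], ([True], P5), ([False,True], P11),
     [[P1,P11,Q4,Q3,P5,Q9,P8,P10,P7,Q6,Q2],
      [P2,P6,P3,Q1,P4,P9,Q11,Q5,Q10,Q8,Q7]])]"

definition column_certs ::
  "(letter list \<times> letter list \<times> letter list \<times> (bool list \<times> pt) \<times> (bool list \<times> pt) \<times> pt list list) list"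
where
  "column_certs = [
    ([B',A',B,A,B], [B',A',A',A',B',A',B,B], [B,A',B,A,B',A'], ([True], P11), ([False], P7),
     [[P7,Q7],
      [P1,Q1,Q6,P6,P10,P5,Q10,Q5,P8,Q3,P4,Q8,P3,Q4,Q9,P2,P9,Q2,Q11,P11]]),
    ([A',A',B,A',B,A], [B,A',B,A',A',A',B,A'], [B,A',B,A,B',A'], ([True], P4), ([False], P5),
     [[P5,Q5],
      [P1,P10,P6,P9,Q7,Q3,P4,P8,P11,Q8,P7,Q9,Q2,Q6,Q1,P2,Q11,P3,Q4,Q10]]),
    ([A',A',B',A,B',A,B',A], [A,A,B,A], [B,A',B,A,B',A'], ([True], P8), ([False], P10),
     [[P10,Q10],
      [P1,Q7,Q4,Q11,Q5,P9,P8,Q6,P3,P6,P5,P11,Q2,P4,Q1,P2,Q3,Q9,Q8,P7]])]"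

text \<open>\<open>y\<close> and the commutator are trivial and \<open>x\<close> has a fixed point,
  so only the cycles of \<open>x\<close> matter. By 4-transitivity one set represents each of the
  sizes 1, 3, 7 and 9, the last two through their complements; size 5 needs all seven extensions of
  four columns.\<close>

definition column_set_certs ::
  "(pt list \<times> letter list \<times> letter list \<times> letter list \<times> (bool list \<times> pt) \<times> (bool list \<times> pt) \<times> pt list list) list"
where
  "column_set_certs = [
    ([P1],
    ([B], [], [], ([True], P9), ([False], P1),
     [[P1,Q1],
      [P2,Q2],
      [P3,P7,P11,P8],
      [P4,Q10,P5,Q6],
      [P6,Q4,P10,Q5],
      [P9],
      [Q3,Q7,Q11,Q8],
      [Q9]])),
    ([P1,P2,P3],
    ([B,A',B,A,B], [], [], ([True], P5), ([False], P1),
     [[P1,Q1],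
      [P2,P4,Q11,Q3],
      [P3,Q2,Q4,P11],
      [P5],
      [P6,Q6],
      [P7,Q8,P9,P10],
      [P8,Q9,Q10,Q7],
      [Q5]])),
    ([P3,P4,P5,P6,P7,P8,P9,P10,P11],
    ([A,B',A',B,A,B,A'], [], [], ([True], P1), ([False], P1),
     [[P1],
      [P2,Q2],
      [P3,P6,P5,Q4],
      [P4,Q3,Q6,Q5],
      [P7,Q11,Q9,P10],
      [P8,Q8],
      [P9,Q10,Q7,P11],
      [Q1]])),
    ([P5,P6,P7,P8,P9,P10,P11],
    ([B,A',B',A,B], [], [], ([True], P4), ([False], P1),
     [[P1,Q1],
      [P2,Q11,Q3,P5],
      [P3,Q5,Q2,P11],
      [P4],
      [P6,P9,Q7,P8],
      [P7,Q8,Q6,Q9],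
      [P10,Q10],
      [Q4]])),
    ([P1,P2,P3,P4,P5],
    ([B,A',B,A'], [], [], ([True], P6), ([False], P1),
     [[P1,P11,P10,P3],
      [P2,Q8,P5,Q9],
      [P4,Q4],
      [P6],
      [P7,Q7],
      [P8,Q5,P9,Q2],
      [Q1,Q11,Q10,Q3],
      [Q6]])),
    ([P1,P2,P3,P4,P6],
    ([A',B,A], [], [], ([True], P8), ([False], P1),
     [[P1,Q1],
      [P2,P6,P10,P7],
      [P3,Q9,P4,Q5],
      [P5,Q3,P9,Q4],
      [P8],
      [P11,Q11],
      [Q2,Q6,Q10,Q7],
      [Q8]])),
    ([P1,P2,P3,P4,P7],
    ([A',B,A], [], [], ([True], P8), ([False], P1),
     [[P1,Q1],
      [P2,P6,P10,P7],
      [P3,Q9,P4,Q5],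
      [P5,Q3,P9,Q4],
      [P8],
      [P11,Q11],
      [Q2,Q6,Q10,Q7],
      [Q8]])),
    ([P1,P2,P3,P4,P8],
    ([B,A',B,A'], [], [], ([True], P6), ([False], P1),
     [[P1,P11,P10,P3],
      [P2,Q8,P5,Q9],
      [P4,Q4],
      [P6],
      [P7,Q7],
      [P8,Q5,P9,Q2],
      [Q1,Q11,Q10,Q3],
      [Q6]])),
    ([P1,P2,P3,P4,P9],
    ([B',A,B',A], [], [], ([True], P5), ([False], P1),
     [[P1,Q8,P4,Q7],
      [P2,P9,P10,P11],
      [P3,Q3],
      [P5],
      [P6,Q6],
      [P7,Q1,P8,Q4],
      [Q2,Q9,Q10,Q11],
      [Q5]])),
    ([P1,P2,P3,P4,P10],
    ([A',B,A], [], [], ([True], P8), ([False], P1),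
     [[P1,Q1],
      [P2,P6,P10,P7],
      [P3,Q9,P4,Q5],
      [P5,Q3,P9,Q4],
      [P8],
      [P11,Q11],
      [Q2,Q6,Q10,Q7],
      [Q8]])),
    ([P1,P2,P3,P4,P11],
    ([B',A,B',A], [], [], ([True], P5), ([False], P1),
     [[P1,Q8,P4,Q7],
      [P2,P9,P10,P11],
      [P3,Q3],
      [P5],
      [P6,Q6],
      [P7,Q1,P8,Q4],
      [Q2,Q9,Q10,Q11],
      [Q5]]))]"

text \<open>Each word stands for an image of \<open>cols\<close>; the six images add up to the
  columns of \<open>P1\<close> and \<open>P2\<close>.\<close>

definition block_words :: "letter list list" where
  "block_words = [[], [B], [A,B,A,B], [A',B,A,B], [A',A',A',B], [A,B,A',B]]"

text \<open>The centralizer of a normal form \<open>h\<close>: an element commuting with \<open>h\<close> is determined by the images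
  of few columns, and the words list the candidates for all these images. The point list is a set
  of odd size that \<open>h\<close> and the candidates commuting with it map to itself or to its complement.\<close>

definition four_chain_table :: "(letter list \<times> pt list \<times> letter list list) list" where
  "four_chain_table = [
    ([A',B',A',B',A,B,A], [P1,P2,P3,P4,P6,P10,Q1,Q2,Q3,Q4,Q6], [
      [], [A',B',A',B',A,B,A], [A',B',A',B,B,A,B,A], [A',B',A',B,A,B,A],
      [A',B,A,B,A',B',A',B], [A',B',A',A',B',A',B',A',B], [B',A,B,A,B',A',B',A],
      [B,B,A',A',B,A',B',A,A]]),
    ([A], [P1,P2,P3,P4,P5,P6,P7,P8,P9,P10,P11], [
      [], [A], [A,A], [A,A,A], [A,A,A,A], [A,A,A,A,A], [A',A',A',A',A'], [A',A',A',A'],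
      [A',A',A'], [A',A'], [A']]),
    ([B,A',A',B,B,A,A,A,A], [P1,P4,P8,P9,P10,Q2,Q3,Q5,Q6,Q7,Q11], [
      [], [B,A',A',B,B,A,A,A,A], [B',A,A,A,B',A',A'], [A,A,A,B',A',B',A,B,B],
      [B,B,A',B,A,B,A',A',A'], [B,A,A,B,A,B',A'], [A,B',A,A,A,B',A',B,A],
      [A,B,A',B',A',A',B'], [B',A,A,B',A',B,B], [B,B,A,B,A',A',B], [A,A,B,A',A',A',B]]),
    ([B,A',B,A',A',A',A',B], [P6,P9,Q11], [
      [], [B,A',B,A',A',A',A',B], [B,B,A',A',B,A], [B,A,B,A,A,A,B,A,A],
      [B',A,A,A,A,B',A,B'], [A,B',A,A,B',A]]),
    ([A',A',A',B,A',A',A',B',A], [P9], [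
      [], [A',A',A',B,A',A',A',B',A], [A',B',A,B,A',A',A'], [A,A,A,B',A',B,A],
      [A',B',A',A',B',A,A,A], [A,B',A',A',B,A',B'], [B',A,B,A,B,A,B',A'],
      [A',B,A,A,A,B',A,A,A], [A,A,B',A',B',A',A',B], [A,B,A,B,A',A',A',A']]),
    ([A',A',A',B,B,A,A,B',A], [P1,P2,P5,P8,P10,Q3,Q4,Q6,Q7,Q8,Q9], [
      [], [A',A',A',B,B,A,A,B',A], [A',B,A',A',A',B,A,B,A'], [B,A,A,B',A',A'],
      [A',B,A',A',B,B,A,A,A], [A,A,B,A',A',B'], [B,A',A',B,B,A,A,B'],
      [A,B',A',B',A,A,A,B',A]]),
    ([B',A',B,A,B,A,A], [P8], [
      [], [B',A',B,A,B,A,A], [B,B,A,A,A,A,B',A'], [A,B,A',A',A',A',B,B],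
      [B',A,A,B,A,B,A',A'], [B,A,B',A,A,B,A'], [A',A',A',B,A,A,B,A], [A,A,A,A,B',A',B',A'],
      [A',A',B',A',B',A,B], [A,B,A',B',A',B',A',B]]),
    ([A',B',A,A,B,A',A',B'], [P1,P3,P5,P6,P7,P11,Q1,Q3,Q5,Q6,Q11], [
      [], [A',B',A,A,B,A',A',B'], [B',A,A,B,A',A',B], [A,B,B,A',A',B',A,B],
      [B',A,A,B',A',A',B], [B,A,A,B',A',A',B,A], [B',A',B,A,A,B,B,A'],
      [B',A,B,A',A',B,A',A']])]"

text \<open>\<open>h\<close> fixes the column \<open>P4\<close>, so an element commuting with it is
  given by the images of \<open>P1\<close> (9 choices) and \<open>P4\<close> (2 choices, the fixed
  columns).\<close>

definition three_cycle_table :: "(letter list \<times> pt list \<times> letter list list)" where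
  "three_cycle_table = ([B,A',B,B,A,A,A,B',A,A], [P1,P3,P5,P7,P8,P9,Q2,Q6,Q11], [
    [], [B,A,A,B',A',A',B,A,A], [B,A',B,B,A,A,A,B',A,A], [B,A,B,A,B',A,B',A',B'],
    [A,A,B',A,A,A,A,B,A',B], [B,A,B,A',B,A',B',A',B'], [B,B,A',A',A',B',A'],
    [A,A,B,A',B',A',A',A'], [B,A',B',A,B',A',B,A',B'], [A,B',A,B',A,B,A',A'],
    [B,A,B',A,B,A',B,A,B'], [B',A',B,A',B,A], [A',A',B,A,B,B,A',B'],
    [A',A',B,A',A',B,A,A,A,A], [B,A,B,B,A',B',A,A], [A,A,A,B,A,B',A',A'], [A,B,A,A,A,B,B],
    [B,A',B,B,A,B,A,A,A,A]])"

definition three_cycle_words :: "letter list list" where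
  "three_cycle_words = [
    [B,A',B,B,A,A,A,B',A,A], [A',B,A,A,B,A,A,A,A], [A,B,B], [A',B',A,A,A,B',A',A',B],
    [A,A,B',A',B,A,B,A',B], [A',A',B',A,B,A',A',A',B'], [B,A,B,A,B',A,B',A',B'],
    [A',B',A,B',A,A,B,A]]"

definition involution_word :: "letter list" where
  "involution_word = [B,A',B,A,B',A']"

text \<open>The 48 elements of the centralizer: 8 moved columns for the image of \<open>P1\<close>,
  then 6 for that of \<open>P3\<close>. Those of order at most 2 come with a point that they and the
  involution fix; elsewhere \<open>[]\<close> is a placeholder.\<close>

definition involution_table :: "(letter list \<times> pt list) list" where
  "involution_table = [
    ([], [P5]), ([A,B,A',B,A',B',A',B',A], [P10]), ([B,B,A,A,B,A',B,A',A'], [P7]),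
    ([B',A',B',A',B,A,B,A,A], [P5]), ([A',A',B',A,A,B,A',A',B], []),
    ([B',A,A,B',A',A',B,A,A], []), ([B',A,B,A',B',A], [P10]), ([B,A',B,A,B',A'], [P5]),
    ([A,B,A,A,A,B',A',A',A'], []), ([B',A',B,A',B',A,B',A,A], []),
    ([B,A,B,A',B',A,B,B], [P5]), ([B,A',A',A',B,B,A,A,A], [P7]),
    ([A',B',A',B,B,A,B,A], [P10]), ([B',A,B',A,A,B,A], []), ([A',B',A,B,A',A',A',B], []),
    ([B,B,A',A',B,A,B'], []), ([B',A',A',B',A,A,B,A,A], []), ([B,B,A,B',A,A,A,B,A], []),
    ([A',B',A',A',B,A',B], []), ([A,B,A',A',A',B,B,A,A], [P10]),
    ([A',B,A',B',A,B,A,A,B], []), ([B',A',B,A,B',A,A,A], []),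
    ([B',A,A,B',A',B',A',A'], []), ([B,B,A,A,A,B',A,B], []), ([B',A,A,A,B',A',B,A], []),
    ([A,A,B,A,B,A',A',B], []), ([B,B,A,B',A,B,A',B], [P5]), ([A,B,B,A',B',A',B',A'], []),
    ([A,A,B,A',B,A,A], []), ([B',A',A',A',A',B,A'], []), ([B',A,A,A,B,A',B',A,A], []),
    ([B',A',A',B',A',B,A,B',A], []), ([A',B',A,B,B,A',B',A,A], []),
    ([A,A,B,B,A',A',A',B,B,A], [P7]), ([B,B,A,B,A,A,A,B',A], []),
    ([A',A',B',A,B',A',A'], []), ([B,A',A',A',B',A',B',A,B], []),
    ([A',A',A',B,A',B',A,B], []), ([B',A',A',B,B,A,A,B], [P7]), ([A,B,A,B,A,B,B,A'], []),
    ([B,A,A,A,A,B',A',B',A'], []), ([A',B,A',A',A',B',A',B,B], []),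
    ([B,A,B',A,A,B',A], []), ([B',A',B,A',A',A',B,B], []), ([A',A',B,A,B,B,A',B,A], []),
    ([B',A',B,A',B,A',B,A',A'], [P5]), ([A,B',A,A,A,A,B], []),
    ([A,B,A,B,A',A',A',A',B'], [])]"

section \<open>Elements that are commutators\<close>

definition cls :: "pt list" where
  "cls = [P1, P2, P3, P4, P5, P6, P7, P8, P9, P10, P11]"

lemma set_cls: "set cls = cols"
  by (simp add: cls_def)

lemma list_all_cls: "list_all P cls \<Longrightarrow> P (col p)"
  unfolding list_all_iff set_cls using col_in_cols by blast

text \<open>One orbit only: each pair generates a group transitive on the 22 points and thus serves
  all even sets. The words \<open>g\<close> are the eight of \<open>four_chain_table\<close> and the
  eight of \<open>three_cycle_words\<close>.\<close>

lemma generic_certs_ok: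
  "list_all (\<lambda>(x, y, g, wp, wp', os). comm_ok x y g wp wp' os \<and> length os = 1) generic_certs"
  by code_simp

lemma involution_certs_ok:
  "list_all (\<lambda>(x, y, g, wp, wp', os). comm_ok x y g wp wp' os \<and> g = involution_word \<and> length os = 2)
     (row_certs @ column_certs)"
  by code_simp

lemma comm_ok_UNIV:
  assumes "comm_ok x y g wp wp' os" shows "set (concat os) = UNIV"
proof (rule card_subset_eq)
  show "card (set (concat os)) = card (UNIV :: pt set)"
    using assms distinct_card[of "concat os"] unfolding comm_ok_def by (simp only: card_pt)
qed auto

lemma commutes_to_generic:
  assumes "(x, y, g, wp, wp', os) \<in> set generic_certs" "even (card F)"
  shows "commutes_to F (ev g)"
proof -
  have ok: "comm_ok x y g wp wp' os" and "length os = 1"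
    using assms(1) generic_certs_ok by (auto simp: list_all_iff)
  then obtain ps where "os = [ps]" by (auto simp: length_Suc_conv)
  then show ?thesis
    using commutes_to_of_comm_ok[OF ok, of F] comm_ok_UNIV[OF ok] assms(2) by simp
qed

definition sd_list :: "'a set list \<Rightarrow> 'a set" where
  "sd_list Ss = foldr sd Ss {}"

lemma mem_sd_list: "p \<in> sd_list Ss \<longleftrightarrow> odd (length (filter (\<lambda>S. p \<in> S) Ss))"
  by (induction Ss) (auto simp: sd_list_def mem_sd)

text \<open>This linearity turns a relation between sets, checked pointwise, into one between
  parities of intersections with \<open>F\<close>.\<close>

lemma even_card_sd_list:
  fixes F :: "'a::finite set"
  shows "even (card (F \<inter> sd_list Ss)) \<longleftrightarrow> even (length (filter (\<lambda>S. odd (card (F \<inter> S))) Ss))"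
proof (induction Ss)
  case (Cons S Ss)
  have "F \<inter> sd_list (S # Ss) = sd (F \<inter> S) (F \<inter> sd_list Ss)"
    by (auto simp: sd_list_def sd_def)
  then show ?case using Cons by (auto simp: even_card_sd)
qed (simp add: sd_list_def)

lemma even_card_Compl:
  fixes F :: "pt set"
  assumes "even (card F)"
  shows "even (card (F - S)) \<longleftrightarrow> even (card (F \<inter> S))"
proof -
  have "card F = card (F - S) + card (F \<inter> S)"
    by (subst card_Un_disjoint[symmetric]) (auto intro: arg_cong[where f = card])
  then show ?thesis using assms by simp
qed

definition first_orbits :: "('a \<times> 'b \<times> 'c \<times> 'd \<times> 'e \<times> pt list list) list \<Rightarrow> pt list list" where
  "first_orbits cs = map (\<lambda>(x, y, g, wp, wp', os). hd os) cs"

text \<open>No pair with commutator an involution \<open>i\<close> generates a transitive group, so that one pair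
  does not suffice. The four subgroups \<open>L\<^sub>2(11)\<close> that contain \<open>i\<close> and whose orbits have length 11,
  and the stabilizers of the three columns fixed by \<open>i\<close> do, since the symmetric difference of
  four orbits of the former is the union of the three columns.\<close>

lemma commutes_to_involution:
  assumes F: "even (card F)"
  shows "commutes_to F (ev involution_word)"
proof (rule ccontr)
  assume neg: "\<not> commutes_to F (ev involution_word)"
  \<comment> \<open>There are two orbits and \<open>F\<close> is even, so a failure on one of them
    is a failure on both.\<close>
  have odd: "odd (card (F \<inter> set ps))" if ps: "ps \<in> set (first_orbits (row_certs @ column_certs))" for ps
  proof -
    obtain x y g wp wp' os where c: "(x, y, g, wp, wp', os) \<in> set (row_certs @ column_certs)"
        "ps = hd os"
      using ps by (auto simp: first_orbits_def simp del: set_append map_append)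
    from bspec[OF involution_certs_ok[unfolded list_all_iff] this(1)]
    have ok: "comm_ok x y g wp wp' os" and g: "g = involution_word" and "length os = 2"
      by auto
    then obtain qs where os: "os = [ps, qs]" using c(2) by (auto simp: length_Suc_conv numeral_eq_Suc)
    have "set ps \<union> set qs = UNIV" "set ps \<inter> set qs = {}"
      using comm_ok_UNIV[OF ok] ok by (auto simp: os comm_ok_def)
    then have "F \<inter> set qs = F - set ps" by blast
    moreover have "\<exists>rs\<in>set os. odd (card (F \<inter> set rs))"
      using commutes_to_of_comm_ok[OF ok] neg unfolding g by blast
    ultimately show ?thesis using even_card_Compl[OF F, of "set ps"] unfolding os by auto
  qed
  let ?r = "map set (first_orbits row_certs)" and ?c = "map set (first_orbits column_certs)"
  have "list_all (\<lambda>p. even (length (filter (\<lambda>S. p \<in> set S) (first_orbits row_certs)))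
      = even (length (filter (\<lambda>S. p \<in> set S) (first_orbits column_certs)))) pts"
    by code_simp
  then have "sd_list ?r = sd_list ?c"
    by (auto simp: list_all_pts mem_sd_list filter_map comp_def)
  moreover have all: "filter (\<lambda>S. odd (card (F \<inter> S))) (map set Ss) = map set Ss"
    if "set Ss \<subseteq> set (first_orbits (row_certs @ column_certs))" for Ss
    using odd that by (intro filter_True) auto
  moreover have "filter (\<lambda>S. odd (card (F \<inter> S))) ?r = ?r" "filter (\<lambda>S. odd (card (F \<inter> S))) ?c = ?c"
    by (rule all, simp add: first_orbits_def)+
  \<comment> \<open>The two families have the same sum, but 4 and 3 members, all met oddly by
    \<open>F\<close>.\<close>
  ultimately have "even (length ?r) \<longleftrightarrow> even (length ?c)"
    using even_card_sd_list[of F ?r] even_card_sd_list[of F ?c] by (simp only:)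
  moreover have "length (first_orbits row_certs) = 4" "length (first_orbits column_certs) = 3"
    by code_simp+
  ultimately show False by simp
qed

text \<open>4-transitivity moves the four given columns to \<open>P1\<close>, ...,
  \<open>P4\<close>; the last condition carries relations under \<open>x\<close> over to
  \<open>x'\<close>.\<close>

lemma conj_normal_form:
  assumes x: "x \<in> N" and d: "distinct [col p1, col p2, col p3, col p4]"
  obtains t x' where "t \<in> N" "x' \<in> N" "x \<circ> t = t \<circ> x'"
    "col (t P1) = col p1" "col (t P2) = col p2" "col (t P3) = col p3" "col (t P4) = col p4"
    "\<forall>p q. col (x (t p)) = col (t q) \<longleftrightarrow> col (x' p) = col q"
proof -
  obtain t where t: "t \<in> N" "base t = [col p1, col p2, col p3, col p4]"
    using ex_base[OF d] col_in_cols by (metis empty_subsetI insert_subset)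
  obtain k where k: "k \<in> N" "k \<circ> t = id" "t \<circ> k = id" using N_inverse[OF t(1)] by metis
  have e: "x \<circ> t = t \<circ> (k \<circ> x \<circ> t)" using k(3) by (simp flip: comp_assoc)
  have "col (x (t p)) = col (t q) \<longleftrightarrow> col ((k \<circ> x \<circ> t) p) = col q" for p q
    using fun_cong[OF e, of p] col_N_inj[OF t(1), of "(k \<circ> x \<circ> t) p" q] by simp
  then show thesis
    using that[of t "k \<circ> x \<circ> t"] t k x e by (simp add: base_def comp_in_N)
qed

text \<open>In terms of the column permutation: a cycle of length at least 4, and for
  \<open>has_three_cycle\<close> one of length 3. If there is neither, its square is
  trivial.\<close>

definition has_chain :: "(pt \<Rightarrow> pt) \<Rightarrow> bool" where
  "has_chain x \<longleftrightarrow> list_ex (\<lambda>p. distinct [col p, col (x p), col (x (x p)), col (x (x (x p)))]) pts"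

definition has_three_cycle :: "(pt \<Rightarrow> pt) \<Rightarrow> bool" where
  "has_three_cycle x \<longleftrightarrow>
     list_ex (\<lambda>p. distinct [col p, col (x p), col (x (x p))] \<and> col (x (x (x p))) = col p) pts"

lemma list_ex_pts: "list_ex P pts \<longleftrightarrow> (\<exists>p. P p)"
  by (simp add: list_ex_iff set_pts)

lemma col_swap:
  assumes "g \<in> N" "col p = col q" shows "col (g p) = col (g q)"
  using col_N_inj[OF assms(1)] assms(2) by blast

lemma eq_ev_of_base:
  assumes "x \<in> N" "base (ev h) = [col (x P1), col (x P2), col (x P3), col (x P4)]"
  shows "x = ev h"
  using base_inj[OF assms(1) ev_in_N, of h] assms(2) by (simp add: base_def)

text \<open>With the images of \<open>P1\<close>, \<open>P2\<close>, \<open>P3\<close> prescribed,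
  eight columns remain for the image of \<open>P4\<close>, each with an entry of its own.\<close>

lemma four_chain_base:
  "list_all (\<lambda>c. c \<in> {P2, P3, P4} \<or> list_ex (\<lambda>(h, w, Ws). base (ev h) = [P2, P3, P4, c]) four_chain_table) cls"
  by code_simp

lemma three_cycle_base:
  "list_all (\<lambda>c. c \<in> {P1, P2, P3} \<or> list_ex (\<lambda>h. base (ev h) = [P2, P3, P1, c]) three_cycle_words) cls"
  by code_simp

lemma conj_of_has_chain:
  assumes x: "x \<in> N" and ch: "has_chain x"
  obtains t h w Ws where "t \<in> N" "(h, w, Ws) \<in> set four_chain_table" "x \<circ> t = t \<circ> ev h"
proof -
  obtain p where p: "distinct [col p, col (x p), col (x (x p)), col (x (x (x p)))]"
    using ch by (auto simp: has_chain_def list_ex_pts)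
  obtain t x' where t: "t \<in> N" "x' \<in> N" "x \<circ> t = t \<circ> x'"
    and tp: "col (t P1) = col p" "col (t P2) = col (x p)" "col (t P3) = col (x (x p))"
      "col (t P4) = col (x (x (x p)))"
    and n: "\<forall>p q. col (x (t p)) = col (t q) \<longleftrightarrow> col (x' p) = col q"
    by (rule conj_normal_form[OF x p])
  have b: "col (x' P1) = P2" "col (x' P2) = P3" "col (x' P3) = P4"
    using n[rule_format, of P1 P2] n[rule_format, of P2 P3] n[rule_format, of P3 P4] tp
      col_swap[OF x tp(1)] col_swap[OF x tp(2)] col_swap[OF x tp(3)] by simp_all
  have "col (x' P4) \<notin> {P2, P3, P4}"
    using b col_N_inj[OF t(2), of P4 P1] col_N_inj[OF t(2), of P4 P2] col_N_inj[OF t(2), of P4 P3] by auto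
  then obtain h w Ws where h: "(h, w, Ws) \<in> set four_chain_table" "base (ev h) = [P2, P3, P4, col (x' P4)]"
    using list_all_cls[OF four_chain_base, of "x' P4"] by (auto simp: list_ex_iff)
  have "x' = ev h" using eq_ev_of_base[OF t(2)] h(2) b by simp
  then show thesis using that t h by blast
qed

lemma conj_of_three_cycle:
  assumes x: "x \<in> N" and c: "has_three_cycle x"
  obtains t h where "t \<in> N" "h \<in> set three_cycle_words" "x \<circ> t = t \<circ> ev h"
proof -
  obtain p where p: "distinct [col p, col (x p), col (x (x p))]" "col (x (x (x p))) = col p"
    using c by (auto simp: has_three_cycle_def list_ex_pts)
  have "card {col p, col (x p), col (x (x p))} \<le> 3" by (simp add: card_insert_if)
  then have "{col p, col (x p), col (x (x p))} \<noteq> cols" using card_cols by force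
  then obtain s where s: "s \<in> cols" "s \<notin> {col p, col (x p), col (x (x p))}"
    using col_in_cols by blast
  have "distinct [col p, col (x p), col (x (x p)), col s]"
    using p(1) s col_of_cols[OF s(1)] by auto
  then obtain t x' where t: "t \<in> N" "x' \<in> N" "x \<circ> t = t \<circ> x'"
    and tp: "col (t P1) = col p" "col (t P2) = col (x p)" "col (t P3) = col (x (x p))"
    and n: "\<forall>p q. col (x (t p)) = col (t q) \<longleftrightarrow> col (x' p) = col q"
    by (rule conj_normal_form[OF x]) blast
  have b: "col (x' P1) = P2" "col (x' P2) = P3" "col (x' P3) = P1"
    using n[rule_format, of P1 P2] n[rule_format, of P2 P3] n[rule_format, of P3 P1] tp p(2)
      col_swap[OF x tp(1)] col_swap[OF x tp(2)] col_swap[OF x tp(3)] by simp_all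
  have "col (x' P4) \<notin> {P1, P2, P3}"
    using b col_N_inj[OF t(2), of P4 P1] col_N_inj[OF t(2), of P4 P2] col_N_inj[OF t(2), of P4 P3] by auto
  then obtain h where h: "h \<in> set three_cycle_words" "base (ev h) = [P2, P3, P1, col (x' P4)]"
    using list_all_cls[OF three_cycle_base, of "x' P4"] by (auto simp: list_ex_iff)
  have "x' = ev h" using eq_ev_of_base[OF t(2)] h(2) b by simp
  then show thesis using that t h by blast
qed

lemma col_square_id:
  assumes x: "x \<in> N" and "\<not> has_chain x" "\<not> has_three_cycle x"
  shows "col (x (x p)) = col p"
proof (rule ccontr)
  assume ne: "col (x (x p)) \<noteq> col p"
  have "col (x p) \<noteq> col p" using ne col_swap[OF x] by metis
  moreover from this have "col (x (x p)) \<noteq> col (x p)" "col (x (x (x p))) \<noteq> col (x (x p))"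
    using col_N_inj[OF x] by simp_all
  moreover have "col (x (x (x p))) \<noteq> col (x p)" using ne col_N_inj[OF x] by simp
  ultimately have "has_chain x \<or> has_three_cycle x"
    using ne unfolding has_chain_def has_three_cycle_def list_ex_pts by (metis distinct_length_2_or_more distinct_singleton)
  then show False using assms by blast
qed

text \<open>If only one pair of columns were exchanged, nine columns would be fixed, and four of
  these already force the identity. Two exchanged pairs give four columns with known images, hence a
  single normal form.\<close>

lemma conj_of_involution:
  assumes x: "x \<in> N" "x \<noteq> id" and sq: "\<And>p. col (x (x p)) = col p"
  obtains t where "t \<in> N" "x \<circ> t = t \<circ> ev involution_word"
proof -
  have "base x \<noteq> base id" using x base_inj[OF x(1) id_in_N] by blast
  moreover have "base x = base id" if "\<forall>p. col (x p) = col p" using that by (simp add: base_def)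
  ultimately obtain p where p: "col (x p) \<noteq> col p" by blast
  have "\<exists>s. col (x s) \<noteq> col s \<and> col s \<notin> {col p, col (x p)}"
  proof (rule ccontr)
    assume neg: "\<not> ?thesis"
    have sub: "{col p, col (x p)} \<subseteq> cols" using col_in_cols by blast
    have "card (cols - {col p, col (x p)}) = 11 - card {col p, col (x p)}"
      by (subst card_Diff_subset[OF _ sub]) (simp_all only: card_cols finite.intros)
    then have "4 \<le> card (cols - {col p, col (x p)})" by (simp add: card_insert_if)
    then obtain cs where cs: "distinct cs" "length cs = 4" "set cs \<subseteq> cols - {col p, col (x p)}"
      by (rule distinct_list_in[OF finite])
    then obtain c1 c2 c3 c4 where c: "cs = [c1, c2, c3, c4]"
      by (auto simp: length_Suc_conv numeral_eq_Suc)
    have "col (x c) = col (id c)" if "c \<in> {c1, c2, c3, c4}" for c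
    proof -
      have "c \<in> set cs" using that unfolding c by simp
      then have cc: "c \<in> cols - {col p, col (x p)}" by (rule subsetD[OF cs(3)])
      have "col c = c" by (rule col_of_cols[OF DiffD1[OF cc]])
      moreover have "col (x c) = col c" using neg DiffD2[OF cc] \<open>col c = c\<close> by metis
      ultimately show ?thesis by simp
    qed
    moreover have "{c1, c2, c3, c4} \<subseteq> cols"
      using subset_trans[OF cs(3) Diff_subset] unfolding c list.set .
    moreover have "distinct [c1, c2, c3, c4]" using cs(1) unfolding c .
    ultimately have "x = id" using eq_of_four_cols[OF x(1) id_in_N, of c1 c2 c3 c4] by simp
    then show False using x(2) by blast
  qed
  then obtain s where s: "col (x s) \<noteq> col s" "col s \<noteq> col p" "col s \<noteq> col (x p)" by blast
  have "col (x s) \<noteq> col (x p)" using s(2) col_N_inj[OF x(1)] by blast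
  moreover have "col (x s) \<noteq> col p" using s(3) sq col_N_inj[OF x(1), of s "x p"] by metis
  ultimately have "distinct [col p, col (x p), col s, col (x s)]" using p s by auto
  then obtain t x' where t: "t \<in> N" "x' \<in> N" "x \<circ> t = t \<circ> x'"
    and tp: "col (t P1) = col p" "col (t P2) = col (x p)" "col (t P3) = col s" "col (t P4) = col (x s)"
    and n: "\<forall>p q. col (x (t p)) = col (t q) \<longleftrightarrow> col (x' p) = col q"
    by (rule conj_normal_form[OF x(1)])
  have "col (x' P1) = P2" "col (x' P2) = P1" "col (x' P3) = P4" "col (x' P4) = P3"
    using n[rule_format, of P1 P2] n[rule_format, of P2 P1] n[rule_format, of P3 P4] n[rule_format, of P4 P3] tp sq
      col_swap[OF x(1) tp(1)] col_swap[OF x(1) tp(2)] col_swap[OF x(1) tp(3)] col_swap[OF x(1) tp(4)]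
    by simp_all
  moreover have "base (ev involution_word) = [P2, P1, P4, P3]" by code_simp
  ultimately have "x' = ev involution_word" using eq_ev_of_base[OF t(2)] by simp
  then show thesis using that t by blast
qed

lemma commutes_to_nontrivial:
  assumes g: "g \<in> N" "g \<noteq> id" and F: "even (card F)"
  shows "commutes_to F g"
proof -
  have lift: "commutes_to F g"
    if t: "t \<in> N" "g \<circ> t = t \<circ> ev h" and h: "\<And>F. even (card F) \<Longrightarrow> commutes_to F (ev h)" for t h
  proof -
    obtain k where k: "k \<in> N" "t \<circ> k = id" using N_inverse[OF t(1)] by metis
    have "commutes_to (k ` F) (ev h)" using h F k(1) by simp
    from commutes_to_conj[OF this t] have "commutes_to (t ` (k ` F)) g" .
    then show ?thesis by (simp add: image_comp k(2))
  qed
  have words: "list_all (\<lambda>h. list_ex (\<lambda>(x, y, g, wp, wp', os). g = h) generic_certs)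
      (map fst four_chain_table @ three_cycle_words)"
    by code_simp
  have gen: "commutes_to F (ev h)"
    if "h \<in> set (map fst four_chain_table @ three_cycle_words)" "even (card F)" for h F
    using words that commutes_to_generic unfolding list_all_iff list_ex_iff by fast
  show ?thesis
  proof (cases "has_chain g")
    case True
    then obtain t h w Ws where "t \<in> N" "(h, w, Ws) \<in> set four_chain_table" "g \<circ> t = t \<circ> ev h"
      by (rule conj_of_has_chain[OF g(1)])
    then show ?thesis using lift gen[of h] by force
  next
    case nch: False
    show ?thesis
    proof (cases "has_three_cycle g")
      case True
      then obtain t h where "t \<in> N" "h \<in> set three_cycle_words" "g \<circ> t = t \<circ> ev h"
        by (rule conj_of_three_cycle[OF g(1)])
      then show ?thesis using lift gen[of h] by force
    next
      case False
      obtain t where "t \<in> N" "g \<circ> t = t \<circ> ev involution_word"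
        by (rule conj_of_involution[OF g col_square_id[OF g(1) nch False]])
      then show ?thesis using lift commutes_to_involution by blast
    qed
  qed
qed

section \<open>Commutators over the identity\<close>

lemma column_set_certs_ok:
  "list_all (\<lambda>(T, x, y, g, wp, wp', os). comm_ok x y g wp wp' os \<and> g = []
     \<and> list_all (\<lambda>ps. even (length (filter (\<lambda>p. col p \<in> set T) ps))) os) column_set_certs"
  by code_simp

definition full :: "pt set \<Rightarrow> pt set" where
  "full T = {p. col p \<in> T}"

lemma commutes_to_full:
  assumes "(T, x, y, g, wp, wp', os) \<in> set column_set_certs"
  shows "commutes_to (full (set T)) id"
proof -
  from bspec[OF column_set_certs_ok[unfolded list_all_iff] assms]
  have ok: "comm_ok x y g wp wp' os" and g: "g = []"
    and ev: "\<forall>ps\<in>set os. even (length (filter (\<lambda>p. col p \<in> set T) ps))"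
    by (auto simp: list_all_iff)
  have "even (card (full (set T) \<inter> set ps))" if ps: "ps \<in> set os" for ps
  proof -
    have "distinct ps" using ok ps by (auto simp: comm_ok_def distinct_concat_iff)
    moreover have "full (set T) \<inter> set ps = set (filter (\<lambda>p. col p \<in> set T) ps)"
      by (auto simp: full_def)
    ultimately show ?thesis using ev ps distinct_card[of "filter (\<lambda>p. col p \<in> set T) ps"] by simp
  qed
  from commutes_to_of_comm_ok[OF ok this] show ?thesis by (simp add: g ev_Nil del: ev.simps)
qed

lemma image_full:
  assumes k: "k \<in> N" and T: "T \<subseteq> cols" shows "k ` full T = full ((\<lambda>c. col (k c)) ` T)"
proof
  obtain k' where k': "k' \<in> N" "k' \<circ> k = id" "k \<circ> k' = id" using N_inverse[OF k] by metis
  show "k ` full T \<subseteq> full ((\<lambda>c. col (k c)) ` T)"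
  proof
    fix q assume "q \<in> k ` full T"
    then obtain p where "q = k p" "col p \<in> T" by (auto simp: full_def)
    moreover from this have "col q = col (k (col p))" by (simp add: col_N[OF k])
    ultimately show "q \<in> full ((\<lambda>c. col (k c)) ` T)" by (auto simp: full_def)
  qed
  show "full ((\<lambda>c. col (k c)) ` T) \<subseteq> k ` full T"
  proof
    fix q assume "q \<in> full ((\<lambda>c. col (k c)) ` T)"
    then obtain c where c: "c \<in> T" "col q = col (k c)" by (auto simp: full_def)
    have "col (k' q) = col (k' (k c))" using col_swap[OF k'(1) c(2)] .
    also have "\<dots> = c" using fun_cong[OF k'(2), of c] col_of_cols[OF subsetD[OF T c(1)]] by simp
    finally have "k' q \<in> full T" using c(1) by (simp add: full_def)
    moreover have "q = k (k' q)" using fun_cong[OF k'(3), of q] by simp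
    ultimately show "q \<in> k ` full T" by blast
  qed
qed

lemma column_set_cert_sets:
  "map fst column_set_certs = [[P1], [P1, P2, P3], [P3, P4, P5, P6, P7, P8, P9, P10, P11],
     [P5, P6, P7, P8, P9, P10, P11], [P1, P2, P3, P4, P5], [P1, P2, P3, P4, P6],
     [P1, P2, P3, P4, P7], [P1, P2, P3, P4, P8], [P1, P2, P3, P4, P9], [P1, P2, P3, P4, P10],
     [P1, P2, P3, P4, P11]]"
  by code_simp

lemma commutes_to_full_image:
  assumes T: "T \<in> set (map fst column_set_certs)" "set T \<subseteq> cols" and t: "t \<in> N"
  shows "commutes_to (full ((\<lambda>c. col (t c)) ` set T)) id"
proof -
  have "commutes_to (full (set T)) id" using T(1) commutes_to_full by fastforce
  from commutes_to_conj[OF this t, of id] show ?thesis by (simp add: image_full[OF t T(2)])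
qed

lemma ex_col_perm:
  assumes "distinct (xs @ ys)" "length (xs @ ys) = 4" "set (xs @ ys) \<subseteq> cols"
  obtains t where "t \<in> N" "map (\<lambda>c. col (t c)) [P1, P2, P3, P4] = xs @ ys"
proof -
  have "xs @ ys \<in> base ` N"
    using assms bij_betw_imp_surj_on[OF bij_betw_base] by auto
  then show thesis using that by (metis (no_types, lifting) base_def imageE)
qed

lemma image_cols_Diff:
  assumes t: "t \<in> N" and S: "S \<subseteq> cols"
  shows "(\<lambda>c. col (t c)) ` (cols - S) = cols - (\<lambda>c. col (t c)) ` S"
proof -
  let ?f = "\<lambda>c. col (t c)"
  have inj: "inj_on ?f cols" unfolding inj_on_def col_N_inj[OF t] by (metis col_of_cols)
  have "?f ` cols \<subseteq> cols" using col_in_cols by blast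
  then have "?f ` cols = cols" using inj by (intro endo_inj_surj finite_subset[OF subset_UNIV finite])
  then show ?thesis using inj_on_image_set_diff[OF inj Diff_subset S] by metis
qed

lemma commutes_to_full_odd:
  assumes T: "T \<subseteq> cols" "odd (card T)" "T \<noteq> cols"
  shows "commutes_to (full T) id"
proof -
  have fin: "finite T" by simp
  have cU: "card (cols - T) = 11 - card T" using card_Diff_subset[OF fin T(1)] unfolding card_cols .
  have le: "card T \<le> 11" using card_mono[OF _ T(1)] unfolding card_cols by simp
  have "card T \<noteq> 11" using T(1,3) card_subset_eq[OF _ T(1)] unfolding card_cols by blast
  then have "card T < 11" using le by simp
  then have "card T \<in> {0, 1, 2, 3, 4, 5, 6, 7, 8, 9, 10}" by (simp add: less_Suc_eq numeral_eq_Suc)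
  then consider "card T = 1" | "card T = 3" | "card T = 5" | "card T = 7" | "card T = 9"
    using T(2) by auto
  then show ?thesis
  proof cases
    case 1
    then obtain c1 where c: "T = {c1}" by (rule card_1_singletonE)
    obtain ys where ys: "distinct ys" "length ys = 3" "set ys \<subseteq> cols - T"
      using distinct_list_in[of "cols - T" 3] cU 1 by auto
    obtain t where t: "t \<in> N" "map (\<lambda>c. col (t c)) [P1, P2, P3, P4] = [c1] @ ys"
      by (rule ex_col_perm[of "[c1]" ys]) (use ys c T(1) in auto)
    have "T = (\<lambda>c. col (t c)) ` set [P1]" using t(2) c by simp
    then show ?thesis using commutes_to_full_image[OF _ _ t(1), of "[P1]"] column_set_cert_sets by simp
  next
    case 2
    obtain xs where xs: "distinct xs" "length xs = 3" "set xs \<subseteq> T"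
      using distinct_list_in[of T 3] 2 by auto
    obtain ys where ys: "distinct ys" "length ys = 1" "set ys \<subseteq> cols - T"
      using distinct_list_in[of "cols - T" 1] cU 2 by auto
    have "set xs = T" using xs 2 by (intro card_subset_eq) (simp_all add: distinct_card)
    obtain t where t: "t \<in> N" "map (\<lambda>c. col (t c)) [P1, P2, P3, P4] = xs @ ys"
      by (rule ex_col_perm[of xs ys]) (use xs ys T(1) in auto)
    have "xs = map (\<lambda>c. col (t c)) [P1, P2, P3]"
      using arg_cong[OF t(2), of "take 3"] xs(2) by (simp add: numeral_eq_Suc)
    then have "T = (\<lambda>c. col (t c)) ` set [P1, P2, P3]" using \<open>set xs = T\<close> by auto
    then show ?thesis
      using commutes_to_full_image[OF _ _ t(1), of "[P1, P2, P3]"] column_set_cert_sets by simp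
  next
    case 3
    \<comment> \<open>Four of the five columns are the images of \<open>P1\<close>, ...,
      \<open>P4\<close>. The preimage \<open>?q\<close> of the fifth cannot be prescribed, so each
      of its seven values has a certificate.\<close>
    obtain xs where xs: "distinct xs" "length xs = 4" "set xs \<subseteq> T"
      using distinct_list_in[of T 4] 3 by auto
    obtain t where t: "t \<in> N" "map (\<lambda>c. col (t c)) [P1, P2, P3, P4] = xs @ []"
      by (rule ex_col_perm[of xs "[]"]) (use xs T(1) in auto)
    obtain k where k: "k \<in> N" "t \<circ> k = id" using N_inverse[OF t(1)] by metis
    have "card (T - set xs) = 1"
      using card_Diff_subset[of "set xs" T] xs 3 distinct_card[OF xs(1)] by simp
    then obtain d where d: "T - set xs = {d}" by (rule card_1_singletonE)
    let ?q = "col (k d)"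
    have tq: "col (t ?q) = d"
    proof -
      have "col (t ?q) = col ((t \<circ> k) d)" by (simp add: col_N[OF t(1)])
      also have "\<dots> = d" unfolding k(2) id_apply using d T(1) by (intro col_of_cols) blast
      finally show ?thesis .
    qed
    have "d \<notin> set xs" using d by blast
    then have "?q \<notin> {P1, P2, P3, P4}" using tq t(2) by auto
    then have q: "?q \<in> {P5, P6, P7, P8, P9, P10, P11}" using col_in_cols[of "k d"] by blast
    have "set xs = (\<lambda>c. col (t c)) ` {P1, P2, P3, P4}" using arg_cong[OF t(2), of set] by simp
    then have "T = (\<lambda>c. col (t c)) ` set [P1, P2, P3, P4, ?q]" using d xs(3) tq by auto
    moreover have "[P1, P2, P3, P4, ?q] \<in> set (map fst column_set_certs)"
      unfolding column_set_cert_sets using q by auto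
    ultimately show ?thesis
      using commutes_to_full_image[OF _ _ t(1), of "[P1, P2, P3, P4, ?q]"] col_in_cols[of "k d"] by simp
  next
    case 4
    obtain xs where xs: "distinct xs" "length xs = 4" "set xs \<subseteq> cols - T"
      using distinct_list_in[of "cols - T" 4] cU 4 by auto
    have "set xs = cols - T" using xs cU 4 by (intro card_subset_eq) (simp_all add: distinct_card)
    obtain t where t: "t \<in> N" "map (\<lambda>c. col (t c)) [P1, P2, P3, P4] = xs @ []"
      by (rule ex_col_perm[of xs "[]"]) (use xs in auto)
    have "set xs = (\<lambda>c. col (t c)) ` {P1, P2, P3, P4}" using arg_cong[OF t(2), of set] by simp
    then have "(\<lambda>c. col (t c)) ` (cols - {P1, P2, P3, P4}) = cols - set xs"
      by (simp only: image_cols_Diff[OF t(1)] insert_subset empty_subsetI insert_iff simp_thms)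
    also have "\<dots> = T" unfolding \<open>set xs = cols - T\<close> using T(1) by blast
    finally have "(\<lambda>c. col (t c)) ` (cols - {P1, P2, P3, P4}) = T" .
    moreover have "cols - {P1, P2, P3, P4} = set [P5, P6, P7, P8, P9, P10, P11]" by auto
    ultimately show ?thesis
      using commutes_to_full_image[OF _ _ t(1), of "[P5, P6, P7, P8, P9, P10, P11]"] column_set_cert_sets
      by simp
  next
    case 5
    obtain xs where xs: "distinct xs" "length xs = 2" "set xs \<subseteq> cols - T"
      using distinct_list_in[of "cols - T" 2] cU 5 by auto
    obtain ys where ys: "distinct ys" "length ys = 2" "set ys \<subseteq> T"
      using distinct_list_in[of T 2] 5 by auto
    have "set xs = cols - T" using xs cU 5 by (intro card_subset_eq) (simp_all add: distinct_card)
    obtain t where t: "t \<in> N" "map (\<lambda>c. col (t c)) [P1, P2, P3, P4] = xs @ ys"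
      by (rule ex_col_perm[of xs ys]) (use xs ys T(1) in auto)
    have "xs = map (\<lambda>c. col (t c)) [P1, P2]"
      using arg_cong[OF t(2), of "take 2"] xs(2) by (simp add: numeral_eq_Suc)
    then have "set xs = (\<lambda>c. col (t c)) ` {P1, P2}" by auto
    then have "(\<lambda>c. col (t c)) ` (cols - {P1, P2}) = cols - set xs"
      by (simp only: image_cols_Diff[OF t(1)] insert_subset empty_subsetI insert_iff simp_thms)
    also have "\<dots> = T" unfolding \<open>set xs = cols - T\<close> using T(1) by blast
    finally have "(\<lambda>c. col (t c)) ` (cols - {P1, P2}) = T" .
    moreover have "cols - {P1, P2} = set [P3, P4, P5, P6, P7, P8, P9, P10, P11]" by auto
    ultimately show ?thesis
      using commutes_to_full_image[OF _ _ t(1), of "[P3, P4, P5, P6, P7, P8, P9, P10, P11]"]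
        column_set_cert_sets by simp
  qed
qed

lemma commutes_to_rotation:
  assumes F: "even (card F)" "even (card (F \<inter> cols))"
  shows "commutes_to F id"
proof -
  let ?os = "[cls, [Q1, Q2, Q3, Q4, Q5, Q6, Q7, Q8, Q9, Q10, Q11]]"
  \<comment> \<open>Eleven steps of \<open>permA\<close> fix \<open>P1\<close> with odd exponent and
    \<open>y\<close> is the identity, so the parities are independent and only the two orbits of
    \<open>permA\<close> matter.\<close>
  have ok: "comm_ok [A] [] [] (replicate 11 True, P1) ([False], P1) ?os" by code_simp
  have "set cls \<union> {Q1, Q2, Q3, Q4, Q5, Q6, Q7, Q8, Q9, Q10, Q11} = UNIV"
    using comm_ok_UNIV[OF ok] by simp
  then have "{Q1, Q2, Q3, Q4, Q5, Q6, Q7, Q8, Q9, Q10, Q11} = - cols" by (auto simp: set_cls)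
  then have "F \<inter> {Q1, Q2, Q3, Q4, Q5, Q6, Q7, Q8, Q9, Q10, Q11} = F - cols" by blast
  then have "list_all (\<lambda>ps. even (card (F \<inter> set ps))) ?os"
    using F(2) even_card_Compl[OF F(1), of cols] by (simp only: list.pred_inject set_cls list.set simp_thms)
  then have "even (card (F \<inter> set ps))" if "ps \<in> set ?os" for ps
    using that unfolding list_all_iff by blast
  from commutes_to_of_comm_ok[OF ok this] show ?thesis by (simp only: ev_Nil)
qed

text \<open>If the 22 points are identified with the blocks of the Hadamard 3-design on 12 points, then the
  images of \<^term>\<open>cols\<close> under \<open>N\<close> are the 12 sets of blocks through a point. A union of two
  columns is the symmetric difference of six of them.\<close>

lemma block_words_ok:
  "list_all (\<lambda>(v, c, c'). list_all (\<lambda>p.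
       odd (length (filter (\<lambda>w. p \<in> set (map (ev (v @ w)) cls)) block_words)) = (col p = c \<or> col p = c')) pts)
     [([], P1, P2), ([A], P2, P3), ([A, A], P3, P4), ([A, A, A], P4, P5), ([A, A, A, A], P5, P6),
      ([A, A, A, A, A], P6, P7), ([A', A', A', A', A'], P7, P8), ([A', A', A', A'], P8, P9),
      ([A', A', A'], P9, P10), ([A', A'], P10, P11)]"
  by code_simp

lemma full_singleton:
  assumes "p \<noteq> col p" shows "full {col p} = {p, col p}"
proof -
  have "list_all (\<lambda>p. p = col p \<or> list_all (\<lambda>q. (col q = col p) = (q = p \<or> q = col p)) pts) pts"
    by code_simp
  then show ?thesis using assms by (auto simp: list_all_pts full_def)
qed

text \<open>By conjugation a counterexample \<open>F\<close> is odd on all images of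
  \<open>cols\<close>. Six of them add up to two columns, so all columns meet \<open>F\<close> in
  the same parity, and eleven odd columns would make \<open>F\<close> odd. Hence \<open>F\<close> is
  a union of columns, of an odd number since \<open>F\<close> is odd on \<open>cols\<close>, but not
  of all.\<close>

lemma commutes_to_id:
  assumes F: "even (card F)" "F \<noteq> UNIV"
  shows "commutes_to F id"
proof (rule ccontr)
  assume neg: "\<not> commutes_to F id"
  have odd: "odd (card (F \<inter> ev w ` cols))" for w
  proof
    assume e: "even (card (F \<inter> ev w ` cols))"
    obtain k where k: "k \<in> N" "k \<circ> ev w = id" "ev w \<circ> k = id" using N_inverse[OF ev_in_N] by metis
    have "k ` (F \<inter> ev w ` cols) = k ` F \<inter> cols"
      unfolding image_Int[OF inj_N[OF k(1)]] image_comp k(2) by (simp only: image_id id_apply)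
    then have "even (card (k ` F \<inter> cols))" using e card_image_N[OF k(1)] by metis
    then have "commutes_to (k ` F) id" using F(1) k(1) by (intro commutes_to_rotation) simp_all
    from commutes_to_conj[OF this ev_in_N, of id w] have "commutes_to (ev w ` (k ` F)) id" by simp
    then show False using neg unfolding image_comp k(3) by simp
  qed
  let ?s = "\<lambda>c. even (card (F \<inter> full {c}))"
  have eq: "?s c \<longleftrightarrow> ?s c'" if v: "list_all (\<lambda>p.
       odd (length (filter (\<lambda>w. p \<in> set (map (ev (v @ w)) cls)) block_words)) = (col p = c \<or> col p = c')) pts"
     and "c \<noteq> c'" for v c c'
  proof -
    let ?B = "map (\<lambda>w. set (map (ev (v @ w)) cls)) block_words"
    have "p \<in> sd_list ?B \<longleftrightarrow> p \<in> sd (full {c}) (full {c'})" for p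
      using v \<open>c \<noteq> c'\<close> unfolding list_all_pts mem_sd_list mem_sd full_def
      by (auto simp: filter_map comp_def simp del: ev.simps)
    then have "sd_list ?B = sd (full {c}) (full {c'})" by blast
    then have "even (card (F \<inter> sd (full {c}) (full {c'}))) \<longleftrightarrow>
        even (length (filter (\<lambda>S. odd (card (F \<inter> S))) ?B))"
      using even_card_sd_list[of F ?B] by simp
    moreover have "filter (\<lambda>S. odd (card (F \<inter> S))) ?B = ?B"
      using odd by (intro filter_True) (auto simp only: set_map set_cls image_iff Ball_def)
    moreover have "even (length block_words)" by code_simp
    ultimately have "even (card (F \<inter> sd (full {c}) (full {c'})))" by (simp only: length_map)
    moreover have "F \<inter> sd (full {c}) (full {c'}) = sd (F \<inter> full {c}) (F \<inter> full {c'})"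
      by (auto simp: sd_def)
    ultimately show ?thesis by (simp add: even_card_sd)
  qed
  have all: "?s c \<longleftrightarrow> ?s P1" if "c \<in> cols" for c
  proof -
    \<comment> \<open>Powers of \<open>permA\<close> shift the relation for \<open>P1\<close> and
      \<open>P2\<close> to all neighbouring columns.\<close>
    have "?s P1 = ?s P2" "?s P2 = ?s P3" "?s P3 = ?s P4" "?s P4 = ?s P5" "?s P5 = ?s P6"
      "?s P6 = ?s P7" "?s P7 = ?s P8" "?s P8 = ?s P9" "?s P9 = ?s P10" "?s P10 = ?s P11"
      using block_words_ok[unfolded list.pred_inject prod.case]
      by (auto intro!: eq simp only: pt.distinct not_False_eq_True)
    then show ?thesis using that by auto
  qed
  have ev: "?s c" if "c \<in> cols" for c
  proof (rule ccontr)
    assume "\<not> ?s c"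
    then have "odd (card (F \<inter> S))" if "S \<in> set (map (\<lambda>c. full {c}) cls)" for S
      using that all \<open>c \<in> cols\<close> unfolding set_map set_cls by blast
    then have "filter (\<lambda>S. odd (card (F \<inter> S))) (map (\<lambda>c. full {c}) cls) = map (\<lambda>c. full {c}) cls"
      by (intro filter_True) blast
    moreover have "sd_list (map (\<lambda>c. full {c}) cls) = UNIV"
    proof -
      have "list_all (\<lambda>p. odd (length (filter (\<lambda>c. col p = c) cls))) pts" by code_simp
      then show ?thesis by (auto simp: list_all_pts mem_sd_list filter_map comp_def full_def)
    qed
    ultimately show False
      using even_card_sd_list[of F "map (\<lambda>c. full {c}) cls"] F(1) by (simp add: cls_def)
  qed
  have colF: "p \<in> F \<longleftrightarrow> col p \<in> F" for p
  proof (cases "p = col p")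
    case False
    have "even (card (F \<inter> {p, col p}))"
      using ev[OF col_in_cols] full_singleton[OF False] by metis
    then show ?thesis using False by (auto simp: Int_insert_right card_insert_if split: if_splits)
  qed simp
  have full: "F = full (F \<inter> cols)"
    using colF col_in_cols unfolding full_def by blast
  moreover have "odd (card (F \<inter> cols))" using odd[of "[]"] by (simp only: ev_Nil image_id id_apply not_False_eq_True)
  moreover have "F \<inter> cols \<noteq> cols"
  proof
    assume "F \<inter> cols = cols"
    then have "F = UNIV" using colF col_in_cols by blast
    then show False using F(2) by blast
  qed
  ultimately show False using commutes_to_full_odd[of "F \<inter> cols"] neg by simp
qed

section \<open>The noncommutator\<close>

definition halves :: "(pt \<Rightarrow> pt) \<Rightarrow> pt set \<Rightarrow> bool" where
  "halves x w \<longleftrightarrow> x ` w = w \<or> x ` w = - w"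

definition halves_ok :: "letter list \<Rightarrow> pt list \<Rightarrow> bool" where
  "halves_ok v w \<longleftrightarrow> list_all (\<lambda>p. (ev v p \<in> set w) = (p \<in> set w)) pts
     \<or> list_all (\<lambda>p. (ev v p \<in> set w) = (p \<notin> set w)) pts"

lemma halves_of_ok:
  assumes "halves_ok v w" shows "halves (ev v) (set w)"
proof -
  have N: "ev v \<in> N" by simp
  have surj: "\<exists>q. p = ev v q" for p using bij_is_surj[OF bij_N[OF N]] by (metis surjD)
  have "ev v ` set w = set w" if "\<forall>p. (ev v p \<in> set w) = (p \<in> set w)"
    using that surj by (auto simp: image_iff) (metis surj)
  moreover have "ev v ` set w = - set w" if "\<forall>p. (ev v p \<in> set w) = (p \<notin> set w)"
    using that surj by (auto simp: image_iff) (metis surj)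
  ultimately show ?thesis using assms unfolding halves_ok_def halves_def list_all_pts by blast
qed

definition odd_half :: "(pt \<Rightarrow> pt) \<Rightarrow> (pt \<Rightarrow> pt) \<Rightarrow> bool" where
  "odd_half x y \<longleftrightarrow> (\<exists>w. odd (card w) \<and> halves x w \<and> halves y w)"

lemma odd_half_sym: "odd_half x y \<Longrightarrow> odd_half y x"
  by (auto simp: odd_half_def)

lemma halves_conj:
  assumes t: "t \<in> N" and e: "x \<circ> t = t \<circ> x'" and h: "halves x' w"
  shows "halves x (t ` w)"
proof -
  have "x ` (t ` w) = t ` (x' ` w)" using e by (metis image_comp)
  then show ?thesis using h bij_image_Compl_eq[OF bij_N[OF t], of w] unfolding halves_def by metis
qed

text \<open>A set in \<^const>\<open>comm_space\<close> meets such a \<open>w\<close> in an even number of points, so that an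
  \<open>odd_half\<close> of all commuting pairs prevents \<open>(UNIV, id)\<close> from being a commutator.\<close>

lemma even_Int_halves:
  assumes x: "x \<in> N" and h: "halves x w" and v: "even (card v)"
  shows "even (card (x ` v \<inter> w)) \<longleftrightarrow> even (card (v \<inter> w))"
  using h unfolding halves_def
proof
  assume "x ` w = w"
  then have "x ` v \<inter> w = x ` (v \<inter> w)" by (simp add: image_Int[OF inj_N[OF x]])
  then show ?thesis using x by simp
next
  assume e: "x ` w = - w"
  have "x ` (v - w) = x ` v \<inter> w"
    unfolding image_set_diff[OF inj_N[OF x]] e by blast
  then have "card (x ` v \<inter> w) = card (v - w)" using card_image_N[OF x] by metis
  \<comment> \<open>Evenness of \<open>v\<close> enters here: it meets \<open>w\<close> and the
    complement of \<open>w\<close> in the same parity.\<close>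
  then show ?thesis using even_card_Compl[OF v, of w] by simp
qed

lemma even_comm_space_Int:
  assumes x: "x \<in> N" and y: "y \<in> N" and h: "halves x w" "halves y w" and S: "S \<in> comm_space x y"
  shows "even (card (S \<inter> w))"
proof -
  obtain u v where "S = sd (sd u (x ` v)) (sd v (y ` u))" "even (card u)" "even (card v)"
    using S unfolding comm_space_def by blast
  then show ?thesis
    using even_Int_halves[OF x h(1), of v] even_Int_halves[OF y h(2), of u]
    by (auto simp: sd_Int even_card_sd)
qed

text \<open>If \<open>y\<close> commutes with an \<open>h\<close> that sends the columns
  \<open>P1\<close>, \<open>P2\<close>, \<open>P3\<close> to \<open>P2\<close>, \<open>P3\<close>,
  \<open>P4\<close>, then \<open>base y\<close> is \<open>image_cols h (y P1)\<close>.\<close>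

definition image_cols :: "(pt \<Rightarrow> pt) \<Rightarrow> pt \<Rightarrow> pt list" where
  "image_cols x p = [col p, col (x p), col (x (x p)), col (x (x (x p)))]"

lemma image_cols_col:
  assumes x: "x \<in> N" shows "image_cols x (col p) = image_cols x p"
proof -
  have "x \<circ> x \<in> N" "x \<circ> x \<circ> x \<in> N" using x by (auto intro: comp_in_N)
  from col_N[OF x, of p] col_N[OF this(1), of p] col_N[OF this(2), of p]
  show ?thesis by (simp add: image_cols_def)
qed

lemma distinct_image_cols:
  assumes "y \<in> N" "distinct [col p, col q, col r, col s]"
  shows "distinct [col (y p), col (y q), col (y r), col (y s)]"
  using assms by (simp add: col_N_inj[OF assms(1)])

text \<open>Every admissible image of \<open>P1\<close> must have a candidate, so that a commuting
  element is found among them; the condition on \<open>w\<close> is required of candidates that do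
  commute.\<close>

lemma four_chain_table_ok:
  "list_all (\<lambda>(h, w, Ws). odd (card (set w)) \<and> halves_ok h w \<and> take 3 (base (ev h)) = [P2, P3, P4]
     \<and> list_all (\<lambda>c. distinct (image_cols (ev h) c) \<longrightarrow>
         list_ex (\<lambda>v. base (ev v) = image_cols (ev h) c \<and> (weq (v @ h) (h @ v) \<longrightarrow> halves_ok v w)) Ws) cls)
     four_chain_table"
  by code_simp

lemma three_cycle_table_ok:
  "case three_cycle_table of (h, w, Ws) \<Rightarrow> odd (card (set w)) \<and> halves_ok h w
     \<and> base (ev h) = [P2, P3, P1, P4]
     \<and> list_all (\<lambda>c. list_all (\<lambda>d. col (ev h d) = d \<longrightarrow>
          distinct [c, col (ev h c), col (ev h (ev h c)), d] \<longrightarrow>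
         list_ex (\<lambda>v. base (ev v) = [c, col (ev h c), col (ev h (ev h c)), d] \<and> halves_ok v w) Ws) cls) cls"
  by code_simp

text \<open>An element with a 3-cycle but no chain thus fixes a column. With this as fourth column,
  the normal form is the single \<open>h\<close> of \<open>three_cycle_table\<close>.\<close>

lemma three_cycle_words_ok:
  "list_all (\<lambda>h. has_chain (ev h) \<or> list_ex (\<lambda>c. col (ev h c) = c) cls) three_cycle_words"
  by code_simp

lemma involution_table_ok:
  "list_all (\<lambda>c. list_all (\<lambda>d. 
       distinct [c, col (ev involution_word c), d, col (ev involution_word d)] \<longrightarrow>
     list_ex (\<lambda>(v, w). base (ev v) = [c, col (ev involution_word c), d, col (ev involution_word d)]
         \<and> (weq (v @ v) [] \<longrightarrow> odd (card (set w)) \<and> halves_ok v w \<and> halves_ok involution_word w))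
       involution_table) cls) cls"
  by code_simp

lemma odd_half_conj:
  assumes t: "t \<in> N" and x: "x \<circ> t = t \<circ> x'" and y: "y \<circ> t = t \<circ> y'" and h: "odd_half x' y'"
  shows "odd_half x y"
  using h halves_conj[OF t x] halves_conj[OF t y] t unfolding odd_half_def by (metis card_image_N)

lemma conj_commuting:
  assumes t: "t \<in> N" and x: "x \<circ> t = t \<circ> x'" and y: "y \<in> N" and c: "x \<circ> y = y \<circ> x"
  obtains y' where "y' \<in> N" "y \<circ> t = t \<circ> y'" "x' \<circ> y' = y' \<circ> x'"
proof -
  obtain k where k: "k \<in> N" "k \<circ> t = id" "t \<circ> k = id" using N_inverse[OF t] by metis
  let ?y' = "k \<circ> (y \<circ> t)"
  have y': "y \<circ> t = t \<circ> ?y'" using k(3) by (simp flip: comp_assoc)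
  have "t (x' (?y' p)) = t (?y' (x' p))" for p
    using fun_cong[OF x, of "?y' p"] fun_cong[OF x, of p] fun_cong[OF y', of p] fun_cong[OF y', of "x' p"]
      fun_cong[OF c, of "t p"] by simp
  then have "x' \<circ> ?y' = ?y' \<circ> x'" using inj_N[OF t] by (auto simp: fun_eq_iff dest: injD)
  then show thesis using that[OF _ y'] k t y by (simp add: comp_in_N)
qed

lemma odd_half_of_chain:
  assumes x: "x \<in> N" and y: "y \<in> N" and c: "x \<circ> y = y \<circ> x" and ch: "has_chain x"
  shows "odd_half x y"
proof -
  obtain t h w Ws where t: "t \<in> N" and h: "(h, w, Ws) \<in> set four_chain_table" and xt: "x \<circ> t = t \<circ> ev h"
    by (rule conj_of_has_chain[OF x ch])
  obtain y' where y': "y' \<in> N" and yt: "y \<circ> t = t \<circ> y'" and c': "ev h \<circ> y' = y' \<circ> ev h"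
    by (rule conj_commuting[OF t xt y c])
  from bspec[OF four_chain_table_ok[unfolded list_all_iff] h]
  have w: "odd (card (set w))" "halves_ok h w" and b: "take 3 (base (ev h)) = [P2, P3, P4]"
    and tab: "\<And>c. c \<in> set cls \<Longrightarrow> distinct (image_cols (ev h) c) \<Longrightarrow>
      \<exists>v\<in>set Ws. base (ev v) = image_cols (ev h) c \<and> (weq (v @ h) (h @ v) \<longrightarrow> halves_ok v w)"
    by (auto simp: list_all_iff list_ex_iff)
  have hP: "col (ev h P1) = P2" "col (ev h P2) = P3" "col (ev h P3) = P4"
    using b by (simp_all add: base_def numeral_eq_Suc)
  have hy: "ev h (y' p) = y' (ev h p)" for p using fun_cong[OF c', of p] by simp
  have hP': "col (ev h P1) = col P2" "col (ev h P2) = col P3" "col (ev h P3) = col P4"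
    using hP by simp_all
  have N: "ev h \<in> N" by simp
  have s2: "col (y' P2) = col (ev h (y' P1))"
    using col_swap[OF y' hP'(1)] by (simp add: hy)
  have s3: "col (y' P3) = col (ev h (ev h (y' P1)))"
    using col_swap[OF y' hP'(2)] col_swap[OF N s2] by (simp add: hy)
  have s4: "col (y' P4) = col (ev h (ev h (ev h (y' P1))))"
    using col_swap[OF y' hP'(3)] col_swap[OF N s3] by (simp add: hy)
  let ?c = "col (y' P1)"
  have b': "base y' = image_cols (ev h) ?c"
    unfolding image_cols_col[OF N] by (simp add: base_def image_cols_def s2 s3 s4)
  have "distinct (base y')"
    using distinct_image_cols[OF y', of P1 P2 P3 P4] by (simp add: base_def)
  then obtain v where v: "v \<in> set Ws" "base (ev v) = base y'" "weq (v @ h) (h @ v) \<longrightarrow> halves_ok v w"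
    using tab[of ?c] col_in_cols b' set_cls by metis
  have "y' = ev v" using base_inj[OF y' ev_in_N] v(2) by simp
  then have "halves_ok v w" using v(3) c' by (simp add: weq_iff ev_append)
  then have "odd_half (ev h) y'"
    using w halves_of_ok \<open>y' = ev v\<close> unfolding odd_half_def by blast
  then show ?thesis by (rule odd_half_conj[OF t xt yt])
qed

lemma has_chain_conj:
  assumes t: "t \<in> N" and e: "x \<circ> t = t \<circ> x'" and ch: "has_chain x'" shows "has_chain x"
proof -
  obtain p where p: "distinct [col p, col (x' p), col (x' (x' p)), col (x' (x' (x' p)))]"
    using ch by (auto simp: has_chain_def list_ex_pts)
  have "x (t q) = t (x' q)" for q using fun_cong[OF e, of q] by simp
  then show ?thesis
    using distinct_image_cols[OF t p] unfolding has_chain_def list_ex_pts by (intro exI[of _ "t p"]) simp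
qed

lemma odd_half_of_three_cycle:
  assumes x: "x \<in> N" and y: "y \<in> N" and c: "x \<circ> y = y \<circ> x"
    and nch: "\<not> has_chain x" and c3: "has_three_cycle x"
  shows "odd_half x y"
proof -
  obtain p where p: "distinct [col p, col (x p), col (x (x p))]" "col (x (x (x p))) = col p"
    using c3 by (auto simp: has_three_cycle_def list_ex_pts)
  obtain u g where u: "u \<in> N" and g: "g \<in> set three_cycle_words" and xu: "x \<circ> u = u \<circ> ev g"
    by (rule conj_of_three_cycle[OF x c3])
  have "\<not> has_chain (ev g)" using has_chain_conj[OF u xu] nch by blast
  then obtain d where d: "d \<in> set cls" "col (ev g d) = d"
    using bspec[OF three_cycle_words_ok[unfolded list_all_iff] g] by (auto simp: list_ex_iff)
  let ?s = "u d"
  have s: "col (x ?s) = col ?s"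
  proof -
    have "col (x (u d)) = col (u (ev g d))" using fun_cong[OF xu, of d] by simp
    also have "\<dots> = col (u (col (ev g d)))" by (simp only: col_N[OF u])
    finally show ?thesis by (simp only: d(2))
  qed
  have ns: "col ?s \<noteq> col q" if "col (x q) \<noteq> col q" for q
    using that s col_swap[OF x] by metis
  have "col ?s \<noteq> col p" "col ?s \<noteq> col (x p)" "col ?s \<noteq> col (x (x p))"
    using p by (intro ns; auto)+
  then have "distinct [col p, col (x p), col (x (x p)), col ?s]" using p(1) by auto
  then obtain t x' where t: "t \<in> N" "x' \<in> N" "x \<circ> t = t \<circ> x'"
    and tp: "col (t P1) = col p" "col (t P2) = col (x p)" "col (t P3) = col (x (x p))" "col (t P4) = col ?s"
    and n: "\<forall>p q. col (x (t p)) = col (t q) \<longleftrightarrow> col (x' p) = col q"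
    by (rule conj_normal_form[OF x])
  have bx: "col (x' P1) = P2" "col (x' P2) = P3" "col (x' P3) = P1" "col (x' P4) = P4"
    using n[rule_format, of P1 P2] n[rule_format, of P2 P3] n[rule_format, of P3 P1]
      n[rule_format, of P4 P4] tp p(2) s
      col_swap[OF x tp(1)] col_swap[OF x tp(2)] col_swap[OF x tp(3)] col_swap[OF x tp(4)] by simp_all
  obtain h w Ws where tab: "three_cycle_table = (h, w, Ws)" by (metis surj_pair)
  from three_cycle_table_ok[unfolded tab prod.case]
  have w: "odd (card (set w))" "halves_ok h w" and b: "base (ev h) = [P2, P3, P1, P4]"
    and Ws: "\<And>c d. c \<in> set cls \<Longrightarrow> d \<in> set cls \<Longrightarrow> col (ev h d) = d \<Longrightarrow>
      distinct [c, col (ev h c), col (ev h (ev h c)), d] \<Longrightarrow>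
      \<exists>v\<in>set Ws. base (ev v) = [c, col (ev h c), col (ev h (ev h c)), d] \<and> halves_ok v w"
    unfolding list_all_iff list_ex_iff by blast+
  have x': "x' = ev h" using eq_ev_of_base[OF t(2)] b bx by simp
  obtain y' where y': "y' \<in> N" and yt: "y \<circ> t = t \<circ> y'" and c': "x' \<circ> y' = y' \<circ> x'"
    by (rule conj_commuting[OF t(1,3) y c])
  have hy: "x' (y' p) = y' (x' p)" for p using fun_cong[OF c', of p] by simp
  have bx': "col (x' P1) = col P2" "col (x' P2) = col P3" "col (x' P4) = col P4"
    using bx by simp_all
  have s2: "col (y' P2) = col (x' (y' P1))"
    using col_swap[OF y' bx'(1)] by (simp add: hy)
  have s3: "col (y' P3) = col (x' (x' (y' P1)))"
    using col_swap[OF y' bx'(2)] col_swap[OF t(2) s2] by (simp add: hy)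
  have s4: "col (x' (y' P4)) = col (y' P4)"
    using col_swap[OF y' bx'(3)] by (simp add: hy)
  let ?c = "col (y' P1)" and ?d = "col (y' P4)"
  have cd: "col (x' ?c) = col (x' (y' P1))" "col (x' (x' ?c)) = col (x' (x' (y' P1)))" "col (x' ?d) = ?d"
    using image_cols_col[OF t(2), of "y' P1"] s4 col_N[OF t(2)] by (simp_all add: image_cols_def)
  have b': "base y' = [?c, col (x' ?c), col (x' (x' ?c)), ?d]"
    by (simp add: base_def s2 s3 cd)
  have "distinct (base y')"
    using distinct_image_cols[OF y', of P1 P2 P3 P4] by (simp add: base_def)
  then obtain v where v: "v \<in> set Ws" "base (ev v) = base y'" "halves_ok v w"
    using Ws[of ?c ?d] col_in_cols b' cd(3) set_cls unfolding x' by metis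
  have "y' = ev v" using base_inj[OF y' ev_in_N] v(2) by simp
  then have "odd_half x' y'"
    using w v(3) halves_of_ok x' unfolding odd_half_def by blast
  then show ?thesis by (rule odd_half_conj[OF t(1,3) yt])
qed

lemma odd_half_of_involution:
  assumes x: "x \<in> N" "x \<noteq> id" and y: "y \<in> N" and c: "x \<circ> y = y \<circ> x"
    and sq: "\<And>p. col (x (x p)) = col p" "\<And>p. col (y (y p)) = col p"
  shows "odd_half x y"
proof -
  let ?i = "ev involution_word"
  obtain t where t: "t \<in> N" and xt: "x \<circ> t = t \<circ> ?i"
    by (rule conj_of_involution[OF x sq(1)])
  obtain y' where y': "y' \<in> N" and yt: "y \<circ> t = t \<circ> y'" and c': "?i \<circ> y' = y' \<circ> ?i"
    by (rule conj_commuting[OF t xt y c])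
  have "y \<circ> y = id"
    using base_inj[OF comp_in_N[OF y y] id_in_N] sq(2) by (simp add: base_def)
  then have "t \<circ> (y' \<circ> y') = t"
    using yt by (metis comp_assoc id_comp)
  then have yy: "y' \<circ> y' = id" using inj_N[OF t] by (auto simp: fun_eq_iff dest: injD)
  have "base ?i = [P2, P1, P4, P3]" by code_simp
  then have iP: "col (?i P1) = col P2" "col (?i P3) = col P4" by (simp_all add: base_def)
  have hy: "?i (y' p) = y' (?i p)" for p using fun_cong[OF c', of p] by simp
  have s: "col (y' P2) = col (?i (y' P1))" "col (y' P4) = col (?i (y' P3))"
    using col_swap[OF y' iP(1)] col_swap[OF y' iP(2)] by (simp_all add: hy)
  let ?c = "col (y' P1)" and ?d = "col (y' P3)"
  have b': "base y' = [?c, col (?i ?c), ?d, col (?i ?d)]"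
    using s col_N[OF ev_in_N] by (simp add: base_def)
  have d: "distinct [?c, col (?i ?c), ?d, col (?i ?d)]"
    using distinct_image_cols[OF y', of P1 P2 P3 P4] unfolding b'[symmetric] by (simp add: base_def)
  have cd: "?c \<in> set cls" "?d \<in> set cls" unfolding set_cls by (rule col_in_cols)+
  note tab = involution_table_ok[unfolded list_all_iff list_ex_iff, rule_format, OF cd d]
  then obtain v w where v: "base (ev v) = base y'"
      "weq (v @ v) [] \<longrightarrow> odd (card (set w)) \<and> halves_ok v w \<and> halves_ok involution_word w"
    unfolding b' by fast
  have v': "y' = ev v" using base_inj[OF y' ev_in_N] v(1) by simp
  then have "weq (v @ v) []" using yy by (simp only: weq_iff ev_append ev_Nil)
  then have "odd_half ?i y'"
    using v(2) halves_of_ok v' unfolding odd_half_def by blast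
  then show ?thesis by (rule odd_half_conj[OF t xt yt])
qed

text \<open>Since \<open>odd_half\<close> is symmetric, a chain or 3-cycle in either element
  suffices. Otherwise both square to the identity, which is why \<open>involution_table\<close>
  gives sets for elements of order at most 2 only.\<close>

lemma odd_half_commuting:
  assumes x: "x \<in> N" and y: "y \<in> N" and c: "x \<circ> y = y \<circ> x"
  shows "odd_half x y"
proof -
  note * = odd_half_of_chain odd_half_of_three_cycle
  consider "has_chain x \<or> has_three_cycle x" | "has_chain y \<or> has_three_cycle y"
    | "\<not> has_chain x" "\<not> has_three_cycle x" "\<not> has_chain y" "\<not> has_three_cycle y" by blast
  then show ?thesis
  proof cases
    case 1
    then show ?thesis using *[OF x y c] by blast
  next
    case 2
    then show ?thesis using *[OF y x c[symmetric]] odd_half_sym by blast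
  next
    case 3
    note sq = col_square_id[OF x 3(1,2)] col_square_id[OF y 3(3,4)]
    have "odd_half x y" if "x \<noteq> id" using odd_half_of_involution[OF x that y c sq] .
    moreover have "odd_half x y" if "y \<noteq> id"
      using odd_half_of_involution[OF y that x c[symmetric] sq(2,1)] by (rule odd_half_sym)
    moreover have "odd_half id id"
      unfolding odd_half_def halves_def by (intro exI[of _ "{P1}"]) simp
    ultimately show ?thesis by blast
  qed
qed

lemma not_commutes_to_UNIV: "\<not> commutes_to UNIV id"
proof
  assume "commutes_to UNIV id"
  then obtain x y where x: "x \<in> N" and y: "y \<in> N" and c: "x \<circ> y = y \<circ> x"
    and V: "(y \<circ> x) ` UNIV \<in> comm_space x y"
    unfolding commutes_to_def by auto
  have "(y \<circ> x) ` UNIV = UNIV" using bij_N[OF comp_in_N[OF y x]] bij_is_surj by blast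
  moreover obtain w where "odd (card w)" "halves x w" "halves y w"
    using odd_half_commuting[OF x y c] by (auto simp: odd_half_def)
  ultimately show False using even_comm_space_Int[OF x y _ _ V, of w] by simp
qed

section \<open>The wreath product\<close>

lemma (in group) eq_commutator_iff:
  assumes "a \<in> carrier G" "b \<in> carrier G" "c \<in> carrier G"
  shows "c = inv a \<otimes> inv b \<otimes> a \<otimes> b \<longleftrightarrow> b \<otimes> a \<otimes> c = a \<otimes> b"
proof -
  have "inv a \<otimes> inv b \<otimes> a \<otimes> b = inv (b \<otimes> a) \<otimes> (a \<otimes> b)"
    using assms by (simp add: inv_mult_group m_assoc)
  then show ?thesis
    using inv_solve_left[of c "b \<otimes> a" "a \<otimes> b"] assms by auto
qed

text \<open>A form free of inverses: those of \<open>KG\<close> are never computed, and the equation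
  is transported directly by isomorphisms.\<close>

lemma is_commutator_iff:
  assumes "group G" "c \<in> carrier G"
  shows "is_commutator G c \<longleftrightarrow>
    (\<exists>a\<in>carrier G. \<exists>b\<in>carrier G. b \<otimes>\<^bsub>G\<^esub> a \<otimes>\<^bsub>G\<^esub> c = a \<otimes>\<^bsub>G\<^esub> b)"
  using group.eq_commutator_iff[OF assms(1)] assms(2) unfolding is_commutator_def by blast

lemma is_commutator_in_derived:
  assumes "group G" "is_commutator G c"
  shows "c \<in> derived G (carrier G)"
proof -
  interpret group G by fact
  obtain a b where ab: "a \<in> carrier G" "b \<in> carrier G"
      "c = inv\<^bsub>G\<^esub> a \<otimes>\<^bsub>G\<^esub> inv\<^bsub>G\<^esub> b \<otimes>\<^bsub>G\<^esub> a \<otimes>\<^bsub>G\<^esub> b"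
    using assms(2) unfolding is_commutator_def by blast
  then have "c \<in> derived_set G (carrier G)"
    \<comment> \<open>\<open>derived_set\<close> consists of products
      \<open>h1 h2 (inv h1) (inv h2)\<close>, hence the inverses as witnesses.\<close>
    by (intro UN_I[of "inv\<^bsub>G\<^esub> a"] UN_I[of "inv\<^bsub>G\<^esub> b"]) auto
  then show ?thesis unfolding derived_def by (rule generate.incl)
qed

lemma is_commutator_iso:
  assumes f: "f \<in> iso G H" and G: "group G" and H: "group H" and c: "c \<in> carrier G"
  shows "is_commutator H (f c) \<longleftrightarrow> is_commutator G c"
proof -
  have hom: "f (x \<otimes>\<^bsub>G\<^esub> y) = f x \<otimes>\<^bsub>H\<^esub> f y" if "x \<in> carrier G" "y \<in> carrier G" for x y
    using f that by (auto simp: iso_def hom_mult)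
  have im: "f ` carrier G = carrier H" and inj: "inj_on f (carrier G)"
    using f by (auto simp: iso_def bij_betw_def)
  interpret group G by fact
  have "b \<otimes>\<^bsub>G\<^esub> a \<otimes>\<^bsub>G\<^esub> c = a \<otimes>\<^bsub>G\<^esub> b \<longleftrightarrow> f b \<otimes>\<^bsub>H\<^esub> f a \<otimes>\<^bsub>H\<^esub> f c = f a \<otimes>\<^bsub>H\<^esub> f b"
    if "a \<in> carrier G" "b \<in> carrier G" for a b
    using that c inj_on_eq_iff[OF inj, of "b \<otimes>\<^bsub>G\<^esub> a \<otimes>\<^bsub>G\<^esub> c" "a \<otimes>\<^bsub>G\<^esub> b"] by (simp add: hom)
  moreover have "f c \<in> carrier H" using im c by blast
  ultimately show ?thesis
    unfolding is_commutator_iff[OF G c] is_commutator_iff[OF H \<open>f c \<in> carrier H\<close>] im[symmetric] by auto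
qed

text \<open>\<open>KG\<close> is the wreath product of \<open>C\<^sub>2\<close> with \<open>N\<close>, a vector being represented by its support.\<close>

definition KG :: "(pt set \<times> (pt \<Rightarrow> pt)) monoid" where
  "KG = \<lparr>carrier = UNIV \<times> N,
         monoid.mult = (\<lambda>(F, g) (F', g'). (sd F (g ` F'), g \<circ> g')),
         one = ({}, id)\<rparr>"

definition even_elems :: "(pt set \<times> (pt \<Rightarrow> pt)) set" where
  "even_elems = {F. even (card F)} \<times> N"

lemma KG_simps [simp]:
  "carrier KG = UNIV \<times> N" "(F, g) \<otimes>\<^bsub>KG\<^esub> (F', g') = (sd F (g ` F'), g \<circ> g')" "\<one>\<^bsub>KG\<^esub> = ({}, id)"
  by (simp_all add: KG_def)

lemma group_KG: "group KG"
proof (rule groupI)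
  fix a assume "a \<in> carrier KG"
  then obtain F g where a: "a = (F, g)" "g \<in> N" by auto
  obtain k where "k \<in> N" "k \<circ> g = id" using N_inverse[OF a(2)] by metis
  then show "\<exists>b\<in>carrier KG. b \<otimes>\<^bsub>KG\<^esub> a = \<one>\<^bsub>KG\<^esub>"
    by (intro bexI[of _ "(k ` F, k)"]) (simp_all add: a)
next
  fix a b c assume "a \<in> carrier KG" "b \<in> carrier KG" "c \<in> carrier KG"
  then show "a \<otimes>\<^bsub>KG\<^esub> b \<otimes>\<^bsub>KG\<^esub> c = a \<otimes>\<^bsub>KG\<^esub> (b \<otimes>\<^bsub>KG\<^esub> c)"
    by (auto simp: sd_assoc image_sd[OF inj_N] image_comp comp_assoc)
qed (auto intro: comp_in_N)

lemma even_fst_mult: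
  assumes "a \<in> carrier KG" "b \<in> carrier KG"
  shows "even (card (fst (a \<otimes>\<^bsub>KG\<^esub> b))) \<longleftrightarrow> (even (card (fst a)) \<longleftrightarrow> even (card (fst b)))"
  using assms by (cases a; cases b) (simp add: even_card_sd)

lemma even_fst_inv:
  assumes "a \<in> carrier KG"
  shows "even (card (fst (inv\<^bsub>KG\<^esub> a))) \<longleftrightarrow> even (card (fst a))"
proof -
  interpret group KG by (rule group_KG)
  have "even (card (fst (a \<otimes>\<^bsub>KG\<^esub> inv\<^bsub>KG\<^esub> a)))" using r_inv[OF assms] by simp
  then show ?thesis using even_fst_mult[OF assms inv_closed[OF assms]] by blast
qed

lemma mem_even_elems: "a \<in> even_elems \<longleftrightarrow> a \<in> carrier KG \<and> even (card (fst a))"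
  by (cases a) (auto simp: even_elems_def)

lemma subgroup_even_elems: "subgroup even_elems KG"
proof -
  interpret group KG by (rule group_KG)
  show ?thesis
  proof (rule subgroupI)
    show "even_elems \<noteq> {}" using mem_even_elems[of "({}, id)"] by auto
    show "inv\<^bsub>KG\<^esub> a \<in> even_elems" if "a \<in> even_elems" for a
      using that even_fst_inv[of a] inv_closed[of a] unfolding mem_even_elems by blast
    show "a \<otimes>\<^bsub>KG\<^esub> b \<in> even_elems" if "a \<in> even_elems" "b \<in> even_elems" for a b
      using that even_fst_mult[of a b] m_closed[of a b] unfolding mem_even_elems by blast
  qed (auto simp: mem_even_elems)
qed

lemma commutator_KG_iff:
  assumes "x \<in> N" "y \<in> N" "g \<in> N"
  shows "(v, y) \<otimes>\<^bsub>KG\<^esub> (u, x) \<otimes>\<^bsub>KG\<^esub> (F, g) = (u, x) \<otimes>\<^bsub>KG\<^esub> (v, y) \<longleftrightarrow>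
    x \<circ> y = y \<circ> x \<circ> g \<and> (y \<circ> x) ` F = sd (sd u (x ` v)) (sd v (y ` u))"
  using sd_eq_iff[of "sd v (y ` u)" "(y \<circ> x) ` F" "sd u (x ` v)"] by (auto simp: sd_commute)

lemma commutes_to_iff:
  "commutes_to F g \<longleftrightarrow> (\<exists>(u, x)\<in>even_elems. \<exists>(v, y)\<in>even_elems.
      x \<circ> y = y \<circ> x \<circ> g \<and> (y \<circ> x) ` F = sd (sd u (x ` v)) (sd v (y ` u)))"
  unfolding commutes_to_def comm_space_def even_elems_def by fastforce

definition even_group :: "(pt set \<times> (pt \<Rightarrow> pt)) monoid" where
  "even_group = KG\<lparr>carrier := even_elems\<rparr>"

lemma group_even_group: "group even_group"
  unfolding even_group_def by (rule group.subgroup_imp_group[OF group_KG subgroup_even_elems])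

lemma is_commutator_even_group_iff:
  assumes "(F, g) \<in> even_elems"
  shows "is_commutator even_group (F, g) \<longleftrightarrow> commutes_to F g"
proof -
  have g: "g \<in> N" using assms by (simp add: even_elems_def)
  have c: "(F, g) \<in> carrier even_group" using assms by (simp add: even_group_def)
  have *: "is_commutator even_group (F, g) \<longleftrightarrow> (\<exists>a\<in>even_elems. \<exists>b\<in>even_elems.
      b \<otimes>\<^bsub>KG\<^esub> a \<otimes>\<^bsub>KG\<^esub> (F, g) = a \<otimes>\<^bsub>KG\<^esub> b)"
    using is_commutator_iff[OF group_even_group c] by (simp add: even_group_def)
  show ?thesis unfolding * commutes_to_iff
  proof (rule bex_cong[OF refl])
    fix a assume a: "a \<in> even_elems"
    obtain u x where ux: "a = (u, x)" by (cases a)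
    show "(\<exists>b\<in>even_elems. b \<otimes>\<^bsub>KG\<^esub> a \<otimes>\<^bsub>KG\<^esub> (F, g) = a \<otimes>\<^bsub>KG\<^esub> b) \<longleftrightarrow>
      (case a of (u, x) \<Rightarrow> \<exists>(v, y)\<in>even_elems.
        x \<circ> y = y \<circ> x \<circ> g \<and> (y \<circ> x) ` F = sd (sd u (x ` v)) (sd v (y ` u)))"
      unfolding ux prod.case
    proof (rule bex_cong[OF refl])
      fix b assume b: "b \<in> even_elems"
      obtain v y where vy: "b = (v, y)" by (cases b)
      have "x \<in> N" "y \<in> N" using a b by (simp_all add: ux vy even_elems_def)
      from commutator_KG_iff[OF this g]
      show "b \<otimes>\<^bsub>KG\<^esub> (u, x) \<otimes>\<^bsub>KG\<^esub> (F, g) = (u, x) \<otimes>\<^bsub>KG\<^esub> b \<longleftrightarrow>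
          (case b of (v, y) \<Rightarrow> x \<circ> y = y \<circ> x \<circ> g \<and> (y \<circ> x) ` F = sd (sd u (x ` v)) (sd v (y ` u)))"
        unfolding vy prod.case .
    qed
  qed
qed

lemma commutes_to_even:
  assumes "(F, g) \<in> even_elems" "(F, g) \<noteq> (UNIV, id)"
  shows "commutes_to F g"
  using assms commutes_to_id commutes_to_nontrivial by (auto simp: even_elems_def)

text \<open>The parity of the first component is a homomorphism, so commutators are even. Conversely
  all even elements but \<open>(UNIV, id)\<close> are commutators by
  \<open>commutes_to_even\<close>; that \<open>N\<close> is perfect comes out along the way.\<close>

lemma derived_KG: "derived KG (carrier KG) = even_elems"
proof
  interpret group KG by (rule group_KG)
  have "h1 \<otimes>\<^bsub>KG\<^esub> h2 \<otimes>\<^bsub>KG\<^esub> inv\<^bsub>KG\<^esub> h1 \<otimes>\<^bsub>KG\<^esub> inv\<^bsub>KG\<^esub> h2 \<in> even_elems"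
    if "h1 \<in> carrier KG" "h2 \<in> carrier KG" for h1 h2
    using that unfolding mem_even_elems
    by (simp only: even_fst_mult even_fst_inv m_closed inv_closed) blast
  then show "derived KG (carrier KG) \<subseteq> even_elems"
    unfolding derived_def by (intro generate_subgroup_incl subgroup_even_elems) blast
  have *: "c \<in> derived KG (carrier KG)" if c: "c \<in> even_elems" "c \<noteq> (UNIV, id)" for c
  proof -
    obtain F g where Fg: "c = (F, g)" by (cases c)
    have g: "g \<in> N" using c by (simp add: Fg even_elems_def)
    have "commutes_to F g" using c unfolding Fg by (rule commutes_to_even)
    then obtain u x v y where "x \<in> N" "y \<in> N" "x \<circ> y = y \<circ> x \<circ> g"
        "(y \<circ> x) ` F = sd (sd u (x ` v)) (sd v (y ` u))"
      unfolding commutes_to_def comm_space_def mem_Collect_eq by metis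
    then have "(v, y) \<otimes>\<^bsub>KG\<^esub> (u, x) \<otimes>\<^bsub>KG\<^esub> c = (u, x) \<otimes>\<^bsub>KG\<^esub> (v, y)"
      and ux: "(u, x) \<in> carrier KG" "(v, y) \<in> carrier KG"
      unfolding Fg using commutator_KG_iff[of x y g v u F] g by auto
    moreover have "c \<in> carrier KG" using g by (simp add: Fg)
    ultimately have "is_commutator KG c" using is_commutator_iff[OF group_KG] by blast
    then show ?thesis by (rule is_commutator_in_derived[OF group_KG])
  qed
  show "even_elems \<subseteq> derived KG (carrier KG)"
  proof
    fix c assume c: "c \<in> even_elems"
    show "c \<in> derived KG (carrier KG)"
    proof (cases "c = (UNIV, id)")
      case True
      \<comment> \<open>\<open>UNIV\<close> is the sum of a pair and its complement, and both of
        these are already reached.\<close>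
      let ?a = "(sd UNIV (pair P1 P2), id)" and ?b = "(pair P1 P2, id)"
      have "?a \<in> even_elems" "?b \<in> even_elems"
        by (simp_all add: even_elems_def even_card_sd card_pt)
      moreover have "P1 \<notin> sd UNIV (pair P1 P2)" "P3 \<notin> pair P1 P2" by (simp_all add: mem_sd)
      then have "?a \<noteq> (UNIV, id)" "?b \<noteq> (UNIV, id)" by blast+
      ultimately have "?a \<otimes>\<^bsub>KG\<^esub> ?b \<in> derived KG (carrier KG)"
        using * unfolding derived_def by (intro generate.eng) blast+
      then show ?thesis by (simp add: True sd_assoc)
    qed (use * c in blast)
  qed
qed

text \<open>Adding \<open>P1\<close> exchanges even and odd sets, so the order is
  \<open>2 ^ 21 * 7920\<close>.\<close>

lemma card_even_elems: "card even_elems = 16609443840"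
proof -
  let ?E = "{F :: pt set. even (card F)}" and ?O = "{F :: pt set. odd (card F)}"
  have "bij_betw (sd {P1}) ?E ?O"
    by (rule bij_betw_byWitness[where f' = "sd {P1}"]) (auto simp: even_card_sd)
  then have "card ?E = card ?O" by (rule bij_betw_same_card)
  moreover have "card ?E + card ?O = card (UNIV :: pt set set)"
    by (subst card_Un_disjoint[symmetric]) (auto intro: arg_cong[where f = card])
  moreover have "card (UNIV :: pt set set) = 2 ^ 22"
    using card_Pow[of "UNIV :: pt set"] by (simp add: card_pt)
  ultimately have "card ?E = 2 ^ 21" by simp
  then show ?thesis by (simp add: even_elems_def card_cartesian_product card_N)
qed

text \<open>The labelling from \<open>ex_labelling\<close> identifies \<Omega> with the 22 points; a
  set of points goes to its indicator function.\<close>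

lemma wreath_iso:
  fixes \<Omega> :: "'b set"
  assumes "transitive_action M11 \<Omega> \<phi>" and "card \<Omega> = 22"
  obtains \<Theta> where "\<Theta> \<in> iso KG (wreath_product (integer_mod_group 2) M11 \<Omega> \<phi>)"
proof -
  interpret A: transitive_action M11 \<Omega> \<phi> by fact
  interpret M: group M11 by (rule group_M11)
  let ?W = "wreath_product (integer_mod_group 2) M11 \<Omega> \<phi>"
  have down: "down g \<in> carrier M11" if "g \<in> N" for g using that by (simp add: carrier_M11)
  interpret N: N_action \<Omega> "\<lambda>g. \<phi> (down g)"
  proof
    show "\<phi> (down g) w \<in> \<Omega>" if "g \<in> N" "w \<in> \<Omega>" for g w
      using A.element_image[OF down that(2)] that by blast
    show "\<phi> (down (g \<circ> h)) w = \<phi> (down g) (\<phi> (down h) w)" if "g \<in> N" "h \<in> N" "w \<in> \<Omega>" for g h w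
      using A.composition_rule[OF that(3) down down] that by (simp add: mult_M11 down_comp)
    show "\<phi> (down id) w = w" if "w \<in> \<Omega>" for w
      using A.id_eq_one that unfolding down_id one_M11 by (metis restrict_apply')
    show "\<exists>g\<in>N. \<phi> (down g) v = w" if "v \<in> \<Omega>" "w \<in> \<Omega>" for v w
      using A.unique_orbit[OF that] by (auto simp: carrier_M11)
  qed fact
  obtain h where h: "bij_betw h UNIV \<Omega>" and eq: "\<And>g p. g \<in> N \<Longrightarrow> \<phi> (down g) (h p) = h (g p)"
    using N.ex_labelling by blast
  have injh: "inj h" and imh: "h ` UNIV = \<Omega>" using h by (auto simp: bij_betw_def)
  define \<chi> where "\<chi> F = (\<lambda>w\<in>\<Omega>. if w \<in> h ` F then 1 else 0 :: int)" for F
  have \<chi>h: "\<chi> F (h p) = (if p \<in> F then 1 else 0)" for F p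
    using imh injh by (auto simp: \<chi>_def inj_image_mem_iff)
  have ext: "f = f'" if "f \<in> extensional \<Omega>" "f' \<in> extensional \<Omega>" "\<And>p. f (h p) = f' (h p)" for f f' :: "'b \<Rightarrow> int"
    using that imh by (intro extensionalityI[of _ \<Omega>]) auto
  have \<chi>_ext: "\<chi> F \<in> extensional \<Omega>" for F by (simp add: \<chi>_def)
  have carW: "carrier ?W = (\<Pi>\<^sub>E w\<in>\<Omega>. {0..<2}) \<times> carrier M11"
    by (simp add: wreath_product_def carrier_integer_mod_group)
  define \<Theta> where "\<Theta> = (\<lambda>(F, g). (\<chi> F, down g))"
  have "\<Theta> \<in> hom KG ?W"
  proof (rule homI)
    show "\<Theta> a \<in> carrier ?W" if "a \<in> carrier KG" for a
      using that down unfolding carW \<Theta>_def by (auto simp: \<chi>_def)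
    show "\<Theta> (a \<otimes>\<^bsub>KG\<^esub> b) = \<Theta> a \<otimes>\<^bsub>?W\<^esub> \<Theta> b" if ab: "a \<in> carrier KG" "b \<in> carrier KG" for a b
    proof -
      obtain F g F' g' where Fg: "a = (F, g)" "b = (F', g')" "g \<in> N" "g' \<in> N" using ab by auto
      obtain k where k: "k \<in> N" "k \<circ> g = id" "g \<circ> k = id" using N_inverse[OF Fg(3)] by metis
      have "down k \<otimes>\<^bsub>M11\<^esub> down g = \<one>\<^bsub>M11\<^esub>"
        by (simp only: mult_M11 one_M11 down_comp[OF k(1) Fg(3), symmetric] k(2) down_id)
      then have inv: "inv\<^bsub>M11\<^esub> down g = down k"
        using M.inv_equality down Fg(3) k(1) by blast
      \<comment> \<open>The wreath product shifts a function by the inverse of \<open>g\<close>; on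
        supports this is the image under \<open>g\<close>.\<close>
      have mem: "p \<in> g ` F' \<longleftrightarrow> k p \<in> F'" for p
        using fun_cong[OF k(2)] fun_cong[OF k(3)] by (auto simp: image_iff) (metis)+
      have "\<chi> (sd F (g ` F')) = (\<lambda>w\<in>\<Omega>. (\<chi> F w + (\<lambda>w\<in>\<Omega>. \<chi> F' (\<phi> (inv\<^bsub>M11\<^esub> down g) w)) w) mod 2)"
      proof (rule ext)
        fix p
        have "h p \<in> \<Omega>" using imh by blast
        then show "\<chi> (sd F (g ` F')) (h p) =
            (\<lambda>w\<in>\<Omega>. (\<chi> F w + (\<lambda>w\<in>\<Omega>. \<chi> F' (\<phi> (inv\<^bsub>M11\<^esub> down g) w)) w) mod 2) (h p)"
          by (simp add: inv eq[OF k(1)] \<chi>h mem_sd mem)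
      qed (simp_all add: \<chi>_ext)
      then show ?thesis
        by (simp add: Fg \<Theta>_def wreath_product_def mult_M11 down_comp)
    qed
  qed
  moreover have "bij_betw \<Theta> (carrier KG) (carrier ?W)"
    unfolding bij_betw_def
  proof
    have "F = F'" if "\<chi> F = \<chi> F'" for F F'
    proof -
      have "(if p \<in> F then 1 else 0 :: int) = (if p \<in> F' then 1 else 0)" for p
        using \<chi>h[of F p] \<chi>h[of F' p] that by simp
      then show ?thesis by (metis subsetI subset_antisym zero_neq_one)
    qed
    then show "inj_on \<Theta> (carrier KG)"
      using down_inj by (auto simp: inj_on_def \<Theta>_def)
    show "\<Theta> ` carrier KG = carrier ?W"
    proof
      show "\<Theta> ` carrier KG \<subseteq> carrier ?W"
        using calculation by (auto simp: hom_def)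
      show "carrier ?W \<subseteq> \<Theta> ` carrier KG"
      proof
        fix a assume "a \<in> carrier ?W"
        then obtain f m where a: "a = (f, m)" "f \<in> (\<Pi>\<^sub>E w\<in>\<Omega>. {0..<2})" "m \<in> carrier M11"
          unfolding carW by blast
        obtain g where g: "g \<in> N" "m = down g" using a(3) unfolding carrier_M11 by blast
        have "f = \<chi> {p. f (h p) = 1}"
        proof (rule ext)
          fix p
          have "h p \<in> \<Omega>" using imh by blast
          then have "f (h p) \<in> {0..<2}" using a(2) by blast
          then show "f (h p) = \<chi> {p. f (h p) = 1} (h p)" by (auto simp: \<chi>h)
        qed (use a(2) in \<open>auto simp: PiE_iff \<chi>_ext\<close>)
        then show "a \<in> \<Theta> ` carrier KG"
          using g by (auto simp: a(1) \<Theta>_def intro!: image_eqI[of _ _ "({p. f (h p) = 1}, g)"])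
      qed
    qed
  qed
  ultimately show thesis using that unfolding iso_def by blast
qed

theorem mainTheorem1:
  fixes \<Omega> :: "'b set"
    and \<phi> :: "(nat \<Rightarrow> nat) \<Rightarrow> 'b \<Rightarrow> 'b"
  assumes "transitive_action M11 \<Omega> \<phi>"
    and "card \<Omega> = 22"
    and "\<forall>\<omega>\<in>\<Omega>. M11\<lparr>carrier := stabilizer M11 \<phi> \<omega>\<rparr> \<cong> alt_group 6"
  shows "order (MacHale_group \<Omega> \<phi>) = 16609443840
    \<and> (\<exists>!x. x \<in> carrier (MacHale_group \<Omega> \<phi>) \<and> \<not> is_commutator (MacHale_group \<Omega> \<phi>) x)"
proof -
  let ?W = "wreath_product (integer_mod_group 2) M11 \<Omega> \<phi>"
  obtain \<Theta> where iso: "\<Theta> \<in> iso KG ?W" using wreath_iso[OF assms(1,2)] .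
  have "group_action M11 \<Omega> \<phi>" using assms(1) by (simp add: transitive_action_def)
  then have W: "group ?W" by (intro group_wreath_product group_integer_mod_group)
  interpret hom: group_hom KG ?W \<Theta>
    using group_KG W iso by (simp add: group_hom_def group_hom_axioms_def iso_def)
  have im: "\<Theta> ` carrier KG = carrier ?W" and inj: "inj_on \<Theta> (carrier KG)"
    using iso by (auto simp: iso_def bij_betw_def)
  have sub: "even_elems \<subseteq> carrier KG" by (auto simp: even_elems_def)
  have der: "derived ?W (carrier ?W) = \<Theta> ` even_elems"
    using hom.derived_img[of "carrier KG"] unfolding im derived_KG by simp
  have car: "carrier (MacHale_group \<Omega> \<phi>) = \<Theta> ` even_elems"
    by (simp add: MacHale_group_def derived_subgroup_def der)
  have G: "group (MacHale_group \<Omega> \<phi>)"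
    unfolding MacHale_group_def derived_subgroup_def
    by (intro group.subgroup_imp_group[OF W] group.derived_is_subgroup[OF W]) simp
  have iso': "\<Theta> \<in> iso even_group (MacHale_group \<Omega> \<phi>)"
  proof -
    have "\<Theta> \<in> hom even_group (MacHale_group \<Omega> \<phi>)"
    proof (rule homI)
      show "\<Theta> a \<in> carrier (MacHale_group \<Omega> \<phi>)" if "a \<in> carrier even_group" for a
        using that by (auto simp: car even_group_def)
      show "\<Theta> (a \<otimes>\<^bsub>even_group\<^esub> b) = \<Theta> a \<otimes>\<^bsub>MacHale_group \<Omega> \<phi>\<^esub> \<Theta> b"
        if "a \<in> carrier even_group" "b \<in> carrier even_group" for a b
        using that hom.hom_mult[OF subsetD[OF sub, of a] subsetD[OF sub, of b]]
        by (simp add: even_group_def MacHale_group_def derived_subgroup_def del: KG_simps)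
    qed
    moreover have "bij_betw \<Theta> (carrier even_group) (carrier (MacHale_group \<Omega> \<phi>))"
      using inj_on_subset[OF inj sub] by (simp add: bij_betw_def car even_group_def)
    ultimately show ?thesis by (simp add: iso_def)
  qed
  have comm: "is_commutator (MacHale_group \<Omega> \<phi>) (\<Theta> c) \<longleftrightarrow> c \<noteq> (UNIV, id)" if "c \<in> even_elems" for c
  proof -
    have "is_commutator (MacHale_group \<Omega> \<phi>) (\<Theta> c) \<longleftrightarrow> is_commutator even_group c"
      using that by (intro is_commutator_iso[OF iso' group_even_group G]) (simp add: even_group_def)
    also have "\<dots> \<longleftrightarrow> c \<noteq> (UNIV, id)"
      using that is_commutator_even_group_iff commutes_to_even not_commutes_to_UNIV by (cases c) metis
    finally show ?thesis .
  qed
  have "(UNIV, id) \<in> even_elems" by (simp add: even_elems_def card_pt)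
  then have "\<exists>!x. x \<in> carrier (MacHale_group \<Omega> \<phi>) \<and> \<not> is_commutator (MacHale_group \<Omega> \<phi>) x"
    unfolding car using comm by (intro ex1I[of _ "\<Theta> (UNIV, id)"]) auto
  moreover have "order (MacHale_group \<Omega> \<phi>) = 16609443840"
    using card_image[OF inj_on_subset[OF inj sub]] by (simp add: order_def car card_even_elems)
  ultimately show ?thesis by blast
qed

end
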